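(* Suppose that the linear program $$\max_{\theta\in\mathbb{R}^d}\ \langle\mu,Q^\theta\rangle\qquad\text{subject to}\qquad\overline{g}(\theta,\phi)\le0\ \text{ for all }\phi\in\Phi$$ has a unique optimizer $\theta^*$. Then $$\lim_{N\to\infty}\theta_N^r=\lim_{N\to\infty}\theta_N=\theta^*\quad\text{with probability one},$$ and, with $\tilde\theta_N^r=\theta_N^r-\theta^*$, $$N\,\mathsf{E}\bigl[\tilde\theta_N^r(\tilde\theta_N^r)^\top\bigr]=\Sigma_\theta+O\bigl(\tfrac1{\sqrt N}\bigr),\qquad \sqrt N\,\tilde\theta_N^r\ \longrightarrow\ N(0,\Sigma_\theta)\ \text{ in distribution as }N\to\infty.$$ The covariance matrix may be expressed as $$\Sigma_\theta=[\bar A^+]^{-1}\Sigma_W([\bar A^+]^{-1})^\top,\qquad\Sigma_W=\lim_{N\to\infty}N\,\mathsf{E}[\overline W_N\overline W_N^\top].$$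
   Context: Markov decision process with finite state space $\mathsf{X}$, finite input space $\mathsf{U}$, $\mathsf{Z}=\mathsf{X}\times\mathsf{U}$, cost $c:\mathsf{Z}\to\mathbb{R}_+$, discount factor $\gamma\in(0,1)$, and controlled transition matrix $P_u(x,x')=\mathsf{P}\{X(k+1)=x'\mid X(k)=x,U(k)=u\}$. The input is defined by a randomized stationary policy, so that $Z(k)=(X(k),U(k))$ is a time-homogeneous Markov chain on $\mathsf{Z}$, assumed uni-chain and aperiodic, with unique invariant pmf $\varpi$; $\mathsf{E}_\varpi$ denotes expectation in steady state. $\mu$ is a pmf on $\mathsf{Z}$, and $\langle\mu,Q\rangle=\sum_z\mu(z)Q(z)$. $\psi:\mathsf{Z}\to\mathbb{R}^d$ is a vector of basis functions, $Q^\theta(x,u)=\theta^\top\psi(x,u)$, and $\underline{Q}^\theta(x)=\min_uQ^\theta(x,u)$. $\Phi$ is the set of deterministic policies $\phi:\mathsf{X}\to\mathsf{U}$, and $\phi^\theta(x)\in\arg\min_uQ^\theta(x,u)$ is the $Q^\theta$-greedy policy. $\{\zeta_k\}$ are random vectors in $\mathbb{R}^{d_+}$ with non-negative entries, $d_+>d$, where $\zeta_k$ is a function of $Z(k)$ (the same function for each $k$). Define $$\mathcal{D}_{k+1}(\theta)=-Q^\theta(Z(k))+c(Z(k))+\gamma\underline{Q}^\theta(X(k+1)),$$ $$\mathcal{D}_{k+1}(\theta,\phi)=c(Z(k))+\theta^\top\{-\psi(Z(k))+\gamma\psi(X(k+1),\phi(X(k+1)))\},$$ $$\overline g(\theta,\phi)=\mathsf{E}_\varpi[-\mathcal{D}_{k+1}(\theta,\phi)\zeta_k],\qquad\overline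 g_N(\theta)=\frac1N\sum_{k=0}^{N-1}[-\mathcal{D}_{k+1}(\theta)\zeta_k].$$ $\theta_N$ denotes the solution of: maximize $\langle\mu,Q^\theta\rangle$ over $\theta\in\mathbb{R}^d$ subject to $\overline g_N(\theta)\le0$ (component-wise). Fix $r>0$ with $|\theta_i^*|<r$ for each $i$; $\theta_N^r$ is the $L_\infty$ projection of $\theta_N$ onto $\{\theta\in\mathbb{R}^d:|\theta_i|\le r,\ 1\le i\le d\}$, with $\theta_N^r=0$ if the program defining $\theta_N$ is unbounded or infeasible. In the paper's setting, uniqueness of $\theta^*$ makes it a basic feasible solution of the limiting linear program, and $\mathcal{I}_+=\{j_1,\dots,j_d\}\subset\{1,\dots,d_+\}$ denotes the set of $d$ indices $i$ for which $\overline g^i(\theta^*,\phi^{\theta^*})=0$, the remaining components being strictly negative. Let $A_k^+$ be the $d\times d$ matrix with entries $$[A_k^+]_{i,j}=\bigl[\psi(Z(k-1))-\gamma\,\psi(X(k),\phi^{\theta^*}(X(k)))\bigr]_j\,\zeta_{k-1}^{j_i},$$ and let $\beta_k^+\in\mathbb{R}^d$ have $i$-th component $c(Z(k-1))\,\zeta_{k-1}^{j_i}$. Set $\bar A^+=\mathsf{E}_\varpi[A_k^+]$ (invertible, because $\theta^*$ is a basic feasible solution), $\bar\beta^+=\mathsf{E}_\varpi[\beta_k^+]$, $$W_k=\beta_k^+-\bar\beta^+-[A_k^+-\bar A^+]\theta^*,\qquad\overline W_N=\frac1N\sum_{k=1}^NW_k.$$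
   Formalization: Added assumption: at θ*, every constraint (i,φ) is strictly negative or is the same function of θ as (i,φ^{θ*}), so ties in the greedy policy add no different active constraint; with such ties the stated Gaussian limit can fail. *)

theory Defs
  imports "HOL-Probability.Probability" "HOL-Library.Landau_Symbols"
begin

text \<open>A transition kernel on a finite set is a function \<open>K :: 'z \<Rightarrow> 'z pmf\<close>.\<close>

text \<open>The joint law is written in product form, so that no convention is needed for
  conditioning on histories of probability zero. The law of \<open>Z 0\<close> is arbitrary.\<close>

definition markov_chain :: "'w measure \<Rightarrow> ('z \<Rightarrow> 'z pmf) \<Rightarrow> (nat \<Rightarrow> 'w \<Rightarrow> 'z) \<Rightarrow> bool" where
  "markov_chain M K Z \<longleftrightarrow>
     (\<forall>k. Z k \<in> measurable M (count_space UNIV)) \<and>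
     (\<forall>k z. measure M {w \<in> space M. \<forall>i\<le>Suc k. Z i w = z i} =
            measure M {w \<in> space M. \<forall>i\<le>k. Z i w = z i} * pmf (K (z k)) (z (Suc k)))"

definition transitions :: "('z \<Rightarrow> 'z pmf) \<Rightarrow> ('z \<times> 'z) set" where
  "transitions K = {(y, z). z \<in> set_pmf (K y)}"

text \<open>On a finite state space the recurrent classes are the closed communicating classes.\<close>

definition recurrent_class :: "('z \<Rightarrow> 'z pmf) \<Rightarrow> 'z set \<Rightarrow> bool" where
  "recurrent_class K C \<longleftrightarrow> C \<noteq> {} \<and> (\<forall>y\<in>C. (transitions K)\<^sup>* `` {y} = C)"

definition unichain :: "('z \<Rightarrow> 'z pmf) \<Rightarrow> bool" where
  "unichain K \<longleftrightarrow> (\<exists>!C. recurrent_class K C)"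

text \<open>Transient states are exempt: they need not have a period at all.\<close>

definition aperiodic :: "('z \<Rightarrow> 'z pmf) \<Rightarrow> bool" where
  "aperiodic K \<longleftrightarrow>
     (\<forall>C. recurrent_class K C \<longrightarrow>
        (\<forall>y\<in>C. Gcd {n. 0 < n \<and> (y, y) \<in> transitions K ^^ n} = (1::nat)))"

definition invariant_pmf :: "('z \<Rightarrow> 'z pmf) \<Rightarrow> 'z pmf \<Rightarrow> bool" where
  "invariant_pmf K \<pi> \<longleftrightarrow> bind_pmf \<pi> K = \<pi>"

text \<open>\<open>P u x\<close> is the law of the next state given state \<open>x\<close> and input \<open>u\<close>; \<open>pol x\<close> is the law
  of the input in state \<open>x\<close> under the randomized stationary policy.\<close>

definition closed_loop :: "('u \<Rightarrow> 'x \<Rightarrow> 'x pmf) \<Rightarrow> ('x \<Rightarrow> 'u pmf) \<Rightarrow> 'x \<times> 'u \<Rightarrow> ('x \<times> 'u) pmf" where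
  "closed_loop P pol z =
     bind_pmf (P (snd z) (fst z)) (\<lambda>x'. map_pmf (\<lambda>u'. (x', u')) (pol x'))"

text \<open>The law of \<open>(Z(k), X(k+1))\<close> when \<open>Z(k)\<close> has law \<open>\<pi>\<close>. All quantities below depend on the
  process only through such pairs, so steady-state expectations are taken with respect to it.\<close>

definition steady_pmf :: "('u \<Rightarrow> 'x \<Rightarrow> 'x pmf) \<Rightarrow> ('x \<times> 'u) pmf \<Rightarrow> (('x \<times> 'u) \<times> 'x) pmf" where
  "steady_pmf P \<pi> = bind_pmf \<pi> (\<lambda>z. map_pmf (\<lambda>x'. (z, x')) (P (snd z) (fst z)))"

definition Q_fun :: "('x \<times> 'u \<Rightarrow> real^'d) \<Rightarrow> real^'d \<Rightarrow> 'x \<times> 'u \<Rightarrow> real" where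
  "Q_fun \<psi> \<theta> z = \<theta> \<bullet> \<psi> z"

definition Q_min :: "('x \<times> 'u::finite \<Rightarrow> real^'d) \<Rightarrow> real^'d \<Rightarrow> 'x \<Rightarrow> real" where
  "Q_min \<psi> \<theta> x = (MIN u. Q_fun \<psi> \<theta> (x, u))"

definition greedy :: "('x \<times> 'u \<Rightarrow> real^'d) \<Rightarrow> real^'d \<Rightarrow> ('x \<Rightarrow> 'u) \<Rightarrow> bool" where
  "greedy \<psi> \<theta> \<phi> \<longleftrightarrow> (\<forall>x. is_arg_min (\<lambda>u. Q_fun \<psi> \<theta> (x, u)) (\<lambda>_. True) (\<phi> x))"

definition objective :: "('x::finite \<times> 'u::finite) pmf \<Rightarrow> ('x \<times> 'u \<Rightarrow> real^'d) \<Rightarrow> real^'d \<Rightarrow> real" where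
  "objective \<mu> \<psi> \<theta> = (\<Sum>z\<in>UNIV. pmf \<mu> z * Q_fun \<psi> \<theta> z)"

text \<open>Temporal differences, as functions of \<open>(Z(k), X(k+1))\<close>.\<close>

definition TD :: "('x \<times> 'u \<Rightarrow> real) \<Rightarrow> real \<Rightarrow> ('x \<times> 'u::finite \<Rightarrow> real^'d) \<Rightarrow> real^'d
    \<Rightarrow> ('x \<times> 'u) \<times> 'x \<Rightarrow> real" where
  "TD c \<gamma> \<psi> \<theta> = (\<lambda>(z, x'). - Q_fun \<psi> \<theta> z + c z + \<gamma> * Q_min \<psi> \<theta> x')"

definition TD_pol :: "('x \<times> 'u \<Rightarrow> real) \<Rightarrow> real \<Rightarrow> ('x \<times> 'u \<Rightarrow> real^'d) \<Rightarrow> real^'d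
    \<Rightarrow> ('x \<Rightarrow> 'u) \<Rightarrow> ('x \<times> 'u) \<times> 'x \<Rightarrow> real" where
  "TD_pol c \<gamma> \<psi> \<theta> \<phi> = (\<lambda>(z, x'). c z + \<theta> \<bullet> (- \<psi> z + \<gamma> *\<^sub>R \<psi> (x', \<phi> x')))"

definition g_bar :: "('u \<Rightarrow> 'x \<Rightarrow> 'x pmf) \<Rightarrow> ('x \<times> 'u) pmf \<Rightarrow> ('x \<times> 'u \<Rightarrow> real) \<Rightarrow> real
    \<Rightarrow> ('x \<times> 'u \<Rightarrow> real^'d) \<Rightarrow> ('x \<times> 'u \<Rightarrow> real^'p) \<Rightarrow> real^'d \<Rightarrow> ('x \<Rightarrow> 'u) \<Rightarrow> real^'p" where
  "g_bar P \<pi> c \<gamma> \<psi> \<zeta> \<theta> \<phi> =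
     measure_pmf.expectation (steady_pmf P \<pi>) (\<lambda>(z, x'). (- TD_pol c \<gamma> \<psi> \<theta> \<phi> (z, x')) *\<^sub>R \<zeta> z)"

definition g_emp :: "(nat \<Rightarrow> 'w \<Rightarrow> 'x \<times> 'u::finite) \<Rightarrow> ('x \<times> 'u \<Rightarrow> real) \<Rightarrow> real
    \<Rightarrow> ('x \<times> 'u \<Rightarrow> real^'d) \<Rightarrow> ('x \<times> 'u \<Rightarrow> real^'p) \<Rightarrow> nat \<Rightarrow> 'w \<Rightarrow> real^'d \<Rightarrow> real^'p" where
  "g_emp Z c \<gamma> \<psi> \<zeta> N w \<theta> =
     (1 / real N) *\<^sub>R (\<Sum>k<N. (- TD c \<gamma> \<psi> \<theta> (Z k w, fst (Z (Suc k) w))) *\<^sub>R \<zeta> (Z k w))"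

definition lim_feasible :: "('u \<Rightarrow> 'x \<Rightarrow> 'x pmf) \<Rightarrow> ('x \<times> 'u) pmf \<Rightarrow> ('x \<times> 'u \<Rightarrow> real) \<Rightarrow> real
    \<Rightarrow> ('x \<times> 'u \<Rightarrow> real^'d) \<Rightarrow> ('x \<times> 'u \<Rightarrow> real^'p) \<Rightarrow> (real^'d) set" where
  "lim_feasible P \<pi> c \<gamma> \<psi> \<zeta> = {\<theta>. \<forall>\<phi> i. g_bar P \<pi> c \<gamma> \<psi> \<zeta> \<theta> \<phi> $ i \<le> 0}"

definition emp_feasible :: "(nat \<Rightarrow> 'w \<Rightarrow> 'x \<times> 'u::finite) \<Rightarrow> ('x \<times> 'u \<Rightarrow> real) \<Rightarrow> real
    \<Rightarrow> ('x \<times> 'u \<Rightarrow> real^'d) \<Rightarrow> ('x \<times> 'u \<Rightarrow> real^'p) \<Rightarrow> nat \<Rightarrow> 'w \<Rightarrow> (real^'d) set" where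
  "emp_feasible Z c \<gamma> \<psi> \<zeta> N w = {\<theta>. \<forall>i. g_emp Z c \<gamma> \<psi> \<zeta> N w \<theta> $ i \<le> 0}"

definition lp_optimizer :: "('a \<Rightarrow> real) \<Rightarrow> 'a set \<Rightarrow> 'a \<Rightarrow> bool" where
  "lp_optimizer f F \<theta> \<longleftrightarrow> is_arg_max f (\<lambda>\<theta>'. \<theta>' \<in> F) \<theta>"

definition lp_infeasible_or_unbounded :: "('a \<Rightarrow> real) \<Rightarrow> 'a set \<Rightarrow> bool" where
  "lp_infeasible_or_unbounded f F \<longleftrightarrow> F = {} \<or> \<not> bdd_above (f ` F)"

text \<open>A nearest point in the \<open>L\<^sub>\<infinity>\<close> norm need not be unique; every nearest point is allowed
  (componentwise clipping to a box gives one).\<close>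

definition Linf_projection :: "'a::euclidean_space set \<Rightarrow> 'a \<Rightarrow> 'a \<Rightarrow> bool" where
  "Linf_projection S v y \<longleftrightarrow> is_arg_min (\<lambda>y'. infnorm (v - y')) (\<lambda>y'. y' \<in> S) y"

definition box_r :: "real \<Rightarrow> (real^'d) set" where
  "box_r r = {\<theta>. \<forall>i. \<bar>\<theta> $ i\<bar> \<le> r}"

text \<open>The limiting linear program has one constraint for each pair \<open>(i, \<phi>)\<close>. At the basic feasible
  solution \<open>\<theta>s\<close> exactly \<open>d\<close> of them are active, namely those with \<open>\<phi> = \<phi>s\<close> and \<open>i\<close> in the range of
  the enumeration \<open>j\<close>, and the remaining ones are strictly negative. Distinct policies can give rise
  to identical constraints (for instance when they differ only at states that are not visited), and
  such repetitions are not counted. The last conjunct thus says that a tie in the arg min defining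
  \<open>\<phi>s\<close> does not make a further, different constraint active at \<open>\<theta>s\<close>; it holds trivially if the greedy
  policy at \<open>\<theta>s\<close> is unique. With such a further constraint, the matrix \<open>A_bar\<close> below would depend on
  the choice of \<open>\<phi>s\<close>.\<close>

definition basic_solution :: "('u \<Rightarrow> 'x \<Rightarrow> 'x pmf) \<Rightarrow> ('x \<times> 'u) pmf \<Rightarrow> ('x \<times> 'u \<Rightarrow> real) \<Rightarrow> real
    \<Rightarrow> ('x \<times> 'u \<Rightarrow> real^'d) \<Rightarrow> ('x \<times> 'u \<Rightarrow> real^'p) \<Rightarrow> real^'d \<Rightarrow> ('x \<Rightarrow> 'u) \<Rightarrow> ('d \<Rightarrow> 'p) \<Rightarrow> bool" where
  "basic_solution P \<pi> c \<gamma> \<psi> \<zeta> \<theta>s \<phi>s j \<longleftrightarrow>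
     bij_betw j UNIV {i. g_bar P \<pi> c \<gamma> \<psi> \<zeta> \<theta>s \<phi>s $ i = 0} \<and>
     (\<forall>i. i \<notin> range j \<longrightarrow> g_bar P \<pi> c \<gamma> \<psi> \<zeta> \<theta>s \<phi>s $ i < 0) \<and>
     (\<forall>\<phi> i. g_bar P \<pi> c \<gamma> \<psi> \<zeta> \<theta>s \<phi> $ i < 0 \<or>
            (\<forall>\<theta>. g_bar P \<pi> c \<gamma> \<psi> \<zeta> \<theta> \<phi> $ i = g_bar P \<pi> c \<gamma> \<psi> \<zeta> \<theta> \<phi>s $ i))"

text \<open>\<open>A_mat\<close>, \<open>b_vec\<close> and \<open>W_vec\<close>, evaluated at \<open>(Z(k-1), X(k))\<close>, are \<open>A\<^sub>k\<^sup>+\<close>, \<open>\<beta>\<^sub>k\<^sup>+\<close> and \<open>W\<^sub>k\<close>.\<close>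

definition A_mat :: "real \<Rightarrow> ('x \<times> 'u \<Rightarrow> real^'d) \<Rightarrow> ('x \<times> 'u \<Rightarrow> real^'p) \<Rightarrow> ('x \<Rightarrow> 'u) \<Rightarrow> ('d \<Rightarrow> 'p)
    \<Rightarrow> ('x \<times> 'u) \<times> 'x \<Rightarrow> real^'d^'d" where
  "A_mat \<gamma> \<psi> \<zeta> \<phi> j = (\<lambda>(z, x'). \<chi> i l. (\<psi> z - \<gamma> *\<^sub>R \<psi> (x', \<phi> x')) $ l * \<zeta> z $ j i)"

definition b_vec :: "('x \<times> 'u \<Rightarrow> real) \<Rightarrow> ('x \<times> 'u \<Rightarrow> real^'p) \<Rightarrow> ('d \<Rightarrow> 'p)
    \<Rightarrow> ('x \<times> 'u) \<times> 'x \<Rightarrow> real^'d" where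
  "b_vec c \<zeta> j = (\<lambda>(z, x'). \<chi> i. c z * \<zeta> z $ j i)"

definition A_bar :: "('u \<Rightarrow> 'x \<Rightarrow> 'x pmf) \<Rightarrow> ('x \<times> 'u) pmf \<Rightarrow> real \<Rightarrow> ('x \<times> 'u \<Rightarrow> real^'d)
    \<Rightarrow> ('x \<times> 'u \<Rightarrow> real^'p) \<Rightarrow> ('x \<Rightarrow> 'u) \<Rightarrow> ('d \<Rightarrow> 'p) \<Rightarrow> real^'d^'d" where
  "A_bar P \<pi> \<gamma> \<psi> \<zeta> \<phi> j = measure_pmf.expectation (steady_pmf P \<pi>) (A_mat \<gamma> \<psi> \<zeta> \<phi> j)"

definition b_bar :: "('u \<Rightarrow> 'x \<Rightarrow> 'x pmf) \<Rightarrow> ('x \<times> 'u) pmf \<Rightarrow> ('x \<times> 'u \<Rightarrow> real)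
    \<Rightarrow> ('x \<times> 'u \<Rightarrow> real^'p) \<Rightarrow> ('d \<Rightarrow> 'p) \<Rightarrow> real^'d" where
  "b_bar P \<pi> c \<zeta> j = measure_pmf.expectation (steady_pmf P \<pi>) (b_vec c \<zeta> j)"

definition W_vec :: "('u \<Rightarrow> 'x \<Rightarrow> 'x pmf) \<Rightarrow> ('x \<times> 'u) pmf \<Rightarrow> ('x \<times> 'u \<Rightarrow> real) \<Rightarrow> real
    \<Rightarrow> ('x \<times> 'u \<Rightarrow> real^'d) \<Rightarrow> ('x \<times> 'u \<Rightarrow> real^'p) \<Rightarrow> real^'d \<Rightarrow> ('x \<Rightarrow> 'u) \<Rightarrow> ('d \<Rightarrow> 'p)
    \<Rightarrow> ('x \<times> 'u) \<times> 'x \<Rightarrow> real^'d" where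
  "W_vec P \<pi> c \<gamma> \<psi> \<zeta> \<theta>s \<phi> j y =
     b_vec c \<zeta> j y - b_bar P \<pi> c \<zeta> j - (A_mat \<gamma> \<psi> \<zeta> \<phi> j y - A_bar P \<pi> \<gamma> \<psi> \<zeta> \<phi> j) *v \<theta>s"

definition W_avg :: "('u \<Rightarrow> 'x \<Rightarrow> 'x pmf) \<Rightarrow> ('x \<times> 'u) pmf \<Rightarrow> (nat \<Rightarrow> 'w \<Rightarrow> 'x \<times> 'u)
    \<Rightarrow> ('x \<times> 'u \<Rightarrow> real) \<Rightarrow> real \<Rightarrow> ('x \<times> 'u \<Rightarrow> real^'d) \<Rightarrow> ('x \<times> 'u \<Rightarrow> real^'p)
    \<Rightarrow> real^'d \<Rightarrow> ('x \<Rightarrow> 'u) \<Rightarrow> ('d \<Rightarrow> 'p) \<Rightarrow> nat \<Rightarrow> 'w \<Rightarrow> real^'d" where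
  "W_avg P \<pi> Z c \<gamma> \<psi> \<zeta> \<theta>s \<phi> j N w =
     (1 / real N) *\<^sub>R (\<Sum>k=1..N. W_vec P \<pi> c \<gamma> \<psi> \<zeta> \<theta>s \<phi> j (Z (k - 1) w, fst (Z k w)))"

definition outer_prod :: "real^'d \<Rightarrow> real^'d \<Rightarrow> real^'d^'d" where
  "outer_prod v w = (\<chi> i l. v $ i * w $ l)"

text \<open>The centred normal law \<open>N(0, \<Sigma>)\<close>, specified by its characteristic function, so that singular
  covariance matrices are included.\<close>

definition centred_normal :: "(real^'d) measure \<Rightarrow> real^'d^'d \<Rightarrow> bool" where
  "centred_normal \<nu> \<Sigma> \<longleftrightarrow> prob_space \<nu> \<and> sets \<nu> = sets borel \<and>
     (\<forall>t. (CLINT x|\<nu>. iexp (t \<bullet> x)) = complex_of_real (exp (- (t \<bullet> (\<Sigma> *v t)) / 2)))"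

text \<open>The library's weak convergence is confined to measures on the real line.\<close>

definition converges_in_distribution ::
    "'w measure \<Rightarrow> (nat \<Rightarrow> 'w \<Rightarrow> 'a::euclidean_space) \<Rightarrow> 'a measure \<Rightarrow> bool" where
  "converges_in_distribution M Y \<nu> \<longleftrightarrow>
     (\<forall>f :: 'a \<Rightarrow> real. continuous_on UNIV f \<and> bounded (range f) \<longrightarrow>
        (\<lambda>n. integral\<^sup>L M (\<lambda>w. f (Y n w))) \<longlonglongrightarrow> integral\<^sup>L \<nu> f)"

end

theory Submission
  imports Defs "HOL-Real_Asymp.Real_Asymp"
begin

text \<open>
  The linear program that defines \<open>\<theta> N\<close> depends on the data only through the frequencies \<open>q\<close> of
  the pairs \<open>(Z k, X (k+1))\<close>, and the limiting program is the same program with the steady-state law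
  of such pairs in place of \<open>q\<close>. The proof therefore has a deterministic half, on how the optimizer
  moves with \<open>q\<close>, and a probabilistic half, on how far \<open>q\<close> is from the steady-state law.

  \<^bold>\<open>Deterministic half.\<close> A unique optimizer at which only the \<open>d\<close> constraints in the range of \<open>j\<close> are
  active is nondegenerate: the gradients of the active constraints are linearly independent, and the
  objective is a combination of them with strictly positive multipliers
  (\<open>cone_condition_multipliers\<close>). Positive multipliers survive small perturbations, so the
  perturbed optimizer still solves the square system of the active constraints, whatever the
  remaining constraints look like far away (\<open>lp_perturbation\<close>). Near \<open>\<theta>s\<close>, only ties in the
  minimum and pairs of steady-state probability zero could keep an active constraint from being
  affine. Ties are harmless, because greedy actions that tie at \<open>\<theta>s\<close> have the same basis vector
  wherever an active constraint sees them (\<open>tie_has_equal_basis\<close>), and null pairs contribute in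
  proportion to their mass (\<open>locally_feasible\<close>).
  The outcome is the expansion
  \<open>\<theta> - \<theta>s = Abar\<^sup>-\<^sup>1 (b q - A q \<theta>s) + O(m + \<delta>\<^sup>2)\<close>, where \<open>\<delta>\<close> is the distance of \<open>q\<close> from the steady-state
  law and \<open>m\<close> is the mass that \<open>q\<close> gives to null pairs (\<open>optimizer_expansion\<close>). For the empirical \<open>q\<close>
  the vector \<open>b q - A q \<theta>s\<close> is exactly the average of the noise \<open>W\<close>. Since \<open>\<theta>r N\<close> is bounded, the
  same bound for \<open>\<theta>r N\<close> extends to all samples, because \<open>\<delta>\<^sup>2\<close> is bounded below on the bad ones
  (\<open>pathwise_expansion\<close>).

  \<^bold>\<open>Probabilistic half.\<close> With a single recurrent class, the Poisson equation is solvable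
  (\<open>poisson_equation\<close>), and turns every centred additive functional of the chain into a martingale
  plus a bounded term, whatever the initial law. This gives \<open>E \<delta>\<^sup>2 = O(1/N)\<close> and \<open>E \<delta>\<^sup>4 = O(1/N\<^sup>2)\<close>,
  hence \<open>\<delta> \<rightarrow> 0\<close> almost surely, and the covariance of the averaged noise with error \<open>O(1/\<surd>N)\<close>. The
  number of visits to null pairs has a bounded second moment, so \<open>E m\<^sup>2 = O(1/N\<^sup>2)\<close>
  (\<open>null_pairs_second_moment\<close>). The remainder of the expansion is thus \<open>O(1/N)\<close> in root mean
  square, which is negligible for the limit law and costs \<open>O(1/\<surd>N)\<close> in the second moment.

  The central limit theorem is proved by following the characteristic function step by step; a second
  Poisson equation, for the conditional variances, makes each step a multiplication by a constant
  (\<open>martingale_clt\<close>). Convergence of characteristic functions and tightness yield convergence in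
  distribution by trigonometric approximation (\<open>convergence_of_characteristic_functions\<close>), and the
  limit law is written down explicitly as the law of a linear image of independent standard normal
  variables (\<open>gaussian_combination\<close>).
\<close>


section \<open>The Poisson equation on a finite state space\<close>

definition mean :: "'z::finite pmf \<Rightarrow> ('z \<Rightarrow> 'b) \<Rightarrow> 'b::real_vector" where
  "mean p f = (\<Sum>y\<in>UNIV. pmf p y *\<^sub>R f y)"

lemma mean_add: "mean p (\<lambda>y. f y + g y) = mean p f + mean p g"
  by (simp add: mean_def scaleR_add_right sum.distrib)

lemma mean_diff: "mean p (\<lambda>y. f y - g y) = mean p f - mean p g"
  by (simp add: mean_def scaleR_diff_right sum_subtractf)

lemma mean_cmult: "mean p (\<lambda>y. a * f y) = a * mean p f" for a :: "'b::real_algebra"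
  by (simp add: mean_def sum_distrib_left)

lemma mean_const [simp]: "mean p (\<lambda>_. a) = a"
  by (simp add: mean_def scaleR_left.sum[symmetric] sum_pmf_eq_1)

lemma mean_mono: "(\<And>y. f y \<le> g y) \<Longrightarrow> mean p f \<le> mean p g" for f :: "'z::finite \<Rightarrow> real"
  by (simp add: mean_def sum_mono mult_left_mono)

lemma norm_mean_le: "(\<And>y. norm (f y) \<le> B) \<Longrightarrow> norm (mean p f) \<le> B"
  for f :: "'z::finite \<Rightarrow> 'b::real_normed_vector"
proof -
  assume "\<And>y. norm (f y) \<le> B"
  then have "norm (mean p f) \<le> mean p (\<lambda>_. B)"
    unfolding mean_def by (intro sum_norm_le) (simp add: mult_left_mono)
  then show ?thesis by simp
qed

lemma mean_bind: "mean (bind_pmf p q) f = mean p (\<lambda>x. mean (q x) f)"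
proof -
  have "pmf (bind_pmf p q) y = (\<Sum>x\<in>UNIV. pmf p x * pmf (q x) y)" for y
    by (simp add: pmf_bind integral_measure_pmf[of UNIV])
  then have "mean (bind_pmf p q) f = (\<Sum>y\<in>UNIV. \<Sum>x\<in>UNIV. (pmf p x * pmf (q x) y) *\<^sub>R f y)"
    by (simp add: mean_def scaleR_left.sum)
  also have "\<dots> = (\<Sum>x\<in>UNIV. \<Sum>y\<in>UNIV. (pmf p x * pmf (q x) y) *\<^sub>R f y)"
    by (rule sum.swap)
  finally show ?thesis
    by (simp add: mean_def scaleR_sum_right)
qed

text \<open>Among the states of the closed set, take one that reaches as few states as possible. A state
  reached from it cannot reach fewer, so all of them reach the same set.\<close>

lemma closed_set_contains_recurrent_class:
  fixes K :: "'z::finite \<Rightarrow> 'z pmf"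
  assumes "S \<noteq> {}" and closed: "\<And>y z. y \<in> S \<Longrightarrow> z \<in> set_pmf (K y) \<Longrightarrow> z \<in> S"
  shows "\<exists>C. recurrent_class K C \<and> C \<subseteq> S"
proof -
  define R where "R y = (transitions K)\<^sup>* `` {y}" for y
  obtain y0 where "y0 \<in> S" using assms(1) by blast
  then obtain y where y: "y \<in> S" and min: "\<And>z. z \<in> S \<Longrightarrow> card (R y) \<le> card (R z)"
    using ex_has_least_nat[of "\<lambda>y. y \<in> S" y0 "\<lambda>y. card (R y)"] by blast
  have sub: "R z \<subseteq> S" if "z \<in> S" for z
  proof
    fix x assume "x \<in> R z"
    then have "(z, x) \<in> (transitions K)\<^sup>*" by (simp add: R_def)
    then show "x \<in> S"
      by (induction rule: rtrancl_induct) (use that closed in \<open>auto simp: transitions_def\<close>)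
  qed
  have "R z = R y" if "z \<in> R y" for z
  proof -
    have "R z \<subseteq> R y" using that by (auto simp: R_def)
    moreover have "card (R y) \<le> card (R z)" using sub[OF y] that min by blast
    ultimately show ?thesis by (intro card_seteq) auto
  qed
  moreover have "y \<in> R y" by (simp add: R_def)
  ultimately have "recurrent_class K (R y)"
    unfolding recurrent_class_def R_def[symmetric] by blast
  then show ?thesis using sub[OF y] by blast
qed

text \<open>An average of values that are at most \<open>m\<close> equals \<open>m\<close> only if every value that carries weight
  equals \<open>m\<close>.\<close>

lemma harmonic_maximum_closed:
  fixes K :: "'z::finite \<Rightarrow> 'z pmf" and h :: "'z \<Rightarrow> real"
  assumes harm: "\<And>z. h z = mean (K z) h" and le: "\<And>z. h z \<le> m"
    and y: "h y = m" and z: "z \<in> set_pmf (K y)"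
  shows "h z = m"
proof -
  have "(\<Sum>x\<in>UNIV. pmf (K y) x * (m - h x)) = mean (K y) (\<lambda>_. m) - mean (K y) h"
    unfolding mean_diff[symmetric] by (simp add: mean_def)
  also have "\<dots> = 0" using harm[of y] y by simp
  finally have "pmf (K y) z * (m - h z) = 0"
    by (subst (asm) sum_nonneg_eq_0_iff) (auto simp: le)
  then show ?thesis using z by (simp add: set_pmf_iff)
qed

text \<open>The sets where \<open>h\<close> is maximal and where it is minimal are both closed, so both contain the
  recurrent class.\<close>

lemma harmonic_constant:
  fixes K :: "'z::finite \<Rightarrow> 'z pmf" and h :: "'z \<Rightarrow> real"
  assumes "unichain K" and harm: "\<And>z. h z = mean (K z) h"
  shows "h y = h z"
proof -
  define hi where "hi = Max (range h)"
  define lo where "lo = Min (range h)"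
  have ht: "h x \<le> hi" and hb: "lo \<le> h x" for x by (simp_all add: hi_def lo_def)
  have "hi \<in> range h" "lo \<in> range h"
    unfolding hi_def lo_def by (intro Max_in Min_in; simp)+
  then have ne: "{x. h x = hi} \<noteq> {}" "{x. h x = lo} \<noteq> {}" by auto
  have "\<exists>C. recurrent_class K C \<and> C \<subseteq> {x. h x = hi}"
    by (rule closed_set_contains_recurrent_class[OF ne(1)])
      (use harmonic_maximum_closed[OF harm ht] in auto)
  moreover have "\<exists>C. recurrent_class K C \<and> C \<subseteq> {x. h x = lo}"
  proof (rule closed_set_contains_recurrent_class[OF ne(2)])
    fix x x' assume x: "x \<in> {x. h x = lo}" "x' \<in> set_pmf (K x)"
    have neg: "- h z = mean (K z) (\<lambda>x. - h x)" for z
      using harm[of z] mean_cmult[of "K z" "-1" h] by simp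
    have "- h x' = - lo"
      by (rule harmonic_maximum_closed[of "\<lambda>x. - h x" K "- lo" x x', OF neg]) (use x hb in auto)
    then show "x' \<in> {x. h x = lo}" by simp
  qed
  ultimately obtain C where "recurrent_class K C" "C \<subseteq> {x. h x = hi}" "C \<subseteq> {x. h x = lo}"
    using assms(1) unfolding unichain_def by metis
  then have "hi = lo" by (auto simp: recurrent_class_def)
  then show ?thesis using ht hb by (metis order_antisym)
qed

text \<open>The linear map \<open>L h = h - K h + \<pi> h\<close> is injective: integrating \<open>L h = 0\<close> against the invariant
  law gives \<open>\<pi> h = 0\<close>, so \<open>h\<close> is harmonic, hence constant, hence zero. In finite dimension \<open>L\<close> is then
  onto, and integrating \<open>L h = f - \<pi> f\<close> shows once more that \<open>\<pi> h = 0\<close>.\<close>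

lemma poisson_equation:
  fixes K :: "'z::finite \<Rightarrow> 'z pmf" and f :: "'z \<Rightarrow> real"
  assumes uni: "unichain K" and inv: "invariant_pmf K \<pi>"
  shows "\<exists>h. \<forall>z. h z - mean (K z) h = f z - mean \<pi> f"
proof -
  have inv': "mean \<pi> (\<lambda>z. mean (K z) h) = mean \<pi> h" for h :: "'z \<Rightarrow> real"
    using inv mean_bind[of \<pi> K h] by (simp add: invariant_pmf_def)
  define L :: "real^'z \<Rightarrow> real^'z" where
    "L v = (\<chi> z. v $ z - mean (K z) (($) v) + mean \<pi> (($) v))" for v
  have "mean p (($) (v + w)) = mean p (($) v) + mean p (($) w)"
    "mean p (($) (a *\<^sub>R v)) = a * mean p (($) v)" for p and v w :: "real^'z" and a
    by (simp_all add: mean_def algebra_simps sum.distrib sum_distrib_left)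
  then have "linear L"
    by (intro linearI) (simp_all add: L_def vec_eq_iff algebra_simps)
  have app: "mean \<pi> (\<lambda>z. v $ z - mean (K z) (($) v) + mean \<pi> (($) v)) = mean \<pi> (($) v)" for v :: "real^'z"
    by (simp add: mean_add mean_diff inv')
  have "inj L"
  proof (subst linear_injective_0[OF \<open>linear L\<close>], intro allI impI)
    fix v assume "L v = 0"
    then have eq: "v $ z - mean (K z) (($) v) + mean \<pi> (($) v) = 0" for z
      by (simp add: L_def vec_eq_iff)
    then have m0: "mean \<pi> (($) v) = 0" using app[of v] by simp
    then have "v $ z = mean (K z) (($) v)" for z using eq[of z] by simp
    from harmonic_constant[of K "($) v", OF uni this] have "v $ y = v $ z" for y z .
    then have "($) v = (\<lambda>_. v $ z)" for z by auto
    then have "v $ z = 0" for z using m0 by (metis mean_const)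
    then show "v = 0" by (simp add: vec_eq_iff)
  qed
  then have "surj L" by (rule linear_inj_imp_surj[OF \<open>linear L\<close>])
  then obtain v where "L v = (\<chi> z. f z - mean \<pi> f)" by (metis surjD)
  then have eq: "v $ z - mean (K z) (($) v) + mean \<pi> (($) v) = f z - mean \<pi> f" for z
    by (simp add: L_def vec_eq_iff)
  then have "mean \<pi> (($) v) = mean \<pi> (\<lambda>z. f z - mean \<pi> f)" using app[of v] by simp
  then have "mean \<pi> (($) v) = 0" by (simp add: mean_diff)
  then show ?thesis using eq by (intro exI[of _ "($) v"]) simp
qed

section \<open>The Markov property and martingale sums\<close>

text \<open>An adapted functional on a finite state space takes finitely many values, so it is measurable and
  integrable, and statements about it reduce to finite sums over initial segments of the path.\<close>

definition adapted :: "nat \<Rightarrow> ((nat \<Rightarrow> 'z) \<Rightarrow> 'b) \<Rightarrow> bool" where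
  "adapted k G \<longleftrightarrow> (\<forall>a b. (\<forall>i\<le>k. a i = b i) \<longrightarrow> G a = G b)"

locale unichain_process = prob_space M
  for M :: "'w measure" +
  fixes K :: "'z::finite \<Rightarrow> 'z pmf" and Z :: "nat \<Rightarrow> 'w \<Rightarrow> 'z" and \<pi> :: "'z pmf"
  assumes chain: "markov_chain M K Z"
    and unichain: "unichain K"
    and invariant: "invariant_pmf K \<pi>"
begin

abbreviation (input) path :: "'w \<Rightarrow> nat \<Rightarrow> 'z" where
  "path w i \<equiv> Z i w"

definition cylinder :: "nat \<Rightarrow> (nat \<Rightarrow> 'z) \<Rightarrow> 'w set" where
  "cylinder k a = {w \<in> space M. \<forall>i\<le>k. Z i w = a i}"

lemma measurable_Z [measurable]: "Z k \<in> measurable M (count_space UNIV)"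
  using chain by (simp add: markov_chain_def)

lemma cylinder_sets [measurable]: "cylinder k a \<in> sets M"
  unfolding cylinder_def by measurable

lemma cylinder_Suc: "measure M (cylinder (Suc k) a) = measure M (cylinder k a) * pmf (K (a k)) (a (Suc k))"
  using chain by (simp add: markov_chain_def cylinder_def)

lemma adapted_expansion:
  fixes G :: "(nat \<Rightarrow> 'z) \<Rightarrow> 'b::real_vector"
  assumes "adapted k G" "w \<in> space M"
  shows "G (path w) = (\<Sum>a\<in>PiE {..k} (\<lambda>_. UNIV). indicator (cylinder k a) w *\<^sub>R G a)"
proof -
  define a0 where "a0 = restrict (path w) {..k}"
  have a0: "a0 \<in> PiE {..k} (\<lambda>_. UNIV)" by (simp add: a0_def)
  have "(\<Sum>a\<in>PiE {..k} (\<lambda>_. UNIV). indicator (cylinder k a) w *\<^sub>R G a)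
      = (\<Sum>a\<in>PiE {..k} (\<lambda>_. UNIV). if a = a0 then G a else 0)"
  proof (rule sum.cong[OF refl])
    fix a :: "nat \<Rightarrow> 'z" assume a: "a \<in> PiE {..k} (\<lambda>_. UNIV)"
    have "w \<in> cylinder k a \<longleftrightarrow> a = a0"
    proof
      assume "w \<in> cylinder k a"
      then show "a = a0" by (intro PiE_ext[OF a a0]) (simp add: cylinder_def a0_def)
    qed (use assms(2) in \<open>simp add: cylinder_def a0_def\<close>)
    then show "indicator (cylinder k a) w *\<^sub>R G a = (if a = a0 then G a else 0)"
      by (simp add: indicator_def)
  qed
  also have "\<dots> = G a0" using a0 by (simp add: finite_PiE)
  also have "\<dots> = G (path w)"
    using assms(1) unfolding adapted_def by (rule allE[of _ a0]) (simp add: a0_def)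
  finally show ?thesis by simp
qed

lemma adapted_integrable:
  fixes G :: "(nat \<Rightarrow> 'z) \<Rightarrow> 'b::{banach, second_countable_topology}"
  assumes "adapted k G"
  shows "integrable M (\<lambda>w. G (path w))"
proof -
  have "integrable M (\<lambda>w. \<Sum>a\<in>PiE {..k} (\<lambda>_. UNIV). indicator (cylinder k a) w *\<^sub>R G a)"
    by (intro Bochner_Integration.integrable_sum integrable_scaleR_left integrable_real_indicator)
      (auto simp: emeasure_eq_measure)
  then show ?thesis
    by (rule Bochner_Integration.integrable_cong[THEN iffD1, rotated -1]) (simp_all add: adapted_expansion[OF assms])
qed

lemma adapted_expectation:
  fixes G :: "(nat \<Rightarrow> 'z) \<Rightarrow> 'b::{banach, second_countable_topology}"
  assumes "adapted k G"
  shows "expectation (\<lambda>w. G (path w)) = (\<Sum>a\<in>PiE {..k} (\<lambda>_. UNIV). prob (cylinder k a) *\<^sub>R G a)"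
proof -
  have "expectation (\<lambda>w. G (path w))
      = expectation (\<lambda>w. \<Sum>a\<in>PiE {..k} (\<lambda>_. UNIV). indicator (cylinder k a) w *\<^sub>R G a)"
    by (rule Bochner_Integration.integral_cong) (simp_all add: adapted_expansion[OF assms])
  also have "\<dots> = (\<Sum>a\<in>PiE {..k} (\<lambda>_. UNIV). expectation (\<lambda>w. indicator (cylinder k a) w *\<^sub>R G a))"
    by (intro Bochner_Integration.integral_sum integrable_scaleR_left integrable_real_indicator)
      (auto simp: emeasure_eq_measure)
  finally show ?thesis by (simp add: emeasure_eq_measure)
qed

text \<open>Both sides are sums over cylinder events; a cylinder of length \<open>k + 1\<close> is one of length \<open>k\<close>
  together with a value for the new coordinate, and the product form of the joint law factors the sum.\<close>

lemma markov_property: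
  fixes F :: "(nat \<Rightarrow> 'z) \<Rightarrow> 'z \<Rightarrow> 'b::{banach, second_countable_topology}"
  assumes ad: "\<And>z. adapted k (\<lambda>a. F a z)"
  shows "expectation (\<lambda>w. F (path w) (Z (Suc k) w)) =
         expectation (\<lambda>w. mean (K (Z k w)) (F (path w)))"
proof -
  let ?A = "PiE {..k} (\<lambda>_. UNIV) :: (nat \<Rightarrow> 'z) set"
  have upd: "F (a(Suc k := z)) y = F a y" for a z y
    using ad[of y] unfolding adapted_def by (metis fun_upd_apply not_less_eq_eq order_refl)
  have ad1: "adapted (Suc k) (\<lambda>a. F a (a (Suc k)))"
    using ad unfolding adapted_def by (metis le_SucI order_refl)
  have ad2: "adapted k (\<lambda>a. mean (K (a k)) (F a))"
    using ad unfolding adapted_def mean_def by (metis (no_types, lifting) order_refl sum.cong)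
  have bij: "bij_betw (\<lambda>(a, z). a(Suc k := z)) (?A \<times> UNIV) (PiE {..Suc k} (\<lambda>_. UNIV))"
    apply (rule bij_betw_byWitness[where f' = "\<lambda>a. (a(Suc k := undefined), a (Suc k))"])
    apply (auto simp: PiE_def extensional_def fun_eq_iff)
    done
  have c: "cylinder k (a(Suc k := z)) = cylinder k a" for a z
    by (auto simp: cylinder_def)
  have "expectation (\<lambda>w. F (path w) (Z (Suc k) w))
      = (\<Sum>a\<in>PiE {..Suc k} (\<lambda>_. UNIV). prob (cylinder (Suc k) a) *\<^sub>R F a (a (Suc k)))"
    using adapted_expectation[OF ad1] by simp
  also have "\<dots> = (\<Sum>(a, z)\<in>?A \<times> UNIV. (prob (cylinder k a) * pmf (K (a k)) z) *\<^sub>R F a z)"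
    by (subst sum.reindex_bij_betw[OF bij, symmetric])
      (auto intro!: sum.cong simp: cylinder_Suc c upd)
  also have "\<dots> = (\<Sum>a\<in>?A. prob (cylinder k a) *\<^sub>R mean (K (a k)) (F a))"
    by (simp add: sum.cartesian_product[symmetric] mean_def scaleR_sum_right)
  also have "\<dots> = expectation (\<lambda>w. mean (K (Z k w)) (F (path w)))"
    using adapted_expectation[OF ad2] by simp
  finally show ?thesis .
qed

end

lemma norm_lebesgue_integral_le:
  fixes f :: "'a \<Rightarrow> 'b::{banach, second_countable_topology}"
  assumes "integrable M f" "integrable M g" "\<And>x. x \<in> space M \<Longrightarrow> norm (f x) \<le> g x"
  shows "norm (integral\<^sup>L M f) \<le> integral\<^sup>L M g"
proof -
  have "norm (integral\<^sup>L M f) \<le> integral\<^sup>L M (\<lambda>x. norm (f x))" by (rule integral_norm_bound)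
  also have "\<dots> \<le> integral\<^sup>L M g" using assms by (intro integral_mono) auto
  finally show ?thesis .
qed

lemma finite_family_bound:
  fixes f :: "'c::finite \<Rightarrow> 'b::real_normed_vector"
  obtains B where "B \<ge> 0" "\<And>z. norm (f z) \<le> B"
proof
  show "norm (f z) \<le> (\<Sum>z\<in>UNIV. norm (f z))" for z by (rule member_le_sum) auto
qed (simp add: sum_nonneg)

lemma finite_family_bound2:
  fixes f :: "'c::finite \<Rightarrow> 'd::finite \<Rightarrow> 'b::real_normed_vector"
  obtains B where "B \<ge> 0" "\<And>z y. norm (f z y) \<le> B"
  using finite_family_bound[of "\<lambda>(z, y). f z y"] by (metis case_prod_conv)

lemma adapted_coordinate: "i \<le> k \<Longrightarrow> adapted k (\<lambda>a. f (a i))"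
  by (auto simp: adapted_def)

lemma adapted_comp: "adapted k G \<Longrightarrow> adapted k (\<lambda>a. f (G a))"
  unfolding adapted_def by metis

lemma adapted_comp2: "adapted k G \<Longrightarrow> adapted k H \<Longrightarrow> adapted k (\<lambda>a. f (G a) (H a))"
  unfolding adapted_def by metis

definition path_sum :: "('z \<Rightarrow> 'z \<Rightarrow> 'b) \<Rightarrow> nat \<Rightarrow> (nat \<Rightarrow> 'z) \<Rightarrow> 'b::comm_monoid_add" where
  "path_sum w n a = (\<Sum>k<n. w (a k) (a (Suc k)))"

lemma path_sum_0 [simp]: "path_sum w 0 a = 0"
  by (simp add: path_sum_def)

lemma path_sum_Suc [simp]: "path_sum w (Suc n) a = path_sum w n a + w (a n) (a (Suc n))"
  by (simp add: path_sum_def)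

lemma adapted_path_sum: "n \<le> k \<Longrightarrow> adapted k (path_sum w n)"
  unfolding adapted_def path_sum_def by (intro allI impI sum.cong) auto

text \<open>The telescoping behind every martingale decomposition: adding an increment of \<open>h\<close> changes the sum
  by boundary terms only.\<close>

lemma path_sum_coboundary:
  "path_sum (\<lambda>z z'. w z z' + h z' - h z) n a = path_sum w n a + h (a n) - h (a 0)"
  for w :: "'z \<Rightarrow> 'z \<Rightarrow> 'b::ab_group_add"
  by (induction n) (auto simp: algebra_simps)

context unichain_process
begin

definition stationary_mean :: "('z \<Rightarrow> 'z \<Rightarrow> 'b::real_vector) \<Rightarrow> 'b" where
  "stationary_mean w = mean \<pi> (\<lambda>z. mean (K z) (w z))"

text \<open>Increments with this property form martingale differences along the chain.\<close>

definition centred :: "('z \<Rightarrow> 'z \<Rightarrow> real) \<Rightarrow> bool" where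
  "centred D \<longleftrightarrow> (\<forall>z. mean (K z) (D z) = 0)"

lemma integrable_path_sum [simp]:
  fixes g :: "'b::comm_monoid_add \<Rightarrow> 'e::{banach, second_countable_topology}"
  shows "integrable M (\<lambda>w. g (path_sum f n (path w)))"
  by (rule adapted_integrable[where k = n and G = "\<lambda>a. g (path_sum f n a)"])
    (intro adapted_comp[where f = g] adapted_path_sum order_refl)

lemma integrable_path_sum2 [simp]:
  fixes g :: "'b::comm_monoid_add \<Rightarrow> 'c::comm_monoid_add \<Rightarrow> 'e::{banach, second_countable_topology}"
  shows "integrable M (\<lambda>w. g (path_sum f n (path w)) (path_sum f' n (path w)))"
  by (rule adapted_integrable[where k = n and G = "\<lambda>a. g (path_sum f n a) (path_sum f' n a)"])
    (intro adapted_comp2[where f = g] adapted_path_sum order_refl)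

lemma integrable_state [simp]:
  fixes g :: "'z \<Rightarrow> 'e::{banach, second_countable_topology}"
  shows "integrable M (\<lambda>w. g (Z n w))"
  by (rule adapted_integrable[where k = n and G = "\<lambda>a. g (a n)"]) (simp add: adapted_coordinate)

lemma integrable_path_sum_state [simp]:
  fixes g :: "'b::comm_monoid_add \<Rightarrow> 'z \<Rightarrow> 'e::{banach, second_countable_topology}"
  shows "integrable M (\<lambda>w. g (path_sum f n (path w)) (Z n w))"
  by (rule adapted_integrable[where k = n and G = "\<lambda>a. g (path_sum f n a) (a n)"])
    (intro adapted_comp2[where f = g] adapted_path_sum order_refl adapted_coordinate[where f = "\<lambda>x. x"])

lemma path_sum_step:
  fixes g :: "'b::comm_monoid_add \<Rightarrow> 'z \<Rightarrow> 'z \<Rightarrow> 'e::{banach, second_countable_topology}"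
  shows "expectation (\<lambda>w. g (path_sum f n (path w)) (Z n w) (Z (Suc n) w)) =
    expectation (\<lambda>w. mean (K (Z n w)) (g (path_sum f n (path w)) (Z n w)))"
  by (rule markov_property[where F = "\<lambda>a. g (path_sum f n a) (a n)"])
    (intro adapted_comp2[where f = "\<lambda>x y. g x y _"] adapted_path_sum order_refl
      adapted_coordinate[where f = "\<lambda>x. x"])

text \<open>The Poisson equation writes \<open>f - \<pi> f\<close> as a difference \<open>h - K h\<close>, whose expectations along the
  chain telescope.\<close>

lemma occupation_bound:
  fixes f :: "'z \<Rightarrow> real"
  shows "\<exists>C\<ge>0. \<forall>n. \<bar>(\<Sum>k<n. expectation (\<lambda>w. f (Z k w))) - real n * mean \<pi> f\<bar> \<le> C"
proof -
  obtain h where h: "\<And>z. h z - mean (K z) h = f z - mean \<pi> f"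
    using poisson_equation[OF unichain invariant, of f] by blast
  obtain H where H: "H \<ge> 0" "\<And>z. norm (h z) \<le> H" using finite_family_bound by blast
  have "expectation (\<lambda>w. f (Z k w)) - mean \<pi> f
      = expectation (\<lambda>w. h (Z k w)) - expectation (\<lambda>w. h (Z (Suc k) w))" for k
  proof -
    have "expectation (\<lambda>w. h (Z (Suc k) w)) = expectation (\<lambda>w. mean (K (Z k w)) h)"
      by (rule path_sum_step[where g = "\<lambda>_ _. h" and f = "\<lambda>_ _. 0::nat"])
    also have "\<dots> = expectation (\<lambda>w. h (Z k w) - (f (Z k w) - mean \<pi> f))"
    proof -
      have "mean (K z) h = h z - (f z - mean \<pi> f)" for z using h[of z] by linarith
      then show ?thesis by simp
    qed
    finally show ?thesis by (simp add: prob_space)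
  qed
  then have tele: "(\<Sum>k<n. expectation (\<lambda>w. f (Z k w)) - mean \<pi> f)
      = (\<Sum>k<n. expectation (\<lambda>w. h (Z k w)) - expectation (\<lambda>w. h (Z (Suc k) w)))" for n
    by (intro sum.cong) auto
  have eq: "(\<Sum>k<n. expectation (\<lambda>w. f (Z k w))) - real n * mean \<pi> f
      = expectation (\<lambda>w. h (Z 0 w)) - expectation (\<lambda>w. h (Z n w))" for n
    using tele[of n]
    unfolding sum_lessThan_telescope'[of "\<lambda>k. expectation (\<lambda>w. h (Z k w))" n]
    by (simp add: sum_subtractf)
  have le: "\<bar>expectation (\<lambda>w. h (Z n w))\<bar> \<le> H" for n
  proof -
    have "norm (expectation (\<lambda>w. h (Z n w))) \<le> expectation (\<lambda>w. H)"
      by (rule norm_lebesgue_integral_le) (use H in auto)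
    then show ?thesis by (simp add: prob_space)
  qed
  have "\<bar>(\<Sum>k<n. expectation (\<lambda>w. f (Z k w))) - real n * mean \<pi> f\<bar> \<le> 2 * H" for n
    unfolding eq using le[of 0] le[of n] by linarith
  then show ?thesis using H(1) by (intro exI[of _ "2 * H"]) auto
qed

text \<open>The corrector \<open>h\<close> solves the Poisson equation for the conditional mean of \<open>w\<close>.\<close>

lemma martingale_decomposition:
  fixes w :: "'z \<Rightarrow> 'z \<Rightarrow> real"
  assumes "stationary_mean w = 0"
  obtains h where "centred (\<lambda>z z'. w z z' + h z' - h z)"
proof -
  obtain h where h: "\<And>z. h z - mean (K z) h = mean (K z) (w z) - mean \<pi> (\<lambda>z. mean (K z) (w z))"
    using poisson_equation[OF unichain invariant, of "\<lambda>z. mean (K z) (w z)"] by blast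
  have "centred (\<lambda>z z'. w z z' + h z' - h z)"
    unfolding centred_def mean_diff mean_add mean_const
  proof
    fix z show "mean (K z) (w z) + mean (K z) h - h z = 0"
      using h[of z] assms by (simp add: stationary_mean_def)
  qed
  then show ?thesis by (rule that)
qed

text \<open>In the product of the two sums after one more step, the mixed terms contain one increment to the
  first power, which has conditional mean zero.\<close>

lemma martingale_covariance:
  assumes "centred D1" "centred D2"
  shows "expectation (\<lambda>w. path_sum D1 n (path w) * path_sum D2 n (path w)) =
    (\<Sum>k<n. expectation (\<lambda>w. mean (K (Z k w)) (\<lambda>z'. D1 (Z k w) z' * D2 (Z k w) z')))"
proof (induction n)
  case (Suc n)
  define E2 where "E2 a b z z' = (a + D1 z z') * (b + D2 z z')" for a b z z'
  have m: "mean (K z) (E2 a b z) = a * b + mean (K z) (\<lambda>z'. D1 z z' * D2 z z')" for a b z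
  proof -
    have "E2 a b z = (\<lambda>z'. a * b + a * D2 z z' + b * D1 z z' + D1 z z' * D2 z z')"
      by (simp add: E2_def fun_eq_iff algebra_simps)
    then show ?thesis using assms by (simp add: mean_add mean_cmult centred_def)
  qed
  have "expectation (\<lambda>w. path_sum D1 (Suc n) (path w) * path_sum D2 (Suc n) (path w))
    = expectation (\<lambda>w. E2 (path_sum D1 n (path w)) (path_sum D2 n (path w)) (Z n w) (Z (Suc n) w))"
    by (simp add: E2_def)
  also have "\<dots> = expectation (\<lambda>w. mean (K (Z n w))
      (E2 (path_sum D1 n (path w)) (path_sum D2 n (path w)) (Z n w)))"
    by (rule markov_property[where F = "\<lambda>a. E2 (path_sum D1 n a) (path_sum D2 n a) (a n)"])
      (auto simp: adapted_def path_sum_def)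
  also have "\<dots> = expectation (\<lambda>w. path_sum D1 n (path w) * path_sum D2 n (path w))
      + expectation (\<lambda>w. mean (K (Z n w)) (\<lambda>z'. D1 (Z n w) z' * D2 (Z n w) z'))"
    unfolding m
    by (rule Bochner_Integration.integral_add)
      (rule integrable_path_sum2[where g = "(*)"],
       rule integrable_state[where g = "\<lambda>z. mean (K z) (\<lambda>z'. D1 z z' * D2 z z')"])
  finally show ?case using Suc by simp
qed simp

lemma martingale_second_moment:
  assumes "centred D" and B: "\<And>z z'. \<bar>D z z'\<bar> \<le> B"
  shows "expectation (\<lambda>w. (path_sum D n (path w))\<^sup>2) \<le> B\<^sup>2 * real n"
proof -
  have "mean (K z) (\<lambda>z'. D z z' * D z z') \<le> mean (K z) (\<lambda>_. B\<^sup>2)" for z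
    by (rule mean_mono) (use B in \<open>metis abs_le_square_iff abs_of_nonneg abs_ge_zero order_trans power2_eq_square\<close>)
  then have "expectation (\<lambda>w. mean (K (Z k w)) (\<lambda>z'. D (Z k w) z' * D (Z k w) z')) \<le> expectation (\<lambda>_. B\<^sup>2)" for k
    by (intro integral_mono integrable_state[where g = "\<lambda>z. mean (K z) (\<lambda>z'. D z z' * D z z')"]) auto
  then have "expectation (\<lambda>w. mean (K (Z k w)) (\<lambda>z'. D (Z k w) z' * D (Z k w) z')) \<le> B\<^sup>2" for k
    by (simp add: prob_space)
  from sum_mono[of "{..<n}", OF this] show ?thesis
    using martingale_covariance[OF assms(1,1), of n] by (simp add: power2_eq_square mult.commute)
qed

text \<open>In \<open>(a + D)\<^sup>4\<close> the term \<open>4 a\<^sup>3 D\<close> averages to zero, so a step adds at most a multiple of \<open>a\<^sup>2\<close> plus a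
  constant. As the second moment grows linearly, the fourth grows quadratically.\<close>

lemma martingale_fourth_moment:
  assumes c: "centred D" and B: "\<And>z z'. \<bar>D z z'\<bar> \<le> B"
  shows "expectation (\<lambda>w. path_sum D n (path w) ^ 4) \<le> B ^ 4 * (4 * (real n)\<^sup>2 + 3 * real n)"
proof (induction n)
  case (Suc n)
  have B0: "B \<ge> 0" using B[of undefined undefined] by linarith
  have pw: "\<bar>D z z' ^ i\<bar> \<le> B ^ i" for z z' i
    unfolding power_abs by (rule power_mono) (use B in auto)
  have m: "mean (K z) (\<lambda>z'. (a + D z z') ^ 4) \<le> a ^ 4 + 8 * B\<^sup>2 * a\<^sup>2 + 3 * B ^ 4" for a z
  proof -
    have "(\<lambda>z'. (a + D z z') ^ 4) = (\<lambda>z'. a ^ 4 + 4 * a ^ 3 * D z z' + 6 * a\<^sup>2 * D z z' ^ 2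
        + 4 * a * D z z' ^ 3 + D z z' ^ 4)"
      by (simp add: fun_eq_iff power4_eq_xxxx power3_eq_cube power2_eq_square algebra_simps)
    then have "mean (K z) (\<lambda>z'. (a + D z z') ^ 4) = a ^ 4 + 6 * a\<^sup>2 * mean (K z) (\<lambda>z'. D z z' ^ 2)
        + 4 * a * mean (K z) (\<lambda>z'. D z z' ^ 3) + mean (K z) (\<lambda>z'. D z z' ^ 4)"
      using c by (simp add: mean_add mean_cmult centred_def)
    moreover have "\<bar>mean (K z) (\<lambda>z'. D z z' ^ i)\<bar> \<le> B ^ i" for i
      using norm_mean_le[of "\<lambda>z'. D z z' ^ i" "B ^ i" "K z"] pw by simp
    note mb = this
    moreover have "6 * a\<^sup>2 * mean (K z) (\<lambda>z'. D z z' ^ 2) \<le> 6 * a\<^sup>2 * B\<^sup>2"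
      using mb[of 2] by (intro mult_left_mono) auto
    moreover have "4 * a * mean (K z) (\<lambda>z'. D z z' ^ 3) \<le> 2 * a\<^sup>2 * B\<^sup>2 + 2 * B ^ 4"
    proof -
      have "4 * a * mean (K z) (\<lambda>z'. D z z' ^ 3) \<le> 4 * (\<bar>a\<bar> * B ^ 3)"
        using mult_left_mono[OF mb[of 3], of "\<bar>a\<bar>"] abs_ge_self[of "a * mean (K z) (\<lambda>z'. D z z' ^ 3)"]
        by (simp add: abs_mult)
      also have "\<dots> \<le> 2 * a\<^sup>2 * B\<^sup>2 + 2 * B ^ 4"
      proof -
        have "4 * (\<bar>a\<bar> * B) \<le> 2 * a\<^sup>2 + 2 * B\<^sup>2"
          using zero_le_power2[of "\<bar>a\<bar> - B"] by (simp add: power2_diff)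
        from mult_left_mono[OF this, of "B\<^sup>2"] show ?thesis
          by (simp add: power2_eq_square power4_eq_xxxx power3_eq_cube algebra_simps)
      qed
      finally show ?thesis .
    qed
    moreover have "mean (K z) (\<lambda>z'. D z z' ^ 4) \<le> B ^ 4" using mb[of 4] by simp
    ultimately show ?thesis by (simp add: algebra_simps)
  qed
  have "expectation (\<lambda>w. path_sum D (Suc n) (path w) ^ 4)
      = expectation (\<lambda>w. mean (K (Z n w)) (\<lambda>z'. (path_sum D n (path w) + D (Z n w) z') ^ 4))"
    using path_sum_step[where g = "\<lambda>a z z'. (a + D z z') ^ 4" and f = D and n = n] by simp
  also have "\<dots> \<le> expectation (\<lambda>w. path_sum D n (path w) ^ 4 + 8 * B\<^sup>2 * (path_sum D n (path w))\<^sup>2 + 3 * B ^ 4)"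
    by (intro integral_mono m
        integrable_path_sum_state[where g = "\<lambda>a z. mean (K z) (\<lambda>z'. (a + D z z') ^ 4)"]
        integrable_path_sum[where g = "\<lambda>a. a ^ 4 + 8 * B\<^sup>2 * a\<^sup>2 + 3 * B ^ 4"])
  also have "\<dots> = expectation (\<lambda>w. path_sum D n (path w) ^ 4)
      + 8 * B\<^sup>2 * expectation (\<lambda>w. (path_sum D n (path w))\<^sup>2) + 3 * B ^ 4"
    using integrable_path_sum[where g = "\<lambda>a. a ^ 4" and f = D and n = n]
      integrable_path_sum[where g = "\<lambda>a. a\<^sup>2" and f = D and n = n]
    by (simp add: prob_space)
  also have "\<dots> \<le> B ^ 4 * (4 * (real n)\<^sup>2 + 3 * real n) + 8 * B\<^sup>2 * (B\<^sup>2 * real n) + 3 * B ^ 4"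
    using martingale_second_moment[OF c B, of n] Suc
    by (intro add_mono mult_left_mono) auto
  also have "\<dots> \<le> B ^ 4 * (4 * (real (Suc n))\<^sup>2 + 3 * real (Suc n))"
    using zero_le_power[OF B0, of 4]
    by (simp add: power2_eq_square power4_eq_xxxx algebra_simps)
  finally show ?case .
qed simp

end


section \<open>Moments of additive functionals\<close>

lemma power4_add_le: "(x + y) ^ 4 \<le> 8 * x ^ 4 + 8 * y ^ 4" for x y :: real
proof -
  have "(x + y)\<^sup>2 \<le> 2 * x\<^sup>2 + 2 * y\<^sup>2"
    using zero_le_power2[of "x - y"] by (simp add: power2_diff power2_sum)
  then have "((x + y)\<^sup>2)\<^sup>2 \<le> (2 * x\<^sup>2 + 2 * y\<^sup>2)\<^sup>2"
    by (intro power_mono) auto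
  also have "\<dots> \<le> 8 * (x\<^sup>2)\<^sup>2 + 8 * (y\<^sup>2)\<^sup>2"
    using zero_le_power2[of "x\<^sup>2 - y\<^sup>2"] by (simp add: power2_diff power2_sum power_mult_distrib)
  finally show ?thesis by (simp flip: power_mult)
qed

lemma power2_add_le: "(x + y)\<^sup>2 \<le> 2 * x\<^sup>2 + 2 * y\<^sup>2" for x y :: real
  using zero_le_power2[of "x - y"] by (simp add: power2_diff power2_sum)

context unichain_process
begin

lemma path_sum_decomposition:
  fixes w :: "'z \<Rightarrow> 'z \<Rightarrow> real"
  assumes "stationary_mean w = 0"
  obtains D h B H where "centred D" "D = (\<lambda>z z'. w z z' + h z' - h z)"
    "B \<ge> 0" "\<And>z z'. \<bar>D z z'\<bar> \<le> B" "H \<ge> 0" "\<And>n a. \<bar>path_sum w n a - path_sum D n a\<bar> \<le> H"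
proof -
  obtain h where c: "centred (\<lambda>z z'. w z z' + h z' - h z)"
    using martingale_decomposition[OF assms] by blast
  define D where "D = (\<lambda>z z'. w z z' + h z' - h z)"
  obtain H where H: "H \<ge> 0" "\<And>z. norm (h z) \<le> H" using finite_family_bound[of h] by blast
  obtain B where B: "B \<ge> 0" "\<And>z z'. norm (D z z') \<le> B" using finite_family_bound2[of D] by blast
  have "\<bar>path_sum w n a - path_sum D n a\<bar> \<le> 2 * H" for n a
    unfolding D_def path_sum_coboundary using H(2)[of "a n"] H(2)[of "a 0"] by simp
  then show ?thesis using that[of D h B "2 * H"] c B H by (simp add: D_def)
qed

lemma path_sum_moments:
  assumes "stationary_mean w = 0"
  shows "\<exists>C\<ge>0. \<forall>n\<ge>1. expectation (\<lambda>x. (path_sum w n (path x))\<^sup>2) \<le> C * real n \<and>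
    expectation (\<lambda>x. path_sum w n (path x) ^ 4) \<le> C * (real n)\<^sup>2"
proof -
  obtain D h B H where c: "centred D" and B: "B \<ge> 0" "\<And>z z'. \<bar>D z z'\<bar> \<le> B"
    and H: "H \<ge> 0" "\<And>n a. \<bar>path_sum w n a - path_sum D n a\<bar> \<le> H"
    using path_sum_decomposition[OF assms] by metis
  define C2 where "C2 = 2 * B\<^sup>2 + 2 * H\<^sup>2"
  define C4 where "C4 = 56 * B ^ 4 + 8 * H ^ 4"
  have n1: "1 \<le> real n" "real n \<le> (real n)\<^sup>2" "1 \<le> (real n)\<^sup>2" if "n \<ge> 1" for n
    using that by (simp_all add: power2_eq_square) (metis One_nat_def mult_le_mono of_nat_1 of_nat_le_iff of_nat_mult nat_mult_1)
  have le: "expectation (\<lambda>x. (path_sum w n (path x))\<^sup>2) \<le> C2 * real n" if "n \<ge> 1" for n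
  proof -
    have "(path_sum w n a)\<^sup>2 \<le> 2 * (path_sum D n a)\<^sup>2 + 2 * H\<^sup>2" for a
    proof -
      have "(path_sum w n a - path_sum D n a)\<^sup>2 \<le> H\<^sup>2"
        using H by (metis abs_ge_zero power2_abs power_mono)
      then show ?thesis
        using power2_add_le[of "path_sum D n a" "path_sum w n a - path_sum D n a"] by simp
    qed
    then have "expectation (\<lambda>x. (path_sum w n (path x))\<^sup>2)
        \<le> expectation (\<lambda>x. 2 * (path_sum D n (path x))\<^sup>2 + 2 * H\<^sup>2)"
      by (intro integral_mono integrable_path_sum[where g = "\<lambda>a. 2 * a\<^sup>2 + 2 * H\<^sup>2"]
          integrable_path_sum[where g = "\<lambda>a. a\<^sup>2"])
    also have "\<dots> = 2 * expectation (\<lambda>x. (path_sum D n (path x))\<^sup>2) + 2 * H\<^sup>2"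
      using integrable_path_sum[where g = "\<lambda>a. a\<^sup>2" and f = D and n = n] by (simp add: prob_space)
    also have "\<dots> \<le> 2 * (B\<^sup>2 * real n) + 2 * H\<^sup>2 * real n"
      using martingale_second_moment[OF c B(2), of n] n1[OF that]
        mult_left_mono[OF n1(1)[OF that], of "2 * H\<^sup>2"] by (intro add_mono mult_left_mono) auto
    finally show ?thesis by (simp add: C2_def algebra_simps)
  qed
  have le4: "expectation (\<lambda>x. path_sum w n (path x) ^ 4) \<le> C4 * (real n)\<^sup>2" if "n \<ge> 1" for n
  proof -
    have "path_sum w n a ^ 4 \<le> 8 * path_sum D n a ^ 4 + 8 * H ^ 4" for a
    proof -
      have "(path_sum w n a - path_sum D n a) ^ 4 \<le> H ^ 4"
        using power_mono[OF H(2)[of n a], of 4] by (simp add: power_even_abs)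
      then show ?thesis
        using power4_add_le[of "path_sum D n a" "path_sum w n a - path_sum D n a"] by simp
    qed
    then have "expectation (\<lambda>x. path_sum w n (path x) ^ 4)
        \<le> expectation (\<lambda>x. 8 * path_sum D n (path x) ^ 4 + 8 * H ^ 4)"
      by (intro integral_mono integrable_path_sum[where g = "\<lambda>a. 8 * a ^ 4 + 8 * H ^ 4"]
          integrable_path_sum[where g = "\<lambda>a. a ^ 4"])
    also have "\<dots> = 8 * expectation (\<lambda>x. path_sum D n (path x) ^ 4) + 8 * H ^ 4"
      using integrable_path_sum[where g = "\<lambda>a. a ^ 4" and f = D and n = n] by (simp add: prob_space)
    also have "\<dots> \<le> 8 * (B ^ 4 * (4 * (real n)\<^sup>2 + 3 * real n)) + 8 * H ^ 4"
      using martingale_fourth_moment[OF c B(2), of n] by simp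
    also have "\<dots> \<le> 8 * (B ^ 4 * (4 * (real n)\<^sup>2 + 3 * (real n)\<^sup>2)) + 8 * H ^ 4 * (real n)\<^sup>2"
      using n1[OF that] mult_left_mono[OF n1(3)[OF that], of "8 * H ^ 4"]
      by (intro add_mono mult_left_mono) auto
    finally show ?thesis by (simp add: C4_def algebra_simps)
  qed
  have C: "C2 \<ge> 0" "C4 \<ge> 0" using B H by (auto simp: C2_def C4_def)
  show ?thesis
  proof (intro exI[of _ "C2 + C4"] conjI allI impI)
    fix n :: nat assume n: "n \<ge> 1"
    show "expectation (\<lambda>x. (path_sum w n (path x))\<^sup>2) \<le> (C2 + C4) * real n"
      using le[OF n] mult_right_mono[of C2 "C2 + C4" "real n"] C by auto
    show "expectation (\<lambda>x. path_sum w n (path x) ^ 4) \<le> (C2 + C4) * (real n)\<^sup>2"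
      using le4[OF n] mult_right_mono[of C4 "C2 + C4" "(real n)\<^sup>2"] C by auto
  qed (use C in auto)
qed

text \<open>A linear form of the Cauchy-Schwarz inequality; the best choice of \<open>a\<close> is the root mean square.\<close>

lemma expectation_abs_le:
  fixes X :: "'w \<Rightarrow> real"
  assumes "integrable M (\<lambda>x. (X x)\<^sup>2)" "integrable M X" "a > 0"
  shows "expectation (\<lambda>x. \<bar>X x\<bar>) \<le> (expectation (\<lambda>x. (X x)\<^sup>2) / a + a) / 2"
proof -
  have "\<bar>X x\<bar> \<le> ((X x)\<^sup>2 / a + a) / 2" for x
    using zero_le_power2[of "\<bar>X x\<bar> - a"] assms(3) by (simp add: power2_diff field_simps power2_eq_square)
  then have "expectation (\<lambda>x. \<bar>X x\<bar>) \<le> expectation (\<lambda>x. ((X x)\<^sup>2 / a + a) / 2)"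
    using assms by (intro integral_mono) auto
  also have "\<dots> = (expectation (\<lambda>x. (X x)\<^sup>2) / a + a) / 2"
    using assms by (simp add: prob_space)
  finally show ?thesis .
qed

text \<open>For the martingale parts the covariance is an occupation sum, known up to a bounded error. Replacing
  the sums by their martingale parts changes each factor by a bounded amount, which multiplies the
  other factor, of mean size \<open>O(\<surd>n)\<close>.\<close>

lemma path_sum_covariance:
  assumes "stationary_mean w1 = 0" "stationary_mean w2 = 0"
    and D1: "centred D1" "D1 = (\<lambda>z z'. w1 z z' + h1 z' - h1 z)"
    and D2: "centred D2" "D2 = (\<lambda>z z'. w2 z z' + h2 z' - h2 z)"
  shows "\<exists>C\<ge>0. \<forall>n\<ge>1. \<bar>expectation (\<lambda>x. path_sum w1 n (path x) * path_sum w2 n (path x))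
     - real n * stationary_mean (\<lambda>z z'. D1 z z' * D2 z z')\<bar> \<le> C * sqrt (real n)"
proof -
  obtain H1 where H1: "H1 \<ge> 0" "\<And>z. norm (h1 z) \<le> H1" using finite_family_bound[of h1] by blast
  obtain H2 where H2: "H2 \<ge> 0" "\<And>z. norm (h2 z) \<le> H2" using finite_family_bound[of h2] by blast
  define H where "H = 2 * (H1 + H2)"
  have H: "H \<ge> 0" using H1 H2 by (simp add: H_def)
  have d1: "\<bar>path_sum w1 n a - path_sum D1 n a\<bar> \<le> H" for n a
    unfolding D1(2) path_sum_coboundary using H1(2)[of "a n"] H1(2)[of "a 0"] H2(1) by (simp add: H_def)
  have d2: "\<bar>path_sum w2 n a - path_sum D2 n a\<bar> \<le> H" for n a
    unfolding D2(2) path_sum_coboundary using H2(2)[of "a n"] H2(2)[of "a 0"] H1(1) by (simp add: H_def)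
  obtain C1 where C1: "\<And>n. n \<ge> 1 \<Longrightarrow> expectation (\<lambda>x. (path_sum w2 n (path x))\<^sup>2) \<le> C1 * real n" "C1 \<ge> 0"
    using path_sum_moments[OF assms(2)] by blast
  obtain B where B: "\<And>z z'. norm (D1 z z') \<le> B" using finite_family_bound2[of D1] by blast
  obtain C2 where C2: "C2 \<ge> 0" "\<And>n. \<bar>(\<Sum>k<n. expectation (\<lambda>w. mean (K (Z k w)) (\<lambda>z'. D1 (Z k w) z' * D2 (Z k w) z')))
      - real n * mean \<pi> (\<lambda>z. mean (K z) (\<lambda>z'. D1 z z' * D2 z z'))\<bar> \<le> C2"
    using occupation_bound[of "\<lambda>z. mean (K z) (\<lambda>z'. D1 z z' * D2 z z')"] by blast
  define C where "C = H * ((C1 + 1) / 2) + H * ((B\<^sup>2 + 1) / 2) + C2"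
  have "C \<ge> 0" using H C1 C2 by (simp add: C_def)
  moreover have "\<bar>expectation (\<lambda>x. path_sum w1 n (path x) * path_sum w2 n (path x))
     - real n * stationary_mean (\<lambda>z z'. D1 z z' * D2 z z')\<bar> \<le> C * sqrt (real n)" if n: "n \<ge> 1" for n
  proof -
    have s: "sqrt (real n) \<ge> 1" "real n / sqrt (real n) = sqrt (real n)" using n by (simp_all add: real_div_sqrt)
    note i2 = integrable_path_sum2[where g = "(*)" and n = n]
    have e2: "expectation (\<lambda>x. \<bar>path_sum w2 n (path x)\<bar>) \<le> (C1 + 1) / 2 * sqrt (real n)"
    proof -
      have "expectation (\<lambda>x. \<bar>path_sum w2 n (path x)\<bar>)
          \<le> (expectation (\<lambda>x. (path_sum w2 n (path x))\<^sup>2) / sqrt (real n) + sqrt (real n)) / 2"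
        by (rule expectation_abs_le) (use n integrable_path_sum[where g = "\<lambda>a. a\<^sup>2"] integrable_path_sum[where g = "\<lambda>a. a"] in auto)
      also have "\<dots> \<le> (C1 * real n / sqrt (real n) + sqrt (real n)) / 2"
        using C1(1)[OF n] by (intro divide_right_mono add_right_mono) auto
      also have "\<dots> = (C1 + 1) / 2 * sqrt (real n)"
        unfolding times_divide_eq_right[symmetric] s(2) by (simp add: field_simps)
      finally show ?thesis .
    qed
    have e1: "expectation (\<lambda>x. \<bar>path_sum D1 n (path x)\<bar>) \<le> (B\<^sup>2 + 1) / 2 * sqrt (real n)"
    proof -
      have "expectation (\<lambda>x. \<bar>path_sum D1 n (path x)\<bar>)
          \<le> (expectation (\<lambda>x. (path_sum D1 n (path x))\<^sup>2) / sqrt (real n) + sqrt (real n)) / 2"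
        by (rule expectation_abs_le) (use n integrable_path_sum[where g = "\<lambda>a. a\<^sup>2"] integrable_path_sum[where g = "\<lambda>a. a"] in auto)
      also have "\<dots> \<le> (B\<^sup>2 * real n / sqrt (real n) + sqrt (real n)) / 2"
        using martingale_second_moment[OF D1(1), of B n] B by (intro divide_right_mono add_right_mono) auto
      also have "\<dots> = (B\<^sup>2 + 1) / 2 * sqrt (real n)"
        unfolding times_divide_eq_right[symmetric] s(2) by (simp add: field_simps)
      finally show ?thesis .
    qed
    have "\<bar>path_sum w1 n a * path_sum w2 n a - path_sum D1 n a * path_sum D2 n a\<bar>
        \<le> H * \<bar>path_sum w2 n a\<bar> + H * \<bar>path_sum D1 n a\<bar>" for a
    proof -
      have "path_sum w1 n a * path_sum w2 n a - path_sum D1 n a * path_sum D2 n a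
        = (path_sum w1 n a - path_sum D1 n a) * path_sum w2 n a
          + (path_sum w2 n a - path_sum D2 n a) * path_sum D1 n a"
        by (simp add: algebra_simps)
      moreover have "\<bar>(path_sum w1 n a - path_sum D1 n a) * path_sum w2 n a\<bar> \<le> H * \<bar>path_sum w2 n a\<bar>"
        unfolding abs_mult by (intro mult_right_mono d1) auto
      moreover have "\<bar>(path_sum w2 n a - path_sum D2 n a) * path_sum D1 n a\<bar> \<le> H * \<bar>path_sum D1 n a\<bar>"
        unfolding abs_mult by (intro mult_right_mono d2) auto
      ultimately show ?thesis by linarith
    qed
    then have "norm (expectation (\<lambda>x. path_sum w1 n (path x) * path_sum w2 n (path x) - path_sum D1 n (path x) * path_sum D2 n (path x)))
      \<le> expectation (\<lambda>x. H * \<bar>path_sum w2 n (path x)\<bar> + H * \<bar>path_sum D1 n (path x)\<bar>)"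
      using integrable_path_sum2[where g = "\<lambda>a b. H * \<bar>a\<bar> + H * \<bar>b\<bar>" and n = n and f = w2 and f' = D1]
      by (intro norm_lebesgue_integral_le) (auto intro!: Bochner_Integration.integrable_diff i2)
    also have "\<dots> = H * expectation (\<lambda>x. \<bar>path_sum w2 n (path x)\<bar>) + H * expectation (\<lambda>x. \<bar>path_sum D1 n (path x)\<bar>)"
      using integrable_path_sum[where g = "\<lambda>a. a" and f = w2 and n = n]
        integrable_path_sum[where g = "\<lambda>a. a" and f = D1 and n = n] by simp
    also have "\<dots> \<le> H * ((C1 + 1) / 2 * sqrt (real n)) + H * ((B\<^sup>2 + 1) / 2 * sqrt (real n))"
      using e1 e2 H by (intro add_mono mult_left_mono) auto
    finally have "\<bar>expectation (\<lambda>x. path_sum w1 n (path x) * path_sum w2 n (path x))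
        - expectation (\<lambda>x. path_sum D1 n (path x) * path_sum D2 n (path x))\<bar>
      \<le> H * ((C1 + 1) / 2 * sqrt (real n)) + H * ((B\<^sup>2 + 1) / 2 * sqrt (real n))"
      by (simp add: i2)
    moreover have "\<bar>expectation (\<lambda>x. path_sum D1 n (path x) * path_sum D2 n (path x))
        - real n * stationary_mean (\<lambda>z z'. D1 z z' * D2 z z')\<bar> \<le> C2"
      using C2(2)[of n] by (simp add: martingale_covariance[OF D1(1) D2(1)] stationary_mean_def)
    moreover have "C2 \<le> C2 * sqrt (real n)" using s(1) C2(1) by (simp add: mult_le_cancel_left1)
    ultimately show ?thesis by (simp add: C_def algebra_simps) 
  qed
  ultimately show ?thesis by blast
qed

text \<open>Let \<open>T n\<close> be the number of visits and \<open>h\<close> the Poisson corrector. Then \<open>T n + h (Z n)\<close> is a martingale,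
  so \<open>E (T n)\<close> stays bounded. When a step is made, \<open>T\<^sup>2 + 2 T h\<close> increases in mean by at most
  \<open>1 + 2 H\<close> times the increase of \<open>T\<close>, where \<open>H\<close> bounds \<open>h\<close>; hence \<open>E (T n)\<^sup>2\<close> is bounded by a
  multiple of \<open>E (T n)\<close>. The decomposition into a martingale and a bounded term alone would only
  give \<open>O(n)\<close>.\<close>

lemma null_pairs_second_moment:
  fixes f :: "'z \<Rightarrow> 'z \<Rightarrow> real"
  assumes "stationary_mean f = 0" and f01: "\<And>z z'. 0 \<le> f z z' \<and> f z z' \<le> 1"
  shows "\<exists>C\<ge>0. \<forall>n. expectation (\<lambda>x. (path_sum f n (path x))\<^sup>2) \<le> C"
proof -
  obtain h where c: "centred (\<lambda>z z'. f z z' + h z' - h z)"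
    using martingale_decomposition[OF assms(1)] by blast
  obtain H where H: "H \<ge> 0" "\<And>z. norm (h z) \<le> H" using finite_family_bound[of h] by blast
  have kf: "mean (K z) (f z) = h z - mean (K z) h" for z
    using c[unfolded centred_def mean_add mean_diff mean_const, rule_format, of z] by simp
  define Th where "Th n = expectation (\<lambda>x. path_sum f n (path x) * h (Z n x))" for n
  define T where "T n = expectation (\<lambda>x. path_sum f n (path x))" for n
  have Tn: "path_sum f n a \<ge> 0" for n a unfolding path_sum_def by (intro sum_nonneg) (use f01 in auto)
  have T_eq: "T n = expectation (\<lambda>x. h (Z 0 x)) - expectation (\<lambda>x. h (Z n x))" for n
  proof (induction n)
    case (Suc n)
    have "T (Suc n) + expectation (\<lambda>x. h (Z (Suc n) x))
      = expectation (\<lambda>x. path_sum f n (path x) + f (Z n x) (Z (Suc n) x) + h (Z (Suc n) x))"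
      using integrable_path_sum[where g = "\<lambda>a. a" and f = f and n = "Suc n"] by (simp add: T_def)
    also have "\<dots> = expectation (\<lambda>x. mean (K (Z n x)) (\<lambda>z'. path_sum f n (path x) + f (Z n x) z' + h z'))"
      by (rule path_sum_step[where g = "\<lambda>a z z'. a + f z z' + h z'"])
    also have "\<dots> = expectation (\<lambda>x. path_sum f n (path x) + h (Z n x))"
      by (simp add: mean_add kf)
    also have "\<dots> = T n + expectation (\<lambda>x. h (Z n x))"
      using integrable_path_sum[where g = "\<lambda>a. a" and f = f and n = "n"] by (simp add: T_def)
    finally show ?case using Suc by simp
  qed (simp add: T_def)
  have hle: "\<bar>expectation (\<lambda>w. h (Z n w))\<bar> \<le> H" for n
  proof -
    have "norm (expectation (\<lambda>w. h (Z n w))) \<le> expectation (\<lambda>w. H)"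
      by (rule norm_lebesgue_integral_le) (use H in auto)
    then show ?thesis by (simp add: prob_space)
  qed
  have T_le: "T n \<le> 2 * H" for n unfolding T_eq using hle[of 0] hle[of n] by linarith
  have step: "expectation (\<lambda>x. (path_sum f (Suc n) (path x))\<^sup>2) + 2 * Th (Suc n)
      \<le> expectation (\<lambda>x. (path_sum f n (path x))\<^sup>2) + 2 * Th n + (1 + 2 * H) * (T (Suc n) - T n)" for n
  proof -
    have "expectation (\<lambda>x. (path_sum f (Suc n) (path x))\<^sup>2) + 2 * Th (Suc n) - (1 + 2 * H) * T (Suc n)
      = expectation (\<lambda>x. (path_sum f (Suc n) (path x))\<^sup>2 + 2 * (path_sum f (Suc n) (path x) * h (Z (Suc n) x))
           - (1 + 2 * H) * path_sum f (Suc n) (path x))"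
      using integrable_path_sum[where g = "\<lambda>a. a" and f = f and n = "Suc n"]
        integrable_path_sum[where g = "\<lambda>a. a\<^sup>2" and f = f and n = "Suc n"]
        integrable_path_sum_state[where g = "\<lambda>a z. a * h z" and f = f and n = "Suc n"]
      unfolding T_def Th_def by (simp del: path_sum_Suc)
    also have "\<dots> \<le> expectation (\<lambda>x. (path_sum f n (path x))\<^sup>2
        + 2 * (path_sum f n (path x) * (f (Z n x) (Z (Suc n) x) + h (Z (Suc n) x)))
        - (1 + 2 * H) * path_sum f n (path x))"
    proof (rule integral_mono)
      show "integrable M (\<lambda>x. (path_sum f (Suc n) (path x))\<^sup>2 + 2 * (path_sum f (Suc n) (path x) * h (Z (Suc n) x))
           - (1 + 2 * H) * path_sum f (Suc n) (path x))"
        by (rule integrable_path_sum_state[where g = "\<lambda>a z. a\<^sup>2 + 2 * (a * h z) - (1 + 2 * H) * a"])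
      show "integrable M (\<lambda>x. (path_sum f n (path x))\<^sup>2
        + 2 * (path_sum f n (path x) * (f (Z n x) (Z (Suc n) x) + h (Z (Suc n) x)))
        - (1 + 2 * H) * path_sum f n (path x))"
        by (rule adapted_integrable[where k = "Suc n" and G = "\<lambda>a. (path_sum f n a)\<^sup>2
        + 2 * (path_sum f n a * (f (a n) (a (Suc n)) + h (a (Suc n))))
        - (1 + 2 * H) * path_sum f n a"]) (auto simp: adapted_def path_sum_def)
      fix x
      let ?T = "path_sum f n (path x)" and ?f = "f (Z n x) (Z (Suc n) x)" and ?h = "h (Z (Suc n) x)"
      have "?f\<^sup>2 \<le> ?f" using f01[of "Z n x" "Z (Suc n) x"] by (simp add: power2_eq_square mult_left_le)
      moreover have "?f * ?h \<le> ?f * H"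
        using f01 H(2)[of "Z (Suc n) x"] by (intro mult_left_mono) auto
      ultimately show "(path_sum f (Suc n) (path x))\<^sup>2 + 2 * (path_sum f (Suc n) (path x) * h (Z (Suc n) x))
           - (1 + 2 * H) * path_sum f (Suc n) (path x) \<le> ?T\<^sup>2 + 2 * (?T * (?f + ?h)) - (1 + 2 * H) * ?T"
        by (simp add: power2_sum algebra_simps)
    qed
    also have "\<dots> = expectation (\<lambda>x. mean (K (Z n x)) (\<lambda>z'. (path_sum f n (path x))\<^sup>2
        + 2 * (path_sum f n (path x) * (f (Z n x) z' + h z')) - (1 + 2 * H) * path_sum f n (path x)))"
      by (rule path_sum_step[where g = "\<lambda>a z z'. a\<^sup>2 + 2 * (a * (f z z' + h z')) - (1 + 2 * H) * a"])
    also have "\<dots> = expectation (\<lambda>x. (path_sum f n (path x))\<^sup>2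
        + 2 * (path_sum f n (path x) * h (Z n x)) - (1 + 2 * H) * path_sum f n (path x))"
      by (simp add: mean_add mean_diff mean_cmult kf)
    also have "\<dots> = expectation (\<lambda>x. (path_sum f n (path x))\<^sup>2) + 2 * Th n - (1 + 2 * H) * T n"
      using integrable_path_sum[where g = "\<lambda>a. a" and f = f and n = "n"]
        integrable_path_sum[where g = "\<lambda>a. a\<^sup>2" and f = f and n = "n"]
        integrable_path_sum_state[where g = "\<lambda>a z. a * h z" and f = f and n = "n"]
      unfolding T_def Th_def by simp
    finally show ?thesis by (simp add: algebra_simps)
  qed
  have le: "expectation (\<lambda>x. (path_sum f n (path x))\<^sup>2) + 2 * Th n \<le> (1 + 2 * H) * T n" for n
  proof (induction n)
    case (Suc n)
    then show ?case using step[of n] by (simp add: algebra_simps)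
  qed (simp add: T_def Th_def)
  have Th_ge: "Th n \<ge> - (H * T n)" for n
  proof -
    have "expectation (\<lambda>x. - (H * path_sum f n (path x))) \<le> Th n"
      unfolding Th_def
    proof (rule integral_mono)
      show "integrable M (\<lambda>x. - (H * path_sum f n (path x)))"
        by (rule integrable_path_sum[where g = "\<lambda>a. - (H * a)"])
      show "integrable M (\<lambda>x. path_sum f n (path x) * h (Z n x))"
        by (rule integrable_path_sum_state[where g = "\<lambda>a z. a * h z"])
      fix x show "- (H * path_sum f n (path x)) \<le> path_sum f n (path x) * h (Z n x)"
        using mult_left_mono[of "- H" "h (Z n x)" "path_sum f n (path x)"] H(2)[of "Z n x"] Tn[of n "path x"]
        by (simp add: algebra_simps abs_le_iff)
    qed
    then show ?thesis by (simp add: T_def)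
  qed
  have "expectation (\<lambda>x. (path_sum f n (path x))\<^sup>2) \<le> (1 + 4 * H) * (2 * H)" for n
  proof -
    have "expectation (\<lambda>x. (path_sum f n (path x))\<^sup>2) \<le> (1 + 4 * H) * T n"
      using le[of n] Th_ge[of n] by (simp add: algebra_simps)
    also have "\<dots> \<le> (1 + 4 * H) * (2 * H)" using T_le[of n] H(1) by (intro mult_left_mono) auto
    finally show ?thesis .
  qed
  then show ?thesis using H(1) by (intro exI[of _ "(1 + 4 * H) * (2 * H)"]) auto
qed

end


section \<open>Characteristic functions of martingale sums\<close>

lemma norm_iexp_diff_le: "norm (iexp x - iexp y) \<le> \<bar>x - y\<bar>"
proof -
  have "iexp x - iexp y = iexp y * (iexp (x - y) - 1)"
    by (simp add: algebra_simps flip: exp_add)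
  then have "norm (iexp x - iexp y) = norm (iexp (x - y) - 1)"
    by (simp add: norm_mult)
  also have "\<dots> \<le> \<bar>x - y\<bar>"
    using iexp_approx1[of "x - y" 0] by simp
  finally show ?thesis .
qed

lemma iexp_taylor2: "norm (iexp x - (1 + \<i> * x - x\<^sup>2 / 2)) \<le> \<bar>x\<bar> ^ 3 / 6"
proof -
  have "(\<Sum>k\<le>2. (\<i> * complex_of_real x) ^ k / fact k) = 1 + \<i> * x - x\<^sup>2 / 2"
    by (simp add: numeral_2_eq_2 power_mult_distrib fact_numeral)
  moreover have "fact (Suc 2) = (6::real)" by (simp add: fact_numeral numeral_3_eq_3[symmetric])
  ultimately show ?thesis using iexp_approx1[of x 2] by (simp add: numeral_3_eq_3)
qed

lemma geometric_recursion_error: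
  fixes a :: "nat \<Rightarrow> complex" and q :: complex
  assumes "norm q \<le> 1" and step: "\<And>k. norm (a (Suc k) - q * a k) \<le> e"
  shows "norm (a n - q ^ n * a 0) \<le> real n * e"
proof (induction n)
  case (Suc n)
  have "a (Suc n) - q ^ Suc n * a 0 = (a (Suc n) - q * a n) + q * (a n - q ^ n * a 0)"
    by (simp add: algebra_simps)
  also have "norm \<dots> \<le> e + norm q * norm (a n - q ^ n * a 0)"
    by (metis norm_triangle_mono norm_mult order_refl step)
  also have "norm q * norm (a n - q ^ n * a 0) \<le> 1 * (real n * e)"
    using assms(1) Suc by (intro mult_mono) auto
  finally show ?case by (simp add: algebra_simps)
qed simp

context unichain_process
begin

text \<open>The conditional variance of an increment depends on the state, so a step does not multiply the
  characteristic function by a constant. The factor \<open>1 - u\<^sup>2/2 g\<close>, where \<open>g\<close> solves the Poisson equation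
  for the conditional variances, compensates for this: \<open>v + K g = g + s\<close>, so to second order in \<open>u\<close>
  the step multiplies the corrected quantity by \<open>1 - u\<^sup>2 s/2\<close> in every state.\<close>

lemma one_step_expansion:
  assumes c: "centred D" and B: "\<And>z z'. \<bar>D z z'\<bar> \<le> B" and G: "\<And>z. \<bar>g z\<bar> \<le> G"
    and g: "\<And>z. g z - mean (K z) g = mean (K z) (\<lambda>z'. D z z' * D z z') - s"
    and u: "0 \<le> u" "u \<le> 1" and s: "0 \<le> s"
  shows "norm (mean (K z) (\<lambda>z'. iexp (u * D z z') * of_real (1 - u\<^sup>2 / 2 * g z'))
      - of_real (1 - u\<^sup>2 * s / 2) * of_real (1 - u\<^sup>2 / 2 * g z))
    \<le> u ^ 3 * (B ^ 3 / 6 + G * B / 2 + s * G / 4)"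
proof -
  have B0: "B \<ge> 0" using B[of undefined undefined] by linarith
  have G0: "G \<ge> 0" using G[of undefined] by linarith
  define main where "main z' = 1 - u\<^sup>2 / 2 * (D z z' * D z z') - u\<^sup>2 / 2 * g z'" for z'
  define lin where "lin z' = u * D z z'" for z'
  define rem where "rem z' = (iexp (u * D z z') - (1 + \<i> * complex_of_real (u * D z z') - complex_of_real ((u * D z z')\<^sup>2 / 2)))
     - of_real (u\<^sup>2 / 2 * g z') * (iexp (u * D z z') - 1)" for z'
  have split: "iexp (u * D z z') * of_real (1 - u\<^sup>2 / 2 * g z') = of_real (main z') + \<i> * of_real (lin z') + rem z'" for z'
    by (simp add: main_def lin_def rem_def field_simps power2_eq_square)
  have rem: "norm (rem z') \<le> u ^ 3 * (B ^ 3 / 6 + G * B / 2)" for z'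
  proof -
    have x: "\<bar>u * D z z'\<bar> \<le> u * B" using B[of z z'] u by (simp add: abs_mult mult_left_mono)
    have "norm (iexp (u * D z z') - (1 + \<i> * complex_of_real (u * D z z') - complex_of_real ((u * D z z')\<^sup>2 / 2))) \<le> \<bar>u * D z z'\<bar> ^ 3 / 6"
      using iexp_taylor2[of "u * D z z'"] by simp
    also have "\<dots> \<le> (u * B) ^ 3 / 6" using x by (intro divide_right_mono power_mono) auto
    finally have 1: "norm (iexp (u * D z z') - (1 + \<i> * complex_of_real (u * D z z') - complex_of_real ((u * D z z')\<^sup>2 / 2))) \<le> (u * B) ^ 3 / 6" .
    have "norm (iexp (u * D z z') - 1) \<le> u * B"
      using norm_iexp_diff_le[of "u * D z z'" 0] x by simp
    moreover have "\<bar>u\<^sup>2 / 2 * g z'\<bar> \<le> u\<^sup>2 / 2 * G" using G[of z'] by (simp add: abs_mult mult_left_mono)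
    ultimately have "norm (of_real (u\<^sup>2 / 2 * g z') * (iexp (u * D z z') - 1)) \<le> (u\<^sup>2 / 2 * G) * (u * B)"
      unfolding norm_mult norm_of_real using u B0 G0 by (intro mult_mono) auto
    with 1 have "norm (rem z') \<le> (u * B) ^ 3 / 6 + (u\<^sup>2 / 2 * G) * (u * B)"
      unfolding rem_def by (rule norm_triangle_le_diff[OF add_mono])
    then show ?thesis by (simp add: power3_eq_cube power2_eq_square algebra_simps)
  qed
  have "mean (K z) (\<lambda>z'. iexp (u * D z z') * of_real (1 - u\<^sup>2 / 2 * g z'))
     = of_real (mean (K z) main) + \<i> * of_real (mean (K z) lin) + mean (K z) rem"
    unfolding split mean_add mean_cmult by (simp add: mean_def scaleR_conv_of_real)
  also have "mean (K z) lin = 0" using c unfolding lin_def mean_cmult by (simp add: centred_def)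
  also have "mean (K z) main = 1 - u\<^sup>2 / 2 * (g z + s)"
  proof -
    have "mean (K z) main = 1 - u\<^sup>2 / 2 * mean (K z) (\<lambda>z'. D z z' * D z z') - u\<^sup>2 / 2 * mean (K z) g"
      unfolding main_def mean_diff mean_cmult by simp
    also have "mean (K z) (\<lambda>z'. D z z' * D z z') = g z - mean (K z) g + s" using g[of z] by simp
    finally show ?thesis by (simp add: field_simps)
  qed
  finally have eq: "mean (K z) (\<lambda>z'. iexp (u * D z z') * of_real (1 - u\<^sup>2 / 2 * g z'))
    = of_real (1 - u\<^sup>2 / 2 * (g z + s)) + \<i> * of_real 0 + mean (K z) rem" .
  have "mean (K z) (\<lambda>z'. iexp (u * D z z') * of_real (1 - u\<^sup>2 / 2 * g z'))
      - of_real (1 - u\<^sup>2 * s / 2) * of_real (1 - u\<^sup>2 / 2 * g z)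
    = mean (K z) rem - of_real (u ^ 4 * (s * g z / 4))"
    unfolding eq by (simp add: field_simps power2_eq_square power4_eq_xxxx)
  also have "norm \<dots> \<le> u ^ 3 * (B ^ 3 / 6 + G * B / 2) + u ^ 3 * (s * G / 4)"
  proof (rule norm_triangle_le_diff[OF add_mono])
    show "norm (mean (K z) rem) \<le> u ^ 3 * (B ^ 3 / 6 + G * B / 2)" by (rule norm_mean_le[OF rem])
    have "\<bar>u ^ 4 * (s * g z / 4)\<bar> = u ^ 4 * (s * \<bar>g z\<bar> / 4)" using s u by (simp add: abs_mult)
    also have "\<dots> \<le> u ^ 3 * (s * G / 4)"
      using G[of z] s u by (intro mult_mono power_decreasing) (auto intro: mult_left_mono)
    finally show "norm (complex_of_real (u ^ 4 * (s * g z / 4))) \<le> u ^ 3 * (s * G / 4)"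
      unfolding norm_of_real .
  qed
  finally show ?thesis by (simp add: algebra_simps)
qed

lemma stationary_mean_nonneg: "(\<And>z z'. 0 \<le> w z z') \<Longrightarrow> 0 \<le> stationary_mean w" for w :: "'z \<Rightarrow> 'z \<Rightarrow> real"
  unfolding stationary_mean_def mean_def by (intro sum_nonneg scaleR_nonneg_nonneg) auto

text \<open>With \<open>u = 1/\<surd>n\<close>, the \<open>n\<close> steps multiply the corrected characteristic function by
  \<open>(1 - s/(2n))\<^sup>n\<close>, which tends to \<open>exp (- s/2)\<close>; the accumulated error is \<open>n O(u\<^sup>3) = O(u)\<close>, and
  the correction itself is \<open>O(u\<^sup>2)\<close>.\<close>

lemma martingale_clt:
  assumes c: "centred D"
  shows "(\<lambda>n. expectation (\<lambda>w. iexp (path_sum D n (path w) / sqrt (real n))))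
    \<longlonglongrightarrow> of_real (exp (- stationary_mean (\<lambda>z z'. D z z' * D z z') / 2))"
proof -
  define s where "s = stationary_mean (\<lambda>z z'. D z z' * D z z')"
  have s: "s \<ge> 0" unfolding s_def by (rule stationary_mean_nonneg) simp
  obtain g where g: "\<And>z. g z - mean (K z) g = mean (K z) (\<lambda>z'. D z z' * D z z') - s"
    using poisson_equation[OF unichain invariant, of "\<lambda>z. mean (K z) (\<lambda>z'. D z z' * D z z')"]
    unfolding s_def stationary_mean_def by blast
  obtain B where B: "B \<ge> 0" "\<And>z z'. \<bar>D z z'\<bar> \<le> B" using finite_family_bound2[of D] by (metis real_norm_def)
  obtain G where G: "G \<ge> 0" "\<And>z. \<bar>g z\<bar> \<le> G" using finite_family_bound[of g] by (metis real_norm_def)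
  define C where "C = B ^ 3 / 6 + G * B / 2 + s * G / 4"
  define u where "u n = 1 / sqrt (real n)" for n
  define a where "a n k = expectation (\<lambda>w. iexp (u n * path_sum D k (path w)) * complex_of_real (1 - (u n)\<^sup>2 / 2 * g (Z k w)))" for n k
  define q where "q n = complex_of_real (1 - (u n)\<^sup>2 * s / 2)" for n
  have u: "0 \<le> u n" "u n \<le> 1" "(u n)\<^sup>2 = 1 / real n" if "n \<ge> 1" for n
    using that by (simp_all add: u_def power_divide)
  have step: "norm (a n (Suc k) - q n * a n k) \<le> u n ^ 3 * C" if n: "n \<ge> 1" for n k
  proof -
    let ?c = "\<lambda>z. complex_of_real (1 - (u n)\<^sup>2 / 2 * g z)"
    let ?m = "\<lambda>z. mean (K z) (\<lambda>z'. iexp (u n * D z z') * ?c z')"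
    define F where "F x z z' = iexp (u n * (x + D z z')) * ?c z'" for x z z'
    have mF: "mean (K z) (F x z) = iexp (u n * x) * ?m z" for x z
      unfolding mean_cmult[symmetric] F_def by (simp add: distrib_left exp_add mult.assoc)
    have "a n (Suc k) = expectation (\<lambda>w. mean (K (Z k w)) (F (path_sum D k (path w)) (Z k w)))"
      using path_sum_step[where g = F and f = D and n = k] by (simp add: a_def F_def)
    moreover have "q n * a n k = expectation (\<lambda>w. iexp (u n * path_sum D k (path w)) * (q n * ?c (Z k w)))"
      unfolding a_def by (subst integral_mult_right_zero[symmetric]) (simp add: ac_simps)
    ultimately have "a n (Suc k) - q n * a n k = expectation (\<lambda>w. iexp (u n * path_sum D k (path w)) *
        (?m (Z k w) - q n * ?c (Z k w)))"
      unfolding mF right_diff_distrib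
      using integrable_path_sum_state[where g = "\<lambda>x z. iexp (u n * x) * ?m z" and f = D and n = k]
        integrable_path_sum_state[where g = "\<lambda>x z. iexp (u n * x) * (q n * ?c z)" and f = D and n = k]
      by (simp only: Bochner_Integration.integral_diff)
    also have "norm \<dots> \<le> expectation (\<lambda>_. u n ^ 3 * C)"
    proof (rule norm_lebesgue_integral_le)
      show "integrable M (\<lambda>w. iexp (u n * path_sum D k (path w)) *
        (?m (Z k w) - q n * ?c (Z k w)))"
        by (rule integrable_path_sum_state[where g = "\<lambda>x z. iexp (u n * x) * (?m z - q n * ?c z)"])
      fix w
      show "norm (iexp (u n * path_sum D k (path w)) *
        (?m (Z k w) - q n * ?c (Z k w))) \<le> u n ^ 3 * C"
        unfolding norm_mult norm_exp_i_times mult_1 q_def C_def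
        by (rule one_step_expansion[OF c B(2) G(2) g u(1,2)[OF n] s])
    qed simp
    finally show ?thesis by (simp add: prob_space)
  qed
  have a_diff: "norm (a n k - expectation (\<lambda>w. iexp (u n * path_sum D k (path w)))) \<le> (u n)\<^sup>2 / 2 * G" for n k
  proof -
    have "a n k - expectation (\<lambda>w. iexp (u n * path_sum D k (path w)))
      = expectation (\<lambda>w. iexp (u n * path_sum D k (path w)) * complex_of_real (- ((u n)\<^sup>2 / 2 * g (Z k w))))"
      unfolding a_def
      using integrable_path_sum[where g = "\<lambda>x. iexp (u n * x)" and f = D and n = k]
           integrable_path_sum_state[where g = "\<lambda>x z. iexp (u n * x) * complex_of_real (1 - (u n)\<^sup>2 / 2 * g z)" and f = D and n = k]
      by (simp only: Bochner_Integration.integral_diff[symmetric]) (simp add: algebra_simps)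
    also have "norm \<dots> \<le> expectation (\<lambda>_. (u n)\<^sup>2 / 2 * G)"
    proof (rule norm_lebesgue_integral_le)
      show "integrable M (\<lambda>w. iexp (u n * path_sum D k (path w)) * complex_of_real (- ((u n)\<^sup>2 / 2 * g (Z k w))))"
        by (rule integrable_path_sum_state[where g = "\<lambda>x z. iexp (u n * x) * complex_of_real (- ((u n)\<^sup>2 / 2 * g z))"])
      fix w
      show "norm (iexp (u n * path_sum D k (path w)) * complex_of_real (- ((u n)\<^sup>2 / 2 * g (Z k w)))) \<le> (u n)\<^sup>2 / 2 * G"
        unfolding norm_mult norm_exp_i_times mult_1 norm_of_real using G(2)[of "Z k w"]
        by (simp add: abs_mult mult_left_mono)
    qed simp
    finally show ?thesis by (simp add: prob_space)
  qed
  have u0: "u \<longlonglongrightarrow> 0" unfolding u_def by real_asymp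
  have a0: "(\<lambda>n. a n 0) \<longlonglongrightarrow> 1"
  proof (rule Lim_transform)
    show "(\<lambda>n. expectation (\<lambda>w. iexp (u n * path_sum D 0 (path w)))) \<longlonglongrightarrow> 1" by (simp add: prob_space)
    show "(\<lambda>n. a n 0 - expectation (\<lambda>w. iexp (u n * path_sum D 0 (path w)))) \<longlonglongrightarrow> 0"
      by (rule Lim_null_comparison[where g = "\<lambda>n. (u n)\<^sup>2 / 2 * G"])
        (use a_diff[of _ 0] in \<open>auto intro!: tendsto_eq_intros u0\<close>)
  qed
  have q: "(\<lambda>n. q n ^ n) \<longlonglongrightarrow> of_real (exp (- s / 2))"
  proof -
    have "(\<lambda>n. complex_of_real ((1 + (- s / 2) / real n) ^ n)) \<longlonglongrightarrow> of_real (exp (- s / 2))"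
      by (intro tendsto_of_real tendsto_exp_limit_sequentially)
    then show ?thesis
      by (rule Lim_transform_eventually)
        (use eventually_ge_at_top[of "1::nat"] in eventually_elim, simp add: q_def u field_simps)
  qed
  have "(\<lambda>n. a n n - q n ^ n * a n 0) \<longlonglongrightarrow> 0"
  proof (rule Lim_null_comparison[where g = "\<lambda>n. u n * C"])
    have "eventually (\<lambda>n. real n \<ge> s) sequentially"
      by (rule eventually_sequentiallyI[of "nat \<lceil>s\<rceil>"]) linarith
    then show "eventually (\<lambda>n. norm (a n n - q n ^ n * a n 0) \<le> u n * C) sequentially"
      using eventually_ge_at_top[of "1::nat"]
    proof eventually_elim
      case (elim n)
      have "(u n)\<^sup>2 * s = s / real n" using u(3)[of n] elim by simp
      then have "(u n)\<^sup>2 * s \<le> 1" using elim by (simp add: divide_le_eq)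
      then have "norm (q n) \<le> 1" unfolding q_def norm_of_real using s by (simp add: abs_le_iff)
      from geometric_recursion_error[of "q n" "a n" "u n ^ 3 * C" n, OF this step]
      have "norm (a n n - q n ^ n * a n 0) \<le> real n * (u n ^ 3 * C)" using elim by simp
      also have "real n * (u n ^ 3 * C) = (real n * (u n)\<^sup>2) * u n * C" by (simp add: power3_eq_cube power2_eq_square)
      also have "\<dots> = u n * C" using u(3)[of n] elim by simp
      finally show ?case .
    qed
    show "(\<lambda>n. u n * C) \<longlonglongrightarrow> 0" by (rule tendsto_mult_left_zero[OF u0])
  qed
  from tendsto_add[OF this tendsto_mult[OF q a0]]
  have "(\<lambda>n. a n n) \<longlonglongrightarrow> of_real (exp (- s / 2))" by simp
  moreover have "(\<lambda>n. expectation (\<lambda>w. iexp (u n * path_sum D n (path w))) - a n n) \<longlonglongrightarrow> 0"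
    by (rule Lim_null_comparison[where g = "\<lambda>n. (u n)\<^sup>2 / 2 * G"])
      (use a_diff in \<open>auto simp: norm_minus_commute intro!: tendsto_eq_intros u0\<close>)
  ultimately have "(\<lambda>n. expectation (\<lambda>w. iexp (u n * path_sum D n (path w)))) \<longlonglongrightarrow> of_real (exp (- s / 2))"
    by (metis (no_types) Lim_transform)
  then show ?thesis by (simp add: u_def s_def)
qed

lemma characteristic_function_perturbation:
  fixes X Y :: "nat \<Rightarrow> 'w \<Rightarrow> real"
  assumes X: "\<And>n. X n \<in> borel_measurable M" and Y: "\<And>n. Y n \<in> borel_measurable M"
    and int: "\<And>n. integrable M (\<lambda>w. X n w - Y n w)"
    and small: "(\<lambda>n. expectation (\<lambda>w. \<bar>X n w - Y n w\<bar>)) \<longlonglongrightarrow> 0"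
    and lim: "(\<lambda>n. expectation (\<lambda>w. iexp (Y n w))) \<longlonglongrightarrow> l"
  shows "(\<lambda>n. expectation (\<lambda>w. iexp (X n w))) \<longlonglongrightarrow> l"
proof (rule Lim_transform[OF lim])
  note [measurable] = X Y
  have i: "integrable M (\<lambda>w. iexp (T w))" if [measurable]: "T \<in> borel_measurable M" for T
    by (rule integrable_const_bound[where B = 1]) auto
  have "norm (expectation (\<lambda>w. iexp (Y n w)) - expectation (\<lambda>w. iexp (X n w))) \<le> expectation (\<lambda>w. \<bar>X n w - Y n w\<bar>)" for n
  proof -
    have "expectation (\<lambda>w. iexp (Y n w)) - expectation (\<lambda>w. iexp (X n w)) = expectation (\<lambda>w. iexp (Y n w) - iexp (X n w))"
      using i X Y by simp
    also have "norm \<dots> \<le> expectation (\<lambda>w. \<bar>X n w - Y n w\<bar>)"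
    proof (rule norm_lebesgue_integral_le)
      show "integrable M (\<lambda>w. iexp (Y n w) - iexp (X n w))" by (intro Bochner_Integration.integrable_diff i X Y)
      show "integrable M (\<lambda>w. \<bar>X n w - Y n w\<bar>)" using int by simp
      show "norm (iexp (Y n w) - iexp (X n w)) \<le> \<bar>X n w - Y n w\<bar>" for w
        using norm_iexp_diff_le[of "Y n w" "X n w"] by (simp add: abs_minus_commute)
    qed
    finally show ?thesis .
  qed
  then show "(\<lambda>n. expectation (\<lambda>w. iexp (X n w)) - expectation (\<lambda>w. iexp (Y n w))) \<longlonglongrightarrow> 0"
    by (intro Lim_null_comparison[OF _ small]) (auto simp: norm_minus_commute)
qed

end


section \<open>Weak convergence from characteristic functions\<close>

text \<open>Finite combinations of waves, the functions whose expectations are determined by the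
  characteristic function. They form an algebra.\<close>

inductive trig_poly :: "('a::real_inner \<Rightarrow> complex) \<Rightarrow> bool" where
  wave: "trig_poly (\<lambda>x. c * iexp (t \<bullet> x))"
| add: "trig_poly f \<Longrightarrow> trig_poly g \<Longrightarrow> trig_poly (\<lambda>x. f x + g x)"

lemma trig_poly_const: "trig_poly (\<lambda>_. c)"
  using trig_poly.wave[of c 0] by simp

lemma trig_poly_wave_mult: "trig_poly g \<Longrightarrow> trig_poly (\<lambda>x. c * iexp (t \<bullet> x) * g x)"
proof (induction rule: trig_poly.induct)
  case (wave c' t')
  have "(\<lambda>x. c * iexp (t \<bullet> x) * (c' * iexp (t' \<bullet> x))) = (\<lambda>x. (c * c') * iexp ((t + t') \<bullet> x))"
    by (simp add: fun_eq_iff inner_add_left distrib_left exp_add ac_simps)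
  then show ?case by (simp only: trig_poly.wave)
next
  case (add f g)
  then show ?case using trig_poly.add by (simp add: distrib_left)
qed

lemma trig_poly_mult: "trig_poly f \<Longrightarrow> trig_poly g \<Longrightarrow> trig_poly (\<lambda>x. f x * g x)"
proof (induction rule: trig_poly.induct)
  case (wave c t)
  then show ?case by (rule trig_poly_wave_mult)
next
  case (add f f')
  then show ?case using trig_poly.add by (simp add: distrib_right)
qed

lemma trig_poly_cos: "trig_poly (\<lambda>x. of_real (cos (t \<bullet> x)))"
proof -
  have "(\<lambda>x. complex_of_real (cos (t \<bullet> x))) = (\<lambda>x. (1/2) * iexp (t \<bullet> x) + (1/2) * iexp ((- t) \<bullet> x))"
    by (simp add: fun_eq_iff cos_exp_eq flip: cos_of_real)
  then show ?thesis by (simp only: trig_poly.intros)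
qed

lemma trig_poly_sin: "trig_poly (\<lambda>x. of_real (sin (t \<bullet> x)))"
proof -
  have "(\<lambda>x. complex_of_real (sin (t \<bullet> x))) = (\<lambda>x. (1/(2*\<i>)) * iexp (t \<bullet> x) + (- (1/(2*\<i>))) * iexp ((- t) \<bullet> x))"
    by (simp add: fun_eq_iff sin_exp_eq diff_divide_distrib right_diff_distrib flip: sin_of_real)
  then show ?thesis by (simp only: trig_poly.intros)
qed

text \<open>Wraps the space around a torus. A polynomial in the coordinates of the image is a trigonometric
  polynomial of \<open>x\<close>, and is bounded on the whole space because the image is bounded.\<close>

definition torus_map :: "real \<Rightarrow> real^'d \<Rightarrow> (real^'d) \<times> (real^'d)" where
  "torus_map s x = ((\<chi> i. cos (s * x $ i)), (\<chi> i. sin (s * x $ i)))"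

lemma trig_poly_torus_polynomial:
  fixes p :: "(real^'d) \<times> (real^'d) \<Rightarrow> real"
  assumes "real_polynomial_function p"
  shows "trig_poly (\<lambda>x. of_real (p (torus_map s x)))"
  using assms
proof (induction rule: real_polynomial_function.induct)
  case (linear f)
  then have lin: "linear f" by (rule bounded_linear.linear)
  have sum: "trig_poly (\<lambda>x. \<Sum>i\<in>A. g i x)" if "finite A" "\<And>i. trig_poly (g i)" for A :: "'d set" and g :: "'d \<Rightarrow> real^'d \<Rightarrow> complex"
    using that(1) by induction (auto intro: trig_poly_const trig_poly.add that(2))
  have "f (torus_map s x) = (\<Sum>i\<in>UNIV. cos (s * x $ i) * f (axis i 1, 0)) + (\<Sum>i\<in>UNIV. sin (s * x $ i) * f (0, axis i 1))" for x
  proof -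
    have tm: "torus_map s x = (\<Sum>i\<in>UNIV. cos (s * x $ i) *\<^sub>R (axis i 1, 0)) + (\<Sum>i\<in>UNIV. sin (s * x $ i) *\<^sub>R (0, axis i 1))"
      by (simp add: torus_map_def prod_eq_iff fst_sum snd_sum vec_eq_iff axis_def if_distrib cong: if_cong)
    show ?thesis
      unfolding tm by (simp only: linear_add[OF lin] linear_sum[OF lin] linear_scale[OF lin] real_scaleR_def)
  qed
  moreover have "trig_poly (\<lambda>x. (\<Sum>i\<in>UNIV. of_real (cos (s * x $ i)) * of_real (f (axis i 1, 0)))
       + (\<Sum>i\<in>UNIV. of_real (sin (s * x $ i)) * of_real (f (0, axis i 1))))"
  proof (intro trig_poly.add sum trig_poly_mult trig_poly_const)
    fix i
    show "trig_poly (\<lambda>x. complex_of_real (cos (s * x $ i)))"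
      using trig_poly_cos[of "axis i s"] by (simp add: inner_axis')
    show "trig_poly (\<lambda>x. complex_of_real (sin (s * x $ i)))"
      using trig_poly_sin[of "axis i s"] by (simp add: inner_axis')
  qed simp_all
  ultimately show ?case by simp
next
  case (const c)
  show ?case by (rule trig_poly_const)
next
  case (add f g)
  then show ?case using trig_poly.add by simp
next
  case (mult f g)
  then show ?case using trig_poly_mult by simp
qed

lemma trig_poly_convergence:
  fixes Y :: "nat \<Rightarrow> 'w \<Rightarrow> 'a::euclidean_space"
  assumes "prob_space M" "\<And>n. Y n \<in> borel_measurable M"
    and "prob_space \<nu>" "sets \<nu> = sets borel"
    and char: "\<And>t. (\<lambda>n. CLINT w|M. iexp (t \<bullet> Y n w)) \<longlonglongrightarrow> (CLINT x|\<nu>. iexp (t \<bullet> x))"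
    and "trig_poly g"
  shows "g \<in> borel_measurable borel \<and> (\<forall>n. integrable M (\<lambda>w. g (Y n w))) \<and> integrable \<nu> g \<and>
    (\<lambda>n. CLINT w|M. g (Y n w)) \<longlonglongrightarrow> (CLINT x|\<nu>. g x)"
  using assms(6)
proof (induction rule: trig_poly.induct)
  case (wave c t)
  interpret M: prob_space M by fact
  interpret N: prob_space \<nu> by fact
  note [measurable] = assms(2)
  note [measurable_cong] = assms(4)
  have "(\<lambda>n. c * (CLINT w|M. iexp (t \<bullet> Y n w))) \<longlonglongrightarrow> c * (CLINT x|\<nu>. iexp (t \<bullet> x))"
    by (intro tendsto_mult_left char)
  moreover have "integrable M (\<lambda>w. c * iexp (t \<bullet> Y n w))" for n
    by (rule M.integrable_const_bound[where B = "norm c"]) (auto simp: norm_mult)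
  moreover have "integrable \<nu> (\<lambda>x. c * iexp (t \<bullet> x))"
    by (rule N.integrable_const_bound[where B = "norm c"]) (auto simp: norm_mult)
  ultimately show ?case by simp
next
  case (add f g)
  then have i: "integrable M (\<lambda>w. f (Y n w))" "integrable M (\<lambda>w. g (Y n w))" for n by auto
  show ?case using add.IH tendsto_add[of "\<lambda>n. CLINT w|M. f (Y n w)" _ _ "\<lambda>n. CLINT w|M. g (Y n w)"]
    by (auto simp: Bochner_Integration.integral_add[OF i])
qed

lemma box_homeomorphism:
  assumes "R > 0"
  obtains s :: real and G :: "(real^'d) \<times> (real^'d) \<Rightarrow> real^'d" where "s > 0"
    "homeomorphism (cbox (\<chi> i. - R) (\<chi> i. R)) (torus_map s ` cbox (\<chi> i. - R) (\<chi> i. R)) (torus_map s) G"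
proof -
  \<comment> \<open>This scale keeps \<open>s * x $ i\<close> within \<open>[-1, 1]\<close>, where the sine is injective.\<close>
  define s where "s = 1 / R"
  have s: "s > 0" using assms by (simp add: s_def)
  have "inj_on (torus_map s) (cbox (\<chi> i. - R) (\<chi> i. R :: real^'d))"
  proof (rule inj_onI)
    fix x y :: "real^'d" assume xy: "x \<in> cbox (\<chi> i. - R) (\<chi> i. R)" "y \<in> cbox (\<chi> i. - R) (\<chi> i. R)"
      and eq: "torus_map s x = torus_map s y"
    show "x = y"
    proof (subst vec_eq_iff, intro allI)
      fix i
      have "sin (s * x $ i) = sin (s * y $ i)"
        using eq by (auto simp: torus_map_def vec_eq_iff)
      moreover have "- (pi / 2) \<le> s * z $ i" "s * z $ i \<le> pi / 2" if "z \<in> cbox (\<chi> i. - R) (\<chi> i. R)" for z :: "real^'d"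
      proof -
        have "- R \<le> z $ i" "z $ i \<le> R" using that by (auto simp: mem_box_cart)
        then have "- 1 \<le> s * z $ i" "s * z $ i \<le> 1" using assms by (simp_all add: s_def field_simps)
        then show "- (pi / 2) \<le> s * z $ i" "s * z $ i \<le> pi / 2" using pi_gt3 by linarith+
      qed
      ultimately have "s * x $ i = s * y $ i"
        using sin_inj_pi xy by metis
      then show "x $ i = y $ i" using s by simp
    qed
  qed
  moreover have "continuous_on (cbox (\<chi> i. - R) (\<chi> i. R :: real^'d)) (torus_map s)"
    unfolding torus_map_def by (intro continuous_intros)
  ultimately have "\<exists>G. homeomorphism (cbox (\<chi> i. - R) (\<chi> i. R :: real^'d)) (torus_map s ` cbox (\<chi> i. - R) (\<chi> i. R)) (torus_map s) G"
    by (intro homeomorphism_compact compact_cbox refl)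
  then show ?thesis using that s by blast
qed

text \<open>Approximation on a ball alone is of no use, since nothing would control \<open>g\<close> outside. So \<open>f\<close> is first
  transported from a cube to its image in the torus and extended from there with the same bound by
  Tietze's theorem; a polynomial close to the extension on a ball that contains the torus then
  inherits the bound everywhere.\<close>

lemma trig_approximation:
  fixes f :: "real^'d \<Rightarrow> real"
  assumes "continuous_on UNIV f" and B: "\<And>x. \<bar>f x\<bar> \<le> B" and e: "e > 0" and R: "R > 0"
  obtains g :: "real^'d \<Rightarrow> real" where "trig_poly (\<lambda>x. of_real (g x))" "\<And>x. \<bar>g x\<bar> \<le> B + e"
    "\<And>x. norm x \<le> R \<Longrightarrow> \<bar>f x - g x\<bar> \<le> e"
proof -
  let ?Q = "cbox (\<chi> i. - R) (\<chi> i. R) :: (real^'d) set"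
  obtain s G where s: "s > 0" and hom: "homeomorphism ?Q (torus_map s ` ?Q) (torus_map s) G"
    using box_homeomorphism[OF R] by blast
  have B0: "B \<ge> 0" using B[of 0] by linarith
  have "compact (torus_map s ` ?Q)"
    by (intro compact_continuous_image compact_cbox homeomorphism_cont1[OF hom])
  then have cl: "closedin (top_of_set UNIV) (torus_map s ` ?Q)"
    by (simp add: compact_imp_closed closed_closedin[symmetric])
  have "continuous_on (torus_map s ` ?Q) (\<lambda>y. f (G y))"
    by (rule continuous_on_compose2[OF assms(1) homeomorphism_cont2[OF hom]]) simp
  then obtain F where F: "continuous_on UNIV F" "\<And>y. y \<in> torus_map s ` ?Q \<Longrightarrow> F y = f (G y)"
    "\<And>y. norm (F y) \<le> B"
  proof (rule Tietze[OF _ cl B0])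
    show "norm (f (G y)) \<le> B" for y using B by simp
  qed auto
  define C :: "((real^'d) \<times> (real^'d)) set" where "C = cball 0 (2 * real CARD('d))"
  have inC: "torus_map s x \<in> C" for x
  proof -
    have "norm (torus_map s x) \<le> norm (fst (torus_map s x)) + norm (snd (torus_map s x))"
      using norm_Pair_le[of "fst (torus_map s x)" "snd (torus_map s x)"] by simp
    also have "\<dots> \<le> (\<Sum>i\<in>(UNIV::'d set). \<bar>fst (torus_map s x) $ i\<bar>) + (\<Sum>i\<in>(UNIV::'d set). \<bar>snd (torus_map s x) $ i\<bar>)"
      by (intro add_mono norm_le_l1_cart)
    also have "\<dots> \<le> (\<Sum>i\<in>(UNIV::'d set). 1) + (\<Sum>i\<in>(UNIV::'d set). 1)"
      by (intro add_mono sum_mono) (auto simp: torus_map_def)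
    finally show ?thesis by (simp add: C_def)
  qed
  obtain p where p: "real_polynomial_function p" "\<And>y. y \<in> C \<Longrightarrow> \<bar>F y - p y\<bar> < e"
  proof (rule Stone_Weierstrass_real_polynomial_function)
    show "compact C" by (simp add: C_def)
    show "continuous_on C F" using F(1) by (rule continuous_on_subset) simp
  qed (use e in auto)
  show ?thesis
  proof
    show "trig_poly (\<lambda>x. of_real (p (torus_map s x)))" by (rule trig_poly_torus_polynomial[OF p(1)])
    show "\<bar>p (torus_map s x)\<bar> \<le> B + e" for x
      using p(2)[OF inC[of x]] F(3)[of "torus_map s x"] by (simp add: abs_if split: if_splits)
    fix x :: "real^'d" assume x: "norm x \<le> R"
    have "- R \<le> x $ i" "x $ i \<le> R" for i
      using component_le_norm_cart[of x i] x by (auto simp: abs_le_iff)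
    then have "x \<in> ?Q" by (simp add: mem_box_cart)
    then have "F (torus_map s x) = f x" using F(2)[of "torus_map s x"] hom by (simp add: homeomorphism_apply1)
    then show "\<bar>f x - p (torus_map s x)\<bar> \<le> e" using p(2)[OF inC[of x]] by simp
  qed
qed

lemma bounded_difference_expectation:
  fixes f g :: "'a::real_normed_vector \<Rightarrow> real"
  assumes "prob_space M" and [measurable]: "Y \<in> borel_measurable M" "f \<in> borel_measurable borel" "g \<in> borel_measurable borel"
    and f: "\<And>x. \<bar>f x\<bar> \<le> B" and g: "\<And>x. \<bar>g x\<bar> \<le> B + e"
    and near: "\<And>x. norm x \<le> R \<Longrightarrow> \<bar>f x - g x\<bar> \<le> e" and e: "e \<ge> 0"
    and tail: "measure M {w \<in> space M. norm (Y w) > R} \<le> \<epsilon>"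
  shows "\<bar>(LINT w|M. f (Y w)) - (LINT w|M. g (Y w))\<bar> \<le> e + (2 * B + e) * \<epsilon>"
proof -
  interpret prob_space M by fact
  have B0: "B \<ge> 0" using f[of 0] by linarith
  have i: "integrable M (\<lambda>w. f (Y w))" "integrable M (\<lambda>w. g (Y w))"
    by (rule integrable_const_bound[where B = B], use f in auto, 
        rule integrable_const_bound[where B = "B + e"], use g in auto)
  let ?A = "{w \<in> space M. norm (Y w) > R}"
  have le: "norm (f (Y w) - g (Y w)) \<le> e + (2 * B + e) * indicator ?A w" if "w \<in> space M" for w
  proof (cases "norm (Y w) \<le> R")
    case True
    then show ?thesis using near[OF True] by (simp add: indicator_def)
  next
    case False
    then show ?thesis using f[of "Y w"] g[of "Y w"] e that by (simp add: indicator_def)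
  qed
  have ii: "integrable M (\<lambda>w. e + (2 * B + e) * indicator ?A w)"
    by (intro Bochner_Integration.integrable_add integrable_mult_right integrable_real_indicator)
      (auto simp: emeasure_eq_measure)
  have "norm (LINT w|M. f (Y w) - g (Y w)) \<le> (LINT w|M. norm (f (Y w) - g (Y w)))" by (rule integral_norm_bound)
  also have "\<dots> \<le> (LINT w|M. e + (2 * B + e) * indicator ?A w)"
    by (rule integral_mono[OF _ ii le]) (use i in auto)
  also have "\<dots> = e + (2 * B + e) * prob ?A"
    by (subst Bochner_Integration.integral_add) (auto simp: prob_space emeasure_eq_measure intro!: integrable_mult_right integrable_real_indicator)
  also have "\<dots> \<le> e + (2 * B + e) * \<epsilon>" using tail B0 e by (intro add_left_mono mult_left_mono) auto
  finally show ?thesis using i by simp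
qed

text \<open>Expectations of trigonometric polynomials converge by assumption. A bounded continuous function is
  uniformly close to one on a large ball, and tightness makes the rest of the space negligible since
  the approximation is bounded there as well.\<close>

lemma convergence_of_characteristic_functions:
  fixes Y :: "nat \<Rightarrow> 'w \<Rightarrow> real^'d"
  assumes "prob_space M" "\<And>n. Y n \<in> borel_measurable M"
    and "prob_space \<nu>" "sets \<nu> = sets borel"
    and char: "\<And>t. (\<lambda>n. CLINT w|M. iexp (t \<bullet> Y n w)) \<longlonglongrightarrow> (CLINT x|\<nu>. iexp (t \<bullet> x))"
    and tight: "\<And>\<epsilon>. \<epsilon> > 0 \<Longrightarrow> \<exists>R. \<forall>n\<ge>1. measure M {w \<in> space M. norm (Y n w) > R} \<le> \<epsilon>"
  shows "converges_in_distribution M Y \<nu>"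
  unfolding converges_in_distribution_def
proof (intro allI impI)
  fix f :: "real^'d \<Rightarrow> real"
  assume f: "continuous_on UNIV f \<and> bounded (range f)"
  interpret M: prob_space M by fact
  interpret N: prob_space \<nu> by fact
  note [measurable_cong] = assms(4)
  obtain B where B: "B > 0" "\<And>x. \<bar>f x\<bar> \<le> B" using f by (auto simp: bounded_pos)
  have fm: "f \<in> borel_measurable borel" using f by (auto intro: borel_measurable_continuous_onI)
  have tight\<nu>: "\<exists>R. measure \<nu> {x \<in> space \<nu>. norm x > R} \<le> \<epsilon>" if "\<epsilon> > 0" for \<epsilon>
  proof -
    have "(\<lambda>n. measure \<nu> {x \<in> space \<nu>. norm x > real n}) \<longlonglongrightarrow> measure \<nu> (\<Inter>n. {x \<in> space \<nu>. norm x > real n})"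
      by (rule N.finite_Lim_measure_decseq) (auto simp: decseq_def)
    also have "(\<Inter>n. {x \<in> space \<nu>. norm x > real n}) = {}"
    proof -
      have "\<exists>n. \<not> real n < norm x" for x :: "real^'d"
        using reals_Archimedean2[of "norm x"] by (meson less_asym)
      then show ?thesis by auto
    qed
    finally have "eventually (\<lambda>n. measure \<nu> {x \<in> space \<nu>. norm x > real n} < \<epsilon>) sequentially"
      using that by (intro order_tendstoD) auto
    then show ?thesis by (meson eventually_happens less_imp_le sequentially_bot)
  qed
  show "(\<lambda>n. LINT w|M. f (Y n w)) \<longlonglongrightarrow> (LINT x|\<nu>. f x)"
  proof (rule LIMSEQ_I)
    fix r :: real assume r: "r > 0"
    define e where "e = min 1 (r / 4)"
    define \<epsilon> where "\<epsilon> = r / (16 * (2 * B + 1))"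
    have e: "e > 0" "\<epsilon> > 0" "e \<le> 1" "e \<le> r / 4" using r B by (simp_all add: e_def \<epsilon>_def)
    have small: "e + (2 * B + e) * \<epsilon> \<le> r / 4 + r / 16"
    proof -
      have "(2 * B + e) * \<epsilon> \<le> (2 * B + 1) * \<epsilon>" using e by (intro mult_right_mono) auto
      also have "\<dots> = r / 16" using B by (simp add: \<epsilon>_def field_simps)
      finally show ?thesis using e by linarith
    qed
    obtain R1 where R1: "\<And>n. n \<ge> 1 \<Longrightarrow> measure M {w \<in> space M. norm (Y n w) > R1} \<le> \<epsilon>" using tight[OF e(2)] by blast
    obtain R2 where R2: "measure \<nu> {x \<in> space \<nu>. norm x > R2} \<le> \<epsilon>" using tight\<nu>[OF e(2)] by blast
    define R where "R = max 1 (max R1 R2)"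
    have "measure M {w \<in> space M. norm (Y n w) > R} \<le> measure M {w \<in> space M. norm (Y n w) > R1}" for n
      using assms(2)[of n] by (intro M.finite_measure_mono) (auto simp: R_def)
    then have t1: "measure M {w \<in> space M. norm (Y n w) > R} \<le> \<epsilon>" if "n \<ge> 1" for n
      using R1[OF that] order_trans by blast
    have "measure \<nu> {x \<in> space \<nu>. norm x > R} \<le> measure \<nu> {x \<in> space \<nu>. norm x > R2}"
      by (intro N.finite_measure_mono) (auto simp: R_def)
    then have t2: "measure \<nu> {x \<in> space \<nu>. norm x > R} \<le> \<epsilon>" using R2 by linarith
    have "R > 0" by (simp add: R_def)
    from trig_approximation[of f B e R, OF _ B(2) e(1) this] f
    obtain g :: "real^'d \<Rightarrow> real" where g: "trig_poly (\<lambda>x. of_real (g x))" "\<And>x. \<bar>g x\<bar> \<le> B + e"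
      "\<And>x. norm x \<le> R \<Longrightarrow> \<bar>f x - g x\<bar> \<le> e" by metis
    note tc = trig_poly_convergence[OF assms(1-5) g(1)]
    have gm: "g \<in> borel_measurable borel"
    proof -
      have "(\<lambda>x. complex_of_real (g x)) \<in> borel_measurable borel" using tc by blast
      then show ?thesis by (simp add: borel_measurable_complex_iff)
    qed
    have "(\<lambda>n. Re (CLINT w|M. complex_of_real (g (Y n w)))) \<longlonglongrightarrow> Re (CLINT x|\<nu>. complex_of_real (g x))"
      using tc by (intro tendsto_Re) auto
    then have "(\<lambda>n. LINT w|M. g (Y n w)) \<longlonglongrightarrow> (LINT x|\<nu>. g x)" by simp
    from LIMSEQ_D[OF this, of "r / 4"] r obtain n0 where
      n0: "\<And>n. n \<ge> n0 \<Longrightarrow> \<bar>(LINT w|M. g (Y n w)) - (LINT x|\<nu>. g x)\<bar> < r / 4" by auto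
    have d2: "\<bar>(LINT x|\<nu>. f x) - (LINT x|\<nu>. g x)\<bar> \<le> e + (2 * B + e) * \<epsilon>"
      using bounded_difference_expectation[where R = R and \<epsilon> = \<epsilon> and Y = "\<lambda>x. x", OF assms(3) _ fm gm B(2) g(2,3)] t2 e by simp
    show "\<exists>no. \<forall>n\<ge>no. norm ((LINT w|M. f (Y n w)) - (LINT x|\<nu>. f x)) < r"
    proof (intro exI[of _ "max n0 1"] allI impI)
      fix n assume n: "n \<ge> max n0 1"
      have d1: "\<bar>(LINT w|M. f (Y n w)) - (LINT w|M. g (Y n w))\<bar> \<le> e + (2 * B + e) * \<epsilon>"
        using bounded_difference_expectation[where R = R and \<epsilon> = \<epsilon> and Y = "Y n", OF assms(1,2) fm gm B(2) g(2,3)] t1[of n] n e by simp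
      have "\<bar>(LINT w|M. f (Y n w)) - (LINT x|\<nu>. f x)\<bar> < r"
        using d1 d2 n0[of n] n small r by linarith
      then show "norm ((LINT w|M. f (Y n w)) - (LINT x|\<nu>. f x)) < r" by simp
    qed
  qed
qed


section \<open>Normal laws with a given covariance\<close>

text \<open>The law of \<open>\<Sum>e. \<xi> e *\<^sub>R b e\<close> for independent standard normal \<open>\<xi> e\<close>. The covariance matrix comes
  already factored, as a sum of the rank-one matrices \<open>outer_prod (b e) (b e)\<close>, and is singular when
  the vectors \<open>b e\<close> do not span the space.\<close>

lemma gaussian_combination:
  fixes b :: "'e::finite \<Rightarrow> real^'d"
  obtains \<nu> :: "(real^'d) measure" where "prob_space \<nu>" "sets \<nu> = sets borel"
    "\<And>t. (CLINT x|\<nu>. iexp (t \<bullet> x)) = complex_of_real (exp (- (\<Sum>e\<in>UNIV. (t \<bullet> b e)\<^sup>2) / 2))"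
proof -
  interpret std: prob_space std_normal_distribution
    using real_dist_normal_dist by (simp add: real_distribution_def)
  interpret ps: product_prob_space "\<lambda>_::'e. std_normal_distribution" UNIV ..
  interpret fs: finite_product_prob_space "\<lambda>_::'e. std_normal_distribution" UNIV by standard simp
  let ?P = "PiM (UNIV::'e set) (\<lambda>_. std_normal_distribution)"
  define X where "X \<xi> = (\<Sum>e\<in>UNIV. \<xi> e *\<^sub>R b e)" for \<xi> :: "'e \<Rightarrow> real"
  have coord: "(\<lambda>\<xi>. \<xi> e) \<in> borel_measurable ?P" for e
    using measurable_component_singleton[of e UNIV "\<lambda>_. std_normal_distribution"] by simp
  then have X: "X \<in> borel_measurable ?P" unfolding X_def by measurable
  define \<nu> where "\<nu> = distr ?P borel X"
  have "(CLINT x|\<nu>. iexp (t \<bullet> x)) = complex_of_real (exp (- (\<Sum>e\<in>UNIV. (t \<bullet> b e)\<^sup>2) / 2))" for t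
  proof -
    have int: "integrable std_normal_distribution (\<lambda>x. iexp ((t \<bullet> b e) * x))" for e
      by (rule std.integrable_const_bound[where B = 1]) auto
    have "(CLINT x|\<nu>. iexp (t \<bullet> x)) = (CLINT \<xi>|?P. iexp (t \<bullet> X \<xi>))"
      unfolding \<nu>_def by (rule integral_distr[OF X]) simp
    also have "\<dots> = (CLINT \<xi>|?P. (\<Prod>e\<in>UNIV. iexp ((t \<bullet> b e) * \<xi> e)))"
      by (simp add: X_def inner_sum_right sum_distrib_left mult.commute flip: exp_sum)
    also have "\<dots> = (\<Prod>e\<in>UNIV. CLINT x|std_normal_distribution. iexp ((t \<bullet> b e) * x))"
      by (rule ps.product_integral_prod[of UNIV "\<lambda>e x. iexp ((t \<bullet> b e) * x)"]) (use int in auto)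
    also have "\<dots> = (\<Prod>e\<in>UNIV. complex_of_real (exp (- (t \<bullet> b e)\<^sup>2 / 2)))"
      using char_std_normal_distribution by (simp add: char_def fun_eq_iff)
    also have "\<dots> = complex_of_real (exp (- (\<Sum>e\<in>UNIV. (t \<bullet> b e)\<^sup>2) / 2))"
      by (simp add: exp_sum[symmetric] sum_negf sum_divide_distrib flip: of_real_prod)
    finally show ?thesis .
  qed
  moreover have "prob_space \<nu>" unfolding \<nu>_def by (rule ps.prob_space_distr[OF X])
  ultimately show ?thesis using that[of \<nu>] by (simp add: \<nu>_def)
qed


section \<open>Perturbation of nondegenerate linear programs\<close>

lemma matrix_inv_inverse:
  assumes "invertible A"
  shows "A ** matrix_inv A = mat 1" "matrix_inv A ** A = mat 1"
proof -
  have "A ** matrix_inv A = mat 1 \<and> matrix_inv A ** A = mat 1"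
    using assms unfolding matrix_inv_def invertible_def by (rule someI_ex)
  then show "A ** matrix_inv A = mat 1" "matrix_inv A ** A = mat 1" by auto
qed

text \<open>The cone condition says that the objective \<open>\<omega>\<close> strictly decreases along every direction that keeps the
  active constraints satisfied. A kernel vector and its negative would both be such directions.\<close>

lemma cone_condition_imp_invertible:
  fixes A :: "real^'d^'d"
  assumes cone: "\<And>v. v \<noteq> 0 \<Longrightarrow> (\<And>i. (A *v v) $ i \<le> 0) \<Longrightarrow> \<omega> \<bullet> v < 0"
  shows "invertible A"
proof -
  have "x = 0" if "A *v x = 0" for x
  proof (rule ccontr)
    assume "x \<noteq> 0"
    moreover have "A *v (- x) = 0" using that matrix_vector_mult_diff_distrib[of A 0 x] by simp
    ultimately have "\<omega> \<bullet> x < 0" "\<omega> \<bullet> (- x) < 0"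
      using that cone[of x] cone[of "- x"] by simp_all
    then show False by simp
  qed
  then show ?thesis
    by (simp add: invertible_left_inverse matrix_left_invertible_ker)
qed

text \<open>The multipliers are the coordinates of \<open>\<omega>\<close> in the basis of the rows of \<open>A\<close>. The \<open>i\<close>-th one is positive
  because \<open>\<omega>\<close> decreases along the edge of the cone on which the \<open>i\<close>-th constraint alone is relaxed.\<close>

lemma cone_condition_multipliers:
  fixes A :: "real^'d^'d"
  assumes cone: "\<And>v. v \<noteq> 0 \<Longrightarrow> (\<And>i. (A *v v) $ i \<le> 0) \<Longrightarrow> \<omega> \<bullet> v < 0"
  obtains l :: real and \<eta> :: "real^'d" where "l > 0" "\<And>v. \<omega> \<bullet> v = \<eta> \<bullet> (A *v v)" "\<And>i. l \<le> \<eta> $ i"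
proof -
  have inv: "invertible A" by (rule cone_condition_imp_invertible[OF cone])
  define \<eta> where "\<eta> = transpose (matrix_inv A) *v \<omega>"
  have l: "\<eta> \<bullet> y = \<omega> \<bullet> (matrix_inv A *v y)" for y
    by (simp add: \<eta>_def dot_lmul_matrix[symmetric] vector_transpose_matrix)
  have AA: "A *v (matrix_inv A *v y) = y" "matrix_inv A *v (A *v y) = y" for y
    using inv by (simp_all add: matrix_vector_mul_assoc matrix_inv_inverse)
  have pos: "\<eta> $ i > 0" for i
  proof -
    let ?v = "matrix_inv A *v (- axis i 1)"
    have Av: "A *v ?v = - axis i 1" by (rule AA)
    then have "?v \<noteq> 0" by (metis axis_eq_0_iff matrix_vector_mult_0_right neg_equal_0_iff_equal zero_neq_one)
    then have "\<omega> \<bullet> ?v < 0" by (rule cone) (simp only: Av, simp add: axis_def)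
    then show ?thesis using l[of "- axis i 1"] by (simp add: inner_axis)
  qed
  have "Min (range (($) \<eta>)) > 0" using pos by (subst Min_gr_iff) auto
  moreover have "\<omega> \<bullet> v = \<eta> \<bullet> (A *v v)" for v by (simp add: l AA)
  moreover have "Min (range (($) \<eta>)) \<le> \<eta> $ i" for i by simp
  ultimately show ?thesis by (rule that)
qed

text \<open>Uniform stability of the program with objective \<open>\<omega>\<close>, active constraint matrix \<open>A0\<close> and optimizer
  \<open>\<theta>s\<close>. The perturbed feasible set \<open>F\<close> is only sandwiched: every point of it satisfies the perturbed
  active constraints, and near \<open>\<theta>s\<close> it contains all points that satisfy them with a margin \<open>\<kappa>\<close>. The
  point is that the optimizer solves the perturbed square system up to a multiple of the margin \<open>\<kappa>\<close>,
  which can be far smaller than the perturbation \<open>\<delta>\<close>.\<close>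

definition lp_stable :: "real^'d^'d \<Rightarrow> real^'d \<Rightarrow> real^'d \<Rightarrow> real \<Rightarrow> real \<Rightarrow> real \<Rightarrow> bool" where
  "lp_stable A0 \<omega> \<theta>s \<rho> \<epsilon> C \<longleftrightarrow> (\<forall>A b F \<kappa> \<delta>.
      (\<forall>x. norm ((A - A0) *v x) \<le> \<delta> * norm x) \<and> norm (b - A *v \<theta>s) \<le> \<delta> \<and> 0 \<le> \<kappa> \<and> \<kappa> \<le> \<delta> \<and> \<delta> \<le> \<epsilon> \<and>
      F \<subseteq> {\<theta>. \<forall>i. (A *v \<theta>) $ i \<le> b $ i} \<and>
      {\<theta>. norm (\<theta> - \<theta>s) < \<rho> \<and> (\<forall>i. (A *v \<theta>) $ i \<le> b $ i - \<kappa>)} \<subseteq> F \<longrightarrow>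
      F \<noteq> {} \<and> bdd_above ((\<lambda>\<theta>. \<omega> \<bullet> \<theta>) ` F) \<and>
      (\<forall>\<theta>. lp_optimizer (\<lambda>\<theta>. \<omega> \<bullet> \<theta>) F \<theta> \<longrightarrow> norm (\<theta> - \<theta>s) \<le> C * \<delta> \<and> norm (A *v \<theta> - b) \<le> C * \<kappa>))"

text \<open>Let \<open>\<theta>0\<close> solve \<open>A \<theta> = b\<close>. Since the multipliers are bounded below by \<open>l\<close>, a feasible point loses at
  least \<open>l/2\<close> times its residual \<open>norm (A \<theta> - b)\<close> against \<open>\<theta>0\<close>. On the other hand the solution \<open>\<theta>1\<close> of
  \<open>A \<theta> = b - \<kappa>\<close> is feasible and loses only \<open>O(\<kappa>)\<close>. Hence the residual of an optimizer is \<open>O(\<kappa>)\<close>.\<close>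

lemma lp_perturbation:
  fixes A0 :: "real^'d^'d" and \<theta>s :: "real^'d"
  assumes cone: "\<And>v. v \<noteq> 0 \<Longrightarrow> (\<And>i. (A0 *v v) $ i \<le> 0) \<Longrightarrow> \<omega> \<bullet> v < 0" and "\<rho> > 0"
  shows "\<exists>\<epsilon>>0. \<exists>C\<ge>0. lp_stable A0 \<omega> \<theta>s \<rho> \<epsilon> C"
proof -
  have inv: "invertible A0" by (rule cone_condition_imp_invertible[OF cone])
  obtain l \<eta> where l: "l > 0" "\<And>v. \<omega> \<bullet> v = \<eta> \<bullet> (A0 *v v)" "\<And>i. l \<le> \<eta> $ i"
    using cone_condition_multipliers[OF cone] by metis
  have "inj ((*v) A0)" using inv by (simp add: invertible_left_inverse matrix_left_invertible_injective)
  then obtain m where m: "m > 0" "\<And>x. m * norm x \<le> norm (A0 *v x)"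
    using linear_inj_bounded_below_pos[OF matrix_vector_mul_linear] by metis
  define n where "n = real CARD('d)"
  have n: "n \<ge> 1" by (simp add: n_def)
  \<comment> \<open>The three bounds keep \<open>A\<close> uniformly invertible, keep half of the multipliers, and keep \<open>\<theta>1\<close> within
    distance \<open>\<rho>\<close> of \<open>\<theta>s\<close>.\<close>
  define \<epsilon> where "\<epsilon> = Min {m / 2, l * m / (4 * (norm \<eta> + 1)), \<rho> * m / (4 * (1 + n))}"
  define C1 where "C1 = (2 / l) * norm \<omega> * (2 / m) * n"
  define C where "C = C1 + (2 / m) * (C1 + 1)"
  have \<epsilon>: "\<epsilon> > 0" "\<epsilon> \<le> m / 2" "\<epsilon> \<le> l * m / (4 * (norm \<eta> + 1))" "\<epsilon> \<le> \<rho> * m / (4 * (1 + n))"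
  proof -
    have "0 < l * m / (4 * (norm \<eta> + 1))" "0 < \<rho> * m / (4 * (1 + n))"
      using m l \<open>\<rho> > 0\<close> n by (simp_all add: add_nonneg_pos)
    then show "\<epsilon> > 0" unfolding \<epsilon>_def using m by simp
  qed (unfold \<epsilon>_def, (rule Min_le; simp)+)
  have C: "C1 \<ge> 0" "C1 \<le> C" "(2 / m) * (C1 + 1) \<le> C" using l m n by (auto simp: C1_def C_def)
  show ?thesis
    unfolding lp_stable_def
  proof (rule exI[of _ \<epsilon>], intro exI[of _ C] conjI allI impI)
    show "\<epsilon> > 0" by fact
    show "C \<ge> 0" using C by simp
    fix A :: "real^'d^'d" and b :: "real^'d" and F :: "(real^'d) set" and \<kappa> \<delta> :: real
    assume asm: "(\<forall>x. norm ((A - A0) *v x) \<le> \<delta> * norm x) \<and> norm (b - A *v \<theta>s) \<le> \<delta> \<and> 0 \<le> \<kappa> \<and> \<kappa> \<le> \<delta> \<and> \<delta> \<le> \<epsilon> \<and>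
      F \<subseteq> {\<theta>. \<forall>i. (A *v \<theta>) $ i \<le> b $ i} \<and>
      {\<theta>. norm (\<theta> - \<theta>s) < \<rho> \<and> (\<forall>i. (A *v \<theta>) $ i \<le> b $ i - \<kappa>)} \<subseteq> F"
    have A: "norm ((A - A0) *v x) \<le> \<delta> * norm x" and b: "norm (b - A *v \<theta>s) \<le> \<delta>"
      and \<kappa>: "0 \<le> \<kappa>" "\<kappa> \<le> \<delta>" and \<delta>: "\<delta> \<le> \<epsilon>" for x using asm by blast+
    have outer: "(A *v \<theta>) $ i \<le> b $ i" if "\<theta> \<in> F" for \<theta> i using asm that by blast
    have inner: "\<theta> \<in> F" if "norm (\<theta> - \<theta>s) < \<rho>" "\<And>i. (A *v \<theta>) $ i \<le> b $ i - \<kappa>" for \<theta>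
      using asm that by blast
    have below: "norm x \<le> (2 / m) * norm (A *v x)" for x
    proof -
      have "norm (A0 *v x) \<le> norm (A *v x) + norm ((A - A0) *v x)"
        using norm_triangle_ineq4[of "A *v x" "(A - A0) *v x"] by (simp add: matrix_vector_mult_diff_rdistrib)
      then have "m * norm x \<le> norm (A *v x) + (m / 2) * norm x"
        using m(2)[of x] A[of x] mult_right_mono[of \<delta> "m / 2" "norm x"] \<delta> \<epsilon>(2) by simp
      then show ?thesis using m(1) by (simp add: field_simps)
    qed
    have "inj ((*v) A)"
    proof (subst linear_injective_0[OF matrix_vector_mul_linear], intro allI impI)
      fix x assume "A *v x = 0" then show "x = 0" using below[of x] by simp
    qed
    then have surj: "surj ((*v) A)" by (rule linear_inj_imp_surj[OF matrix_vector_mul_linear])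
    obtain \<theta>0 where \<theta>0: "A *v \<theta>0 = b" using surj by (metis surjD)
    define ones :: "real^'d" where "ones = (\<chi> i. \<kappa>)"
    obtain \<theta>1 where \<theta>1: "A *v \<theta>1 = b - ones" using surj by (metis surjD)
    have ones: "norm ones \<le> \<kappa> * n"
      using norm_le_l1_cart[of ones] \<kappa> by (simp add: ones_def n_def mult.commute)
    have upper: "\<omega> \<bullet> \<theta> \<le> \<omega> \<bullet> \<theta>0 - (l / 2) * norm (A *v \<theta> - b)" if "\<theta> \<in> F" for \<theta>
    proof -
      define v where "v = \<theta> - \<theta>0"
      have Av: "A *v v = A *v \<theta> - b" by (simp add: v_def matrix_vector_mult_diff_distrib \<theta>0)
      have le0: "(A *v v) $ i \<le> 0" for i using outer[OF that, of i] by (simp add: Av)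
      have "l * norm (A *v v) \<le> l * (\<Sum>i\<in>UNIV. \<bar>(A *v v) $ i\<bar>)"
        using l(1) norm_le_l1_cart by (intro mult_left_mono) auto
      also have "\<dots> \<le> (\<Sum>i\<in>UNIV. \<eta> $ i * (- (A *v v) $ i))"
        unfolding sum_distrib_left using le0 l(3) by (intro sum_mono) (simp add: mult_right_mono_neg)
      also have "\<dots> = - (\<eta> \<bullet> (A *v v))" by (simp add: inner_vec_def sum_negf)
      finally have 1: "\<eta> \<bullet> (A *v v) \<le> - l * norm (A *v v)" by simp
      have "\<bar>\<eta> \<bullet> ((A - A0) *v v)\<bar> \<le> norm \<eta> * (\<delta> * norm v)"
        using Cauchy_Schwarz_ineq2[of \<eta> "(A - A0) *v v"] mult_left_mono[OF A[of v], of "norm \<eta>"] by simp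
      also have "\<dots> \<le> norm \<eta> * (\<epsilon> * ((2 / m) * norm (A *v v)))"
        using below[of v] \<delta> \<epsilon>(1) by (intro mult_left_mono mult_mono) auto
      also have "\<dots> \<le> (norm \<eta> + 1) * (l * m / (4 * (norm \<eta> + 1)) * ((2 / m) * norm (A *v v)))"
        using \<epsilon>(1,3) m by (intro mult_mono mult_nonneg_nonneg) auto
      also have "\<dots> = (l / 2) * norm (A *v v)"
        using m(1) by (simp add: field_simps add_nonneg_eq_0_iff)
      finally have 2: "\<bar>\<eta> \<bullet> ((A - A0) *v v)\<bar> \<le> (l / 2) * norm (A *v v)" .
      have "\<omega> \<bullet> v = \<eta> \<bullet> (A *v v) - \<eta> \<bullet> ((A - A0) *v v)"
        by (simp add: l(2) matrix_vector_mult_diff_rdistrib inner_diff_right)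
      also have "\<dots> \<le> - (l / 2) * norm (A *v v)" using 1 2 by (simp add: abs_le_iff)
      finally show ?thesis by (simp add: v_def inner_diff_right Av[unfolded v_def])
    qed
    have \<theta>1F: "\<theta>1 \<in> F"
    proof (rule inner)
      show "(A *v \<theta>1) $ i \<le> b $ i - \<kappa>" for i by (simp add: \<theta>1 ones_def)
      have "norm (A *v (\<theta>1 - \<theta>s)) = norm ((b - A *v \<theta>s) - ones)"
        by (simp add: matrix_vector_mult_diff_distrib \<theta>1 algebra_simps)
      also have "\<dots> \<le> \<delta> + \<kappa> * n" using b ones norm_triangle_ineq4 by (metis add_mono order_trans)
      also have "\<dots> \<le> \<epsilon> + \<epsilon> * n"
        using \<delta> mult_right_mono[OF order_trans[OF \<kappa>(2) \<delta>] order_trans[OF zero_le_one n]] by linarith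
      also have "\<dots> = \<epsilon> * (1 + n)" by (simp add: distrib_left)
      finally have "norm (\<theta>1 - \<theta>s) \<le> (2 / m) * (\<epsilon> * (1 + n))"
        using below[of "\<theta>1 - \<theta>s"] m(1) by (meson divide_nonneg_pos less_imp_le mult_left_mono order_trans zero_le_numeral)
      also have "\<dots> \<le> (2 / m) * (\<rho> * m / (4 * (1 + n)) * (1 + n))"
        using \<epsilon>(4) m(1) n by (intro mult_left_mono mult_right_mono) auto
      also have "\<dots> = \<rho> / 2"
      proof -
        have "(2 / m) * (\<rho> * m / (4 * k) * k) = \<rho> / 2" if "k \<noteq> 0" for k
          using that m(1) by (simp add: field_simps)
        from this[of "1 + n"] n show ?thesis by linarith
      qed
      also have "\<dots> < \<rho>" using \<open>\<rho> > 0\<close> by simp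
      finally show "norm (\<theta>1 - \<theta>s) < \<rho>" .
    qed
    have lower: "\<omega> \<bullet> \<theta>1 \<ge> \<omega> \<bullet> \<theta>0 - norm \<omega> * ((2 / m) * (\<kappa> * n))"
    proof -
      have "A *v (\<theta>0 - \<theta>1) = ones" by (simp add: matrix_vector_mult_diff_distrib \<theta>0 \<theta>1)
      then have "norm (\<theta>0 - \<theta>1) \<le> (2 / m) * (\<kappa> * n)"
        using below[of "\<theta>0 - \<theta>1"] ones m(1)
        by (metis divide_nonneg_pos mult_left_mono order_trans zero_le_numeral)
      then have "norm \<omega> * norm (\<theta>0 - \<theta>1) \<le> norm \<omega> * ((2 / m) * (\<kappa> * n))" by (rule mult_left_mono) simp
      moreover have "\<omega> \<bullet> (\<theta>0 - \<theta>1) \<le> norm \<omega> * norm (\<theta>0 - \<theta>1)" by (rule norm_cauchy_schwarz)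
      ultimately show ?thesis by (simp add: inner_diff_right)
    qed
    show "F \<noteq> {}" using \<theta>1F by blast
    show "bdd_above ((\<lambda>\<theta>. \<omega> \<bullet> \<theta>) ` F)"
    proof (rule bdd_aboveI2)
      fix \<theta> assume "\<theta> \<in> F"
      moreover have "0 \<le> (l / 2) * norm (A *v \<theta> - b)" using l(1) by simp
      ultimately show "\<omega> \<bullet> \<theta> \<le> \<omega> \<bullet> \<theta>0" using upper[of \<theta>] by linarith
    qed
    have opt_bounds: "norm (\<theta> - \<theta>s) \<le> C * \<delta> \<and> norm (A *v \<theta> - b) \<le> C * \<kappa>"
      if opt: "lp_optimizer (\<lambda>\<theta>. \<omega> \<bullet> \<theta>) F \<theta>" for \<theta>
    proof -
      have \<theta>: "\<theta> \<in> F" "\<omega> \<bullet> \<theta> \<ge> \<omega> \<bullet> \<theta>1"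
        using opt \<theta>1F by (auto simp: lp_optimizer_def is_arg_max_def not_less)
      have "(l / 2) * norm (A *v \<theta> - b) \<le> norm \<omega> * ((2 / m) * (\<kappa> * n))"
        using upper[OF \<theta>(1)] \<theta>(2) lower by linarith
      then have res: "norm (A *v \<theta> - b) \<le> C1 * \<kappa>" using l(1) m(1) by (simp add: C1_def field_simps)
      have "A *v (\<theta> - \<theta>s) = (A *v \<theta> - b) + (b - A *v \<theta>s)" by (simp add: matrix_vector_mult_diff_distrib)
      then have "norm (A *v (\<theta> - \<theta>s)) \<le> C1 * \<kappa> + \<delta>" using norm_triangle_mono[OF res b] by simp
      also have "\<dots> \<le> (C1 + 1) * \<delta>" using \<kappa> C(1) by (simp add: distrib_right mult_left_mono)
      finally have "(2 / m) * norm (A *v (\<theta> - \<theta>s)) \<le> (2 / m) * ((C1 + 1) * \<delta>)"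
        using m(1) by (intro mult_left_mono) auto
      then have "norm (\<theta> - \<theta>s) \<le> (2 / m) * (C1 + 1) * \<delta>" using below[of "\<theta> - \<theta>s"] unfolding mult.assoc by (rule order_trans[rotated])
      also have "\<dots> \<le> C * \<delta>" using C(3) \<kappa> by (intro mult_right_mono) auto
      finally show ?thesis using res mult_right_mono[OF C(2) \<kappa>(1)] by simp
    qed
    show "norm (\<theta> - \<theta>s) \<le> C * \<delta>" "norm (A *v \<theta> - b) \<le> C * \<kappa>"
      if "lp_optimizer (\<lambda>\<theta>. \<omega> \<bullet> \<theta>) F \<theta>" for \<theta>
      using opt_bounds[OF that] by simp_all
  qed
qed


section \<open>The limiting linear program\<close>

lemma expectation_finite_pmf:
  fixes f :: "'z::finite \<Rightarrow> 'b::{banach, second_countable_topology}"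
  shows "measure_pmf.expectation p f = (\<Sum>e\<in>UNIV. pmf p e *\<^sub>R f e)"
  by (rule integral_measure_pmf) auto

lemma weighted_matrix_vector_mult:
  fixes A :: "'e \<Rightarrow> real^'n^'m"
  shows "(\<Sum>e\<in>E. q e *\<^sub>R A e) *v x = (\<Sum>e\<in>E. q e *\<^sub>R (A e *v x))"
proof -
  have lin: "linear (\<lambda>A :: real^'n^'m. A *v x)"
    by (rule linearI) (simp_all add: matrix_vector_mult_add_rdistrib scaleR_matrix_vector_assoc)
  show ?thesis by (simp only: linear_sum[OF lin] linear_scale[OF lin])
qed

lemma Q_min_le: "Q_min \<psi> \<theta> x \<le> Q_fun \<psi> \<theta> (x, u)"
  unfolding Q_min_def by (rule Min_le) auto

lemma Q_min_attained: "\<exists>u. Q_min \<psi> \<theta> x = Q_fun \<psi> \<theta> (x, u)"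
proof -
  have "Q_min \<psi> \<theta> x \<in> range (\<lambda>u. Q_fun \<psi> \<theta> (x, u))" unfolding Q_min_def by (rule Min_in) auto
  then show ?thesis by auto
qed

lemma greedy_Q_min:
  fixes \<psi> :: "'x \<times> 'u::finite \<Rightarrow> real^'d"
  assumes "greedy \<psi> \<theta> \<phi>"
  shows "Q_min \<psi> \<theta> x = Q_fun \<psi> \<theta> (x, \<phi> x)"
proof -
  obtain u where "Q_min \<psi> \<theta> x = Q_fun \<psi> \<theta> (x, u)" using Q_min_attained[of \<psi> \<theta> x] by blast
  moreover have "Q_fun \<psi> \<theta> (x, \<phi> x) \<le> Q_fun \<psi> \<theta> (x, u)"
    using assms by (auto simp: greedy_def is_arg_min_def not_less)
  ultimately show ?thesis using Q_min_le[of \<psi> \<theta> x "\<phi> x"] by simp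
qed

lemma TD_pol_eq: "TD_pol c \<gamma> \<psi> \<theta> \<phi> (z, x') = - Q_fun \<psi> \<theta> z + c z + \<gamma> * Q_fun \<psi> \<theta> (x', \<phi> x')"
  by (simp add: TD_pol_def Q_fun_def inner_diff_right)

text \<open>For a fixed policy the constraints are affine in \<open>\<theta>\<close>, with coefficients given by \<open>A_mat\<close> and \<open>b_vec\<close>.\<close>

lemma A_mat_residual:
  "(A_mat \<gamma> \<psi> \<zeta> \<phi> j e *v \<theta> - b_vec c \<zeta> j e) $ i = - TD_pol c \<gamma> \<psi> \<theta> \<phi> e * \<zeta> (fst e) $ j i"
proof -
  obtain z x' where e: "e = (z, x')" by (cases e)
  have "(A_mat \<gamma> \<psi> \<zeta> \<phi> j e *v \<theta>) $ i = (\<theta> \<bullet> (\<psi> z - \<gamma> *\<^sub>R \<psi> (x', \<phi> x'))) * \<zeta> z $ j i"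
    by (simp add: e A_mat_def matrix_vector_mult_def inner_vec_def sum_distrib_left sum_distrib_right mult_ac)
  then show ?thesis by (simp add: e b_vec_def TD_pol_eq Q_fun_def inner_diff_right algebra_simps)
qed

lemma Q_min_lipschitz:
  fixes \<psi> :: "'x \<times> 'u::finite \<Rightarrow> real^'d"
  assumes B: "\<And>z. norm (\<psi> z) \<le> B"
  shows "\<bar>Q_min \<psi> \<theta> x - Q_min \<psi> \<theta>' x\<bar> \<le> B * norm (\<theta> - \<theta>')"
proof -
  have d: "Q_fun \<psi> \<theta> z - Q_fun \<psi> \<theta>' z \<le> B * norm (\<theta> - \<theta>')" for \<theta> \<theta>' z
  proof -
    have "(\<theta> - \<theta>') \<bullet> \<psi> z \<le> norm (\<theta> - \<theta>') * norm (\<psi> z)" by (rule norm_cauchy_schwarz)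
    also have "\<dots> \<le> norm (\<theta> - \<theta>') * B" by (intro mult_left_mono B) simp
    finally show ?thesis by (simp add: Q_fun_def inner_diff_left mult.commute)
  qed
  have one: "Q_min \<psi> \<theta> x - Q_min \<psi> \<theta>' x \<le> B * norm (\<theta> - \<theta>')" for \<theta> \<theta>'
  proof -
    obtain u where "Q_min \<psi> \<theta>' x = Q_fun \<psi> \<theta>' (x, u)" using Q_min_attained[of \<psi> \<theta>' x] by blast
    then show ?thesis using Q_min_le[of \<psi> \<theta> x u] d[of \<theta> "(x, u)" \<theta>'] by linarith
  qed
  show ?thesis using one[of \<theta> \<theta>'] one[of \<theta>' \<theta>] by (simp add: norm_minus_commute abs_le_iff)
qed

locale projected_bellman_lp =
  fixes P :: "'u::finite \<Rightarrow> 'x::finite \<Rightarrow> 'x pmf"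
    and \<pi> \<mu> :: "('x \<times> 'u) pmf"
    and c :: "'x \<times> 'u \<Rightarrow> real"
    and \<gamma> :: real
    and \<psi> :: "'x \<times> 'u \<Rightarrow> real^'d"
    and \<zeta> :: "'x \<times> 'u \<Rightarrow> real^'p"
    and \<theta>s :: "real^'d"
    and \<phi>s :: "'x \<Rightarrow> 'u"
    and j :: "'d \<Rightarrow> 'p"
  assumes gamma_pos: "0 < \<gamma>"
    and zeta_nonneg: "\<And>z i. 0 \<le> \<zeta> z $ i"
    and optimizer: "lp_optimizer (objective \<mu> \<psi>) (lim_feasible P \<pi> c \<gamma> \<psi> \<zeta>) \<theta>s"
    and unique: "\<And>\<theta>'. lp_optimizer (objective \<mu> \<psi>) (lim_feasible P \<pi> c \<gamma> \<psi> \<zeta>) \<theta>' \<Longrightarrow> \<theta>' = \<theta>s"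
    and greedy: "greedy \<psi> \<theta>s \<phi>s"
    and basic: "basic_solution P \<pi> c \<gamma> \<psi> \<zeta> \<theta>s \<phi>s j"
begin

abbreviation (input) Q :: "real^'d \<Rightarrow> 'x \<times> 'u \<Rightarrow> real" where
  "Q \<equiv> Q_fun \<psi>"

abbreviation (input) Qmin :: "real^'d \<Rightarrow> 'x \<Rightarrow> real" where
  "Qmin \<equiv> Q_min \<psi>"

abbreviation (input) td :: "real^'d \<Rightarrow> ('x \<times> 'u) \<times> 'x \<Rightarrow> real" where
  "td \<equiv> TD c \<gamma> \<psi>"

abbreviation (input) td_pol :: "real^'d \<Rightarrow> ('x \<Rightarrow> 'u) \<Rightarrow> ('x \<times> 'u) \<times> 'x \<Rightarrow> real" where
  "td_pol \<equiv> TD_pol c \<gamma> \<psi>"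

abbreviation (input) g :: "real^'d \<Rightarrow> ('x \<Rightarrow> 'u) \<Rightarrow> real^'p" where
  "g \<equiv> g_bar P \<pi> c \<gamma> \<psi> \<zeta>"

abbreviation (input) A :: "('x \<times> 'u) \<times> 'x \<Rightarrow> real^'d^'d" where
  "A \<equiv> A_mat \<gamma> \<psi> \<zeta> \<phi>s j"

definition pair_law :: "('x \<times> 'u) \<times> 'x \<Rightarrow> real" where
  "pair_law e = pmf (steady_pmf P \<pi>) e"

text \<open>The constraint functions when pairs \<open>(z, x')\<close> are weighted by \<open>q\<close>. Taking \<open>q\<close> to be the steady-state
  law of such pairs or their empirical frequencies gives the limiting or the sampled program.\<close>

definition slack :: "(('x \<times> 'u) \<times> 'x \<Rightarrow> real) \<Rightarrow> real^'d \<Rightarrow> 'p \<Rightarrow> real" where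
  "slack q \<theta> k = (\<Sum>e\<in>UNIV. q e * (- td \<theta> e * \<zeta> (fst e) $ k))"

definition feasible :: "(('x \<times> 'u) \<times> 'x \<Rightarrow> real) \<Rightarrow> (real^'d) set" where
  "feasible q = {\<theta>. \<forall>k. slack q \<theta> k \<le> 0}"

text \<open>Coefficients of the active constraints for the fixed policy \<open>\<phi>s\<close>, with pairs weighted by \<open>q\<close>.\<close>

definition A_of :: "(('x \<times> 'u) \<times> 'x \<Rightarrow> real) \<Rightarrow> real^'d^'d" where
  "A_of q = (\<Sum>e\<in>UNIV. q e *\<^sub>R A e)"

definition b_of :: "(('x \<times> 'u) \<times> 'x \<Rightarrow> real) \<Rightarrow> real^'d" where
  "b_of q = (\<Sum>e\<in>UNIV. q e *\<^sub>R b_vec c \<zeta> j e)"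

definition deviation :: "(('x \<times> 'u) \<times> 'x \<Rightarrow> real) \<Rightarrow> real" where
  "deviation q = (\<Sum>e\<in>UNIV. \<bar>q e - pair_law e\<bar>)"

definition null_mass :: "(('x \<times> 'u) \<times> 'x \<Rightarrow> real) \<Rightarrow> real" where
  "null_mass q = (\<Sum>e\<in>UNIV. if pair_law e = 0 then q e else 0)"

lemma pair_law_nonneg: "0 \<le> pair_law e"
  by (simp add: pair_law_def)

lemma null_mass_pair_law [simp]: "null_mass pair_law = 0"
  by (auto simp: null_mass_def intro: sum.neutral)

lemma deviation_pair_law [simp]: "deviation pair_law = 0"
  by (simp add: deviation_def)

lemma null_mass_nonneg: "(\<And>e. 0 \<le> q e) \<Longrightarrow> 0 \<le> null_mass q"
  unfolding null_mass_def by (intro sum_nonneg) auto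

lemma null_mass_le_deviation: "null_mass q \<le> deviation q"
  unfolding null_mass_def deviation_def by (intro sum_mono) auto

lemma deviation_nonneg: "0 \<le> deviation q"
  unfolding deviation_def by (intro sum_nonneg) auto

lemma A_bar_eq: "A_bar P \<pi> \<gamma> \<psi> \<zeta> \<phi>s j = A_of pair_law"
  by (simp add: A_bar_def A_of_def expectation_finite_pmf pair_law_def)

lemma b_bar_eq: "b_bar P \<pi> c \<zeta> j = b_of pair_law"
  by (simp add: b_bar_def b_of_def expectation_finite_pmf pair_law_def)

lemma g_bar_eq: "g \<theta> \<phi> $ k = (\<Sum>e\<in>UNIV. pair_law e * (- td_pol \<theta> \<phi> e * \<zeta> (fst e) $ k))"
  by (simp add: g_bar_def expectation_finite_pmf pair_law_def case_prod_beta mult.assoc)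

lemma TD_le_TD_pol: "td \<theta> e \<le> td_pol \<theta> \<phi> e"
  using Q_min_le[of \<psi> \<theta> "snd e" "\<phi> (snd e)"] gamma_pos
  by (cases e) (simp add: TD_def TD_pol_eq)

lemma TD_greedy: "greedy \<psi> \<theta> \<phi> \<Longrightarrow> td \<theta> e = td_pol \<theta> \<phi> e"
  by (cases e) (simp add: TD_def TD_pol_eq greedy_Q_min)

lemma g_bar_le_slack: "g \<theta> \<phi> $ k \<le> slack pair_law \<theta> k"
  unfolding g_bar_eq slack_def
  by (intro sum_mono mult_left_mono mult_right_mono pair_law_nonneg zeta_nonneg) (simp add: TD_le_TD_pol)

lemma g_bar_greedy: "greedy \<psi> \<theta> \<phi> \<Longrightarrow> g \<theta> \<phi> $ k = slack pair_law \<theta> k"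
  by (simp add: g_bar_eq slack_def TD_greedy)

lemma ex_greedy: "\<exists>\<phi>. greedy \<psi> \<theta> \<phi>"
proof -
  have "\<exists>u. Qmin \<theta> x = Q \<theta> (x, u)" for x by (rule Q_min_attained)
  then obtain \<phi> where \<phi>: "\<And>x. Qmin \<theta> x = Q \<theta> (x, \<phi> x)" by metis
  have "greedy \<psi> \<theta> \<phi>"
    unfolding greedy_def is_arg_min_def by (auto simp: not_less simp flip: \<phi> intro: Q_min_le)
  then show ?thesis by blast
qed

text \<open>Since \<open>\<zeta>\<close> is nonnegative, the constraint functions of all policies are dominated by that of a greedy one.\<close>

lemma lim_feasible_eq: "lim_feasible P \<pi> c \<gamma> \<psi> \<zeta> = feasible pair_law"
  unfolding lim_feasible_def feasible_def
  using g_bar_le_slack g_bar_greedy ex_greedy by (metis (no_types, opaque_lifting) order_trans)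

lemma linear_residual:
  "(A_of q *v \<theta> - b_of q) $ i = (\<Sum>e\<in>UNIV. q e * (- td_pol \<theta> \<phi>s e * \<zeta> (fst e) $ j i))"
proof -
  have "A_of q *v \<theta> = (\<Sum>e\<in>UNIV. q e *\<^sub>R (A e *v \<theta>))"
    unfolding A_of_def
    by (rule weighted_matrix_vector_mult)
  then have "A_of q *v \<theta> - b_of q = (\<Sum>e\<in>UNIV. q e *\<^sub>R (A e *v \<theta> - b_vec c \<zeta> j e))"
    by (simp add: b_of_def scaleR_diff_right sum_subtractf)
  then show ?thesis by (simp only: sum_component vector_scaleR_component A_mat_residual real_scaleR_def)
qed

text \<open>Freezing the policy can only relax a constraint; this holds globally in \<open>\<theta>\<close> and is what confines
  the sampled program to the affine active constraints.\<close>

lemma linear_residual_le_slack: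
  assumes "\<And>e. 0 \<le> q e"
  shows "(A_of q *v \<theta> - b_of q) $ i \<le> slack q \<theta> (j i)"
  unfolding linear_residual slack_def
  by (intro sum_mono mult_left_mono mult_right_mono assms zeta_nonneg) (simp add: TD_le_TD_pol)

lemma active: "slack pair_law \<theta>s (j i) = 0"
proof -
  have "j i \<in> range j" by simp
  then have "g \<theta>s \<phi>s $ j i = 0"
    using basic by (auto simp: basic_solution_def bij_betw_def)
  then show ?thesis using g_bar_greedy[OF greedy] by simp
qed

lemma inactive: "k \<notin> range j \<Longrightarrow> slack pair_law \<theta>s k < 0"
  using basic g_bar_greedy[OF greedy] by (auto simp: basic_solution_def)

lemma b_of_pair_law: "b_of pair_law = A_of pair_law *v \<theta>s"
proof -
  have "(A_of pair_law *v \<theta>s - b_of pair_law) $ i = slack pair_law \<theta>s (j i)" for i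
    unfolding linear_residual slack_def by (simp add: TD_greedy[OF greedy])
  then have "A_of pair_law *v \<theta>s - b_of pair_law = 0" by (simp add: vec_eq_iff active del: vector_minus_component)
  then show ?thesis by simp
qed

text \<open>Change \<open>\<phi>s\<close> at the single state \<open>x'\<close> to the tied action \<open>u\<close>. The constraint \<open>j i\<close> of the new policy is
  also active at \<open>\<theta>s\<close>, so it must coincide with that of \<open>\<phi>s\<close> for all \<open>\<theta>\<close>. The two differ by a
  positive multiple of \<open>\<theta> \<bullet> (\<psi> (x', u) - \<psi> (x', \<phi>s x'))\<close>.\<close>

lemma tie_has_equal_basis:
  assumes e: "pair_law (z, x') > 0" "\<zeta> z $ j i > 0"
    and tie: "Q \<theta>s (x', u) = Q \<theta>s (x', \<phi>s x')"
  shows "\<psi> (x', u) = \<psi> (x', \<phi>s x')"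
proof -
  define \<phi> where "\<phi> = \<phi>s(x' := u)"
  have "td_pol \<theta>s \<phi> e = td_pol \<theta>s \<phi>s e" for e
    by (cases e) (simp add: TD_pol_eq \<phi>_def tie)
  then have "g \<theta>s \<phi> $ j i = g \<theta>s \<phi>s $ j i"
    by (simp add: g_bar_eq)
  then have "g \<theta>s \<phi> $ j i = 0"
    using active[of i] g_bar_greedy[OF greedy] by simp
  moreover have "g \<theta>s \<phi> $ j i < 0 \<or>
      (\<forall>\<theta>. g \<theta> \<phi> $ j i = g \<theta> \<phi>s $ j i)"
    using basic unfolding basic_solution_def by blast
  ultimately have same: "g \<theta> \<phi> $ j i = g \<theta> \<phi>s $ j i" for \<theta>
    by simp
  \<comment> \<open>Testing with \<open>\<theta> = v\<close> turns the difference into a sum of nonnegative terms.\<close>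
  define v where "v = \<psi> (x', u) - \<psi> (x', \<phi>s x')"
  have "(\<Sum>e\<in>UNIV. pair_law e * (\<gamma> * (if snd e = x' then v \<bullet> v else 0) * \<zeta> (fst e) $ j i)) = 0"
  proof -
    have "td_pol v \<phi> e - td_pol v \<phi>s e = \<gamma> * (if snd e = x' then v \<bullet> v else 0)" for e
      by (cases e) (auto simp: TD_pol_eq \<phi>_def v_def Q_fun_def inner_diff_right algebra_simps)
    then have "(\<Sum>e\<in>UNIV. pair_law e * (\<gamma> * (if snd e = x' then v \<bullet> v else 0) * \<zeta> (fst e) $ j i))
      = (\<Sum>e\<in>UNIV. pair_law e * ((td_pol v \<phi> e - td_pol v \<phi>s e) * \<zeta> (fst e) $ j i))" by simp
    also have "\<dots> = g v \<phi>s $ j i - g v \<phi> $ j i"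
      unfolding g_bar_eq sum_subtractf[symmetric] by (intro sum.cong refl) (simp add: algebra_simps)
    finally show ?thesis using same[of v] by simp
  qed
  moreover have "0 \<le> pair_law e * (\<gamma> * (if snd e = x' then v \<bullet> v else 0) * \<zeta> (fst e) $ j i)" for e
    using gamma_pos by (intro mult_nonneg_nonneg pair_law_nonneg zeta_nonneg) auto
  ultimately have "\<forall>e\<in>UNIV. pair_law e * (\<gamma> * (if snd e = x' then v \<bullet> v else 0) * \<zeta> (fst e) $ j i) = 0"
    by (subst (asm) sum_nonneg_eq_0_iff) auto
  from bspec[OF this, of "(z, x')"] have "pair_law (z, x') * (\<gamma> * (v \<bullet> v) * \<zeta> z $ j i) = 0"
    by simp
  then have "v \<bullet> v = 0" using e gamma_pos by simp
  then show ?thesis by (simp add: v_def)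
qed

text \<open>Actions that are strictly worse at \<open>\<theta>s\<close> stay worse nearby, and actions that tie give the same value
  for every \<open>\<theta>\<close>.\<close>

lemma locally_greedy:
  obtains \<rho> where "\<rho> > 0"
    "\<And>\<theta> z x' i. norm (\<theta> - \<theta>s) < \<rho> \<Longrightarrow> pair_law (z, x') > 0 \<Longrightarrow> \<zeta> z $ j i > 0 \<Longrightarrow>
      Qmin \<theta> x' = Q \<theta> (x', \<phi>s x')"
proof -
  have "\<forall>\<^sub>F \<theta> in nhds \<theta>s. Q \<theta>s (x, \<phi>s x) < Q \<theta>s (x, u) \<longrightarrow> Q \<theta> (x, \<phi>s x) \<le> Q \<theta> (x, u)" for x u
  proof (cases "Q \<theta>s (x, \<phi>s x) < Q \<theta>s (x, u)")
    case True
    have "((\<lambda>\<theta>. Q \<theta> (x, u) - Q \<theta> (x, \<phi>s x)) \<longlongrightarrow> Q \<theta>s (x, u) - Q \<theta>s (x, \<phi>s x)) (nhds \<theta>s)"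
      unfolding Q_fun_def by (intro tendsto_intros filterlim_ident)
    then have "\<forall>\<^sub>F \<theta> in nhds \<theta>s. 0 < Q \<theta> (x, u) - Q \<theta> (x, \<phi>s x)"
      by (rule order_tendstoD) (use True in simp)
    then show ?thesis by eventually_elim simp
  qed simp
  then have "\<forall>\<^sub>F \<theta> in nhds \<theta>s. \<forall>x u. Q \<theta>s (x, \<phi>s x) < Q \<theta>s (x, u) \<longrightarrow> Q \<theta> (x, \<phi>s x) \<le> Q \<theta> (x, u)"
    by (intro eventually_all_finite)
  then obtain \<rho> where \<rho>: "\<rho> > 0" "\<And>\<theta> x u. dist \<theta> \<theta>s < \<rho> \<Longrightarrow> Q \<theta>s (x, \<phi>s x) < Q \<theta>s (x, u) \<Longrightarrow> Q \<theta> (x, \<phi>s x) \<le> Q \<theta> (x, u)"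
    unfolding eventually_nhds_metric by blast
  show ?thesis
  proof (rule that[OF \<rho>(1)])
    fix \<theta> z x' i assume \<theta>: "norm (\<theta> - \<theta>s) < \<rho>" and e: "pair_law (z, x') > 0" "\<zeta> z $ j i > 0"
    obtain u where u: "Qmin \<theta> x' = Q \<theta> (x', u)" using Q_min_attained[of \<psi> \<theta> x'] by blast
    have "Q \<theta>s (x', \<phi>s x') \<le> Q \<theta>s (x', u)"
      using Q_min_le[of \<psi> \<theta>s x' u] by (simp add: greedy_Q_min[OF greedy])
    then consider "Q \<theta>s (x', \<phi>s x') < Q \<theta>s (x', u)" | "Q \<theta>s (x', u) = Q \<theta>s (x', \<phi>s x')" by linarith
    then have "Q \<theta> (x', \<phi>s x') \<le> Q \<theta> (x', u)"
    proof cases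
      case 1
      then show ?thesis using \<rho>(2)[of \<theta> x' u] \<theta> by (simp add: dist_norm)
    next
      case 2
      then show ?thesis using tie_has_equal_basis[OF e 2] by (simp add: Q_fun_def)
    qed
    then show "Qmin \<theta> x' = Q \<theta> (x', \<phi>s x')" using u Q_min_le[of \<psi> \<theta> x' "\<phi>s x'"] by simp
  qed
qed

text \<open>Near \<open>\<theta>s\<close> the inactive constraints hold by continuity. An active constraint exceeds its affine version
  only through pairs at which \<open>\<phi>s\<close> fails to be greedy for \<open>\<theta>\<close>; such pairs are given weight zero by \<open>\<zeta>\<close>
  or have steady-state probability zero, so the excess is at most a multiple of \<open>null_mass q\<close>.\<close>

lemma locally_feasible:
  obtains \<rho> \<epsilon> C where "\<rho> > 0" "\<epsilon> > 0" "C \<ge> 0"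
    "\<And>q \<theta>. (\<And>e. 0 \<le> q e) \<Longrightarrow> deviation q \<le> \<epsilon> \<Longrightarrow> norm (\<theta> - \<theta>s) < \<rho> \<Longrightarrow>
      (\<And>i. (A_of q *v \<theta>) $ i \<le> b_of q $ i - C * null_mass q) \<Longrightarrow> \<theta> \<in> feasible q"
proof -
  obtain \<rho>1 where \<rho>1: "\<rho>1 > 0"
    "\<And>\<theta> z x' i. norm (\<theta> - \<theta>s) < \<rho>1 \<Longrightarrow> pair_law (z, x') > 0 \<Longrightarrow> \<zeta> z $ j i > 0 \<Longrightarrow>
      Qmin \<theta> x' = Q \<theta> (x', \<phi>s x')"
    using locally_greedy by metis
  obtain B where B: "B \<ge> 0" "\<And>z. norm (\<psi> z) \<le> B" using finite_family_bound by blast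
  obtain Bz where Bz: "Bz \<ge> 0" "\<And>z. norm (\<zeta> z) \<le> Bz" using finite_family_bound by blast
  obtain Bt where Bt: "Bt \<ge> 0" "\<And>e. norm (td \<theta>s e) \<le> Bt" using finite_family_bound by blast
  have Bzk: "\<zeta> z $ k \<le> Bz" for z k using component_le_norm_cart[of "\<zeta> z" k] Bz(2)[of z] by linarith
  define L where "L = (1 + \<gamma>) * B"
  have L: "L \<ge> 0" using B gamma_pos by (simp add: L_def)
  have TD_lip: "\<bar>td \<theta> e - td \<theta>s e\<bar> \<le> L * norm (\<theta> - \<theta>s)" for \<theta> e
  proof -
    obtain z x' where e: "e = (z, x')" by (cases e)
    have "\<bar>Q \<theta> z - Q \<theta>s z\<bar> \<le> norm (\<theta> - \<theta>s) * norm (\<psi> z)"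
      using Cauchy_Schwarz_ineq2[of "\<theta> - \<theta>s" "\<psi> z"] by (simp add: Q_fun_def inner_diff_left)
    also have "\<dots> \<le> norm (\<theta> - \<theta>s) * B" by (intro mult_left_mono B) simp
    finally have 1: "\<bar>Q \<theta> z - Q \<theta>s z\<bar> \<le> norm (\<theta> - \<theta>s) * B" .
    have 2: "\<bar>\<gamma> * (Qmin \<theta> x' - Qmin \<theta>s x')\<bar> \<le> \<gamma> * (B * norm (\<theta> - \<theta>s))"
      unfolding abs_mult using Q_min_lipschitz[OF B(2), where \<theta> = \<theta> and \<theta>' = \<theta>s and x = x'] gamma_pos
      by (simp add: mult_left_mono)
    have "td \<theta> e - td \<theta>s e = - (Q \<theta> z - Q \<theta>s z) + \<gamma> * (Qmin \<theta> x' - Qmin \<theta>s x')"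
      by (simp add: e TD_def algebra_simps)
    then show ?thesis using 1 2 by (simp add: L_def algebra_simps abs_le_iff)
  qed
  have p_sum: "(\<Sum>e\<in>UNIV. pair_law e) = 1" unfolding pair_law_def by (rule sum_pmf_eq_1) auto
  obtain \<sigma> where \<sigma>: "\<sigma> > 0" "\<And>k. k \<notin> range j \<Longrightarrow> slack pair_law \<theta>s k \<le> - \<sigma>"
  proof -
    define \<sigma> where "\<sigma> = Min (insert 1 ((\<lambda>k. - slack pair_law \<theta>s k) ` (- range j)))"
    have "\<sigma> > 0" unfolding \<sigma>_def using inactive by (subst Min_gr_iff) auto
    moreover have "slack pair_law \<theta>s k \<le> - \<sigma>" if "k \<notin> range j" for k
    proof -
      have "\<sigma> \<le> - slack pair_law \<theta>s k" unfolding \<sigma>_def using that by (intro Min_le) auto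
      then show ?thesis by simp
    qed
    ultimately show ?thesis by (rule that)
  qed
  define \<rho> where "\<rho> = min (min \<rho>1 1) (\<sigma> / (4 * (L * Bz + 1)))"
  define \<epsilon> where "\<epsilon> = min 1 (\<sigma> / (4 * ((L + Bt) * Bz + 1)))"
  define C where "C = \<gamma> * (2 * B * (norm \<theta>s + 1)) * Bz"
  have LB: "L * Bz \<ge> 0" "(L + Bt) * Bz \<ge> 0" using L Bz Bt by auto
  have pos: "\<rho> > 0" "\<epsilon> > 0" using \<rho>1(1) \<sigma>(1) LB by (auto simp: \<rho>_def \<epsilon>_def)
  have C: "C \<ge> 0" using gamma_pos B Bz by (simp add: C_def)
  show ?thesis
  proof (rule that[OF pos C])
    fix q \<theta> assume q: "\<And>e. 0 \<le> q e" and dq: "deviation q \<le> \<epsilon>" and \<theta>: "norm (\<theta> - \<theta>s) < \<rho>"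
      and lin: "\<And>i. (A_of q *v \<theta>) $ i \<le> b_of q $ i - C * null_mass q"
    have \<theta>1: "norm (\<theta> - \<theta>s) < \<rho>1" "norm (\<theta> - \<theta>s) \<le> 1" "norm (\<theta> - \<theta>s) \<le> \<sigma> / (4 * (L * Bz + 1))"
      using \<theta> by (auto simp: \<rho>_def)
    have "slack q \<theta> k \<le> 0" for k
    proof (cases "k \<in> range j")
      case False
      have t1: "slack q \<theta> k - slack pair_law \<theta> k \<le> deviation q * ((L + Bt) * Bz)"
      proof -
        have "slack q \<theta> k - slack pair_law \<theta> k = (\<Sum>e\<in>UNIV. (q e - pair_law e) * (- td \<theta> e * \<zeta> (fst e) $ k))"
          unfolding slack_def sum_subtractf[symmetric] by (intro sum.cong refl) (simp add: algebra_simps)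
        also have "\<dots> \<le> (\<Sum>e\<in>UNIV. \<bar>q e - pair_law e\<bar> * ((L + Bt) * Bz))"
        proof (rule sum_mono)
          fix e
          have "\<bar>td \<theta> e\<bar> \<le> L + Bt"
            using TD_lip[of \<theta> e] Bt(2)[of e] mult_left_mono[OF \<theta>1(2) L] by (simp add: abs_le_iff)
          then have "\<bar>- td \<theta> e * \<zeta> (fst e) $ k\<bar> \<le> (L + Bt) * Bz"
            unfolding abs_mult using zeta_nonneg[of "fst e" k] Bzk L Bt by (intro mult_mono) auto
          then have "\<bar>(q e - pair_law e) * (- td \<theta> e * \<zeta> (fst e) $ k)\<bar> \<le> \<bar>q e - pair_law e\<bar> * ((L + Bt) * Bz)"
            unfolding abs_mult[of "q e - pair_law e"] by (rule mult_left_mono) simp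
          then show "(q e - pair_law e) * (- td \<theta> e * \<zeta> (fst e) $ k) \<le> \<bar>q e - pair_law e\<bar> * ((L + Bt) * Bz)" by linarith
        qed
        finally show ?thesis by (simp add: deviation_def sum_distrib_right)
      qed
      have t2: "slack pair_law \<theta> k - slack pair_law \<theta>s k \<le> L * norm (\<theta> - \<theta>s) * Bz"
      proof -
        have "slack pair_law \<theta> k - slack pair_law \<theta>s k = (\<Sum>e\<in>UNIV. pair_law e * ((td \<theta>s e - td \<theta> e) * \<zeta> (fst e) $ k))"
          unfolding slack_def sum_subtractf[symmetric] by (intro sum.cong refl) (simp add: algebra_simps)
        also have "\<dots> \<le> (\<Sum>e\<in>UNIV. pair_law e * (L * norm (\<theta> - \<theta>s) * Bz))"
          using TD_lip L zeta_nonneg Bzk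
          by (intro sum_mono mult_left_mono mult_mono pair_law_nonneg) (auto simp: abs_le_iff)
        finally show ?thesis by (simp add: p_sum flip: sum_distrib_right)
      qed
      have "deviation q * ((L + Bt) * Bz) \<le> \<sigma> / (4 * ((L + Bt) * Bz + 1)) * ((L + Bt) * Bz + 1)"
        using dq LB \<sigma>(1) by (intro mult_mono) (auto simp: \<epsilon>_def)
      also have "\<dots> = \<sigma> / 4" using LB by (simp add: field_simps add_nonneg_eq_0_iff)
      finally have s1: "deviation q * ((L + Bt) * Bz) \<le> \<sigma> / 4" .
      have "L * norm (\<theta> - \<theta>s) * Bz = norm (\<theta> - \<theta>s) * (L * Bz)" by simp
      also have "\<dots> \<le> \<sigma> / (4 * (L * Bz + 1)) * (L * Bz + 1)"
        using \<theta>1(3) LB \<sigma>(1) by (intro mult_mono) auto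
      also have "\<dots> = \<sigma> / 4" using LB by (simp add: field_simps add_nonneg_eq_0_iff)
      finally have s2: "L * norm (\<theta> - \<theta>s) * Bz \<le> \<sigma> / 4" .
      show ?thesis using t1 t2 s1 s2 \<sigma>(2)[OF False] \<sigma>(1) by linarith
    next
      case True
      then obtain i where k: "k = j i" by auto
      have "slack q \<theta> k - (A_of q *v \<theta> - b_of q) $ i
        = (\<Sum>e\<in>UNIV. q e * ((td_pol \<theta> \<phi>s e - td \<theta> e) * \<zeta> (fst e) $ k))"
        unfolding linear_residual slack_def k sum_subtractf[symmetric] by (intro sum.cong refl) (simp add: algebra_simps)
      also have "\<dots> \<le> (\<Sum>e\<in>UNIV. C * (if pair_law e = 0 then q e else 0))"
      proof (rule sum_mono)
        fix e :: "('x \<times> 'u) \<times> 'x"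
        obtain z x' where e: "e = (z, x')" by (cases e)
        have diff: "td_pol \<theta> \<phi>s e - td \<theta> e = \<gamma> * (Q \<theta> (x', \<phi>s x') - Qmin \<theta> x')"
          by (simp add: e TD_def TD_pol_eq algebra_simps)
        show "q e * ((td_pol \<theta> \<phi>s e - td \<theta> e) * \<zeta> (fst e) $ k) \<le> C * (if pair_law e = 0 then q e else 0)"
        proof (cases "pair_law e = 0")
          case True
          have "\<bar>Q \<theta> y\<bar> \<le> B * (norm \<theta>s + 1)" for y
          proof -
            have "\<bar>Q \<theta> y\<bar> \<le> norm \<theta> * norm (\<psi> y)" unfolding Q_fun_def by (rule Cauchy_Schwarz_ineq2)
            also have "\<dots> \<le> (norm \<theta>s + 1) * B"
              using \<theta>1(2) norm_triangle_sub[of \<theta> \<theta>s] by (intro mult_mono B(2)) auto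
            finally show ?thesis by (simp add: mult.commute)
          qed
          note qb = this
          obtain u where "Qmin \<theta> x' = Q \<theta> (x', u)" using Q_min_attained[of \<psi> \<theta> x'] by blast
          then have "Q \<theta> (x', \<phi>s x') - Qmin \<theta> x' \<le> 2 * B * (norm \<theta>s + 1)"
            using qb[of "(x', u)"] qb[of "(x', \<phi>s x')"] by (simp add: abs_le_iff)
          then have "(\<gamma> * (Q \<theta> (x', \<phi>s x') - Qmin \<theta> x')) * \<zeta> (fst e) $ k \<le> C"
            unfolding C_def using zeta_nonneg Bzk gamma_pos B(1) Q_min_le
            by (intro mult_mono mult_left_mono) auto
          from mult_left_mono[OF this q[of e]] show ?thesis using True by (simp add: diff mult.commute)
        next
          case False
          then have pe: "pair_law (z, x') > 0" using pair_law_nonneg[of e] by (simp add: e)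
          have "(td_pol \<theta> \<phi>s e - td \<theta> e) * \<zeta> (fst e) $ k = 0"
          proof (cases "\<zeta> z $ j i > 0")
            case True
            from \<rho>1(2)[OF \<theta>1(1) pe True] show ?thesis unfolding diff by simp
          next
            case False
            then have "\<zeta> z $ j i = 0" using zeta_nonneg[of z "j i"] by simp
            then show ?thesis by (simp add: e k)
          qed
          then show ?thesis using False by auto
        qed
      qed
      also have "\<dots> = C * null_mass q" by (simp add: null_mass_def sum_distrib_left)
      finally show ?thesis using lin[of i] by simp
    qed
    then show "\<theta> \<in> feasible q" by (simp add: feasible_def)
  qed
qed

definition \<omega> :: "real^'d" where
  "\<omega> = (\<Sum>z\<in>UNIV. pmf \<mu> z *\<^sub>R \<psi> z)"

lemma objective_eq: "objective \<mu> \<psi> = (\<lambda>\<theta>. \<omega> \<bullet> \<theta>)"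
  by (simp add: objective_def \<omega>_def Q_fun_def fun_eq_iff inner_sum_right inner_commute)

text \<open>A direction along which the objective does not decrease would, followed for a short while, lead to a
  second optimizer of the limiting program.\<close>

lemma cone_condition:
  assumes "v \<noteq> 0" and v: "\<And>i. (A_of pair_law *v v) $ i \<le> 0"
  shows "\<omega> \<bullet> v < 0"
proof (rule ccontr)
  assume nonneg: "\<not> \<omega> \<bullet> v < 0"
  obtain \<rho> \<epsilon> C where loc: "\<rho> > 0" "\<epsilon> > 0" "C \<ge> 0"
    "\<And>q \<theta>. (\<And>e. 0 \<le> q e) \<Longrightarrow> deviation q \<le> \<epsilon> \<Longrightarrow> norm (\<theta> - \<theta>s) < \<rho> \<Longrightarrow>
      (\<And>i. (A_of q *v \<theta>) $ i \<le> b_of q $ i - C * null_mass q) \<Longrightarrow> \<theta> \<in> feasible q"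
    using locally_feasible by metis
  define s where "s = \<rho> / (2 * norm v)"
  have s: "s > 0" using loc(1) assms(1) by (simp add: s_def)
  define \<theta>' where "\<theta>' = \<theta>s + s *\<^sub>R v"
  have "\<theta>' \<in> feasible pair_law"
  proof (rule loc(4)[OF pair_law_nonneg])
    show "norm (\<theta>' - \<theta>s) < \<rho>" using loc(1) assms(1) s by (simp add: \<theta>'_def s_def)
    show "(A_of pair_law *v \<theta>') $ i \<le> b_of pair_law $ i - C * null_mass pair_law" for i
      using v[of i] s by (simp add: \<theta>'_def b_of_pair_law matrix_vector_right_distrib matrix_vector_mult_scaleR mult_nonneg_nonpos)
  qed (use loc(2) in auto)
  moreover have "\<omega> \<bullet> \<theta>' \<ge> \<omega> \<bullet> \<theta>s" using nonneg s by (simp add: \<theta>'_def inner_add_right)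
  ultimately have "lp_optimizer (objective \<mu> \<psi>) (lim_feasible P \<pi> c \<gamma> \<psi> \<zeta>) \<theta>'"
    using optimizer unfolding lp_optimizer_def is_arg_max_def lim_feasible_eq objective_eq
    by (meson less_le_trans not_less)
  then have "\<theta>' = \<theta>s" by (rule unique)
  then show False using s assms(1) by (simp add: \<theta>'_def)
qed

lemma invertible_A_bar: "invertible (A_of pair_law)"
  using cone_condition by (rule cone_condition_imp_invertible)

lemma A_of_deviation:
  obtains B where "B \<ge> 0" "\<And>q x. norm ((A_of q - A_of pair_law) *v x) \<le> deviation q * B * norm x"
proof -
  obtain Ba where Ba0: "Ba \<ge> 0" "\<And>e. norm (onorm ((*v) (A e))) \<le> Ba"
    using finite_family_bound[of "\<lambda>e. onorm ((*v) (A e))"] by blast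
  have Ba: "Ba \<ge> 0" "onorm ((*v) (A e)) \<le> Ba" for e
    using Ba0(1) Ba0(2)[of e] by (auto simp: abs_le_iff)
  have A_of_mult: "A_of q *v x = (\<Sum>e\<in>UNIV. q e *\<^sub>R (A e *v x))" for q x
    unfolding A_of_def
    by (rule weighted_matrix_vector_mult)
  have dA: "norm ((A_of q - A_of pair_law) *v x) \<le> deviation q * Ba * norm x" for q x
  proof -
    have "(A_of q - A_of pair_law) *v x = (\<Sum>e\<in>UNIV. (q e - pair_law e) *\<^sub>R (A e *v x))"
      by (simp add: matrix_vector_mult_diff_rdistrib A_of_mult scaleR_diff_left sum_subtractf)
    also have "norm \<dots> \<le> (\<Sum>e\<in>UNIV. \<bar>q e - pair_law e\<bar> * (Ba * norm x))"
    proof (rule sum_norm_le)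
      fix e
      have "norm (A e *v x) \<le> onorm ((*v) (A e)) * norm x"
        by (rule onorm[OF matrix_vector_mul_bounded_linear])
      also have "\<dots> \<le> Ba * norm x" by (intro mult_right_mono Ba) simp
      finally show "norm ((q e - pair_law e) *\<^sub>R (A e *v x)) \<le> \<bar>q e - pair_law e\<bar> * (Ba * norm x)"
        by (simp add: mult_left_mono)
    qed
    finally show ?thesis by (simp add: deviation_def sum_distrib_right mult.assoc)
  qed
  show ?thesis by (rule that[OF Ba(1) dA])
qed

lemma b_of_deviation:
  obtains B where "B \<ge> 0" "\<And>q. norm (b_of q - b_of pair_law) \<le> deviation q * B"
proof -
  obtain Bb where Bb: "Bb \<ge> 0" "\<And>e. norm (b_vec c \<zeta> j e) \<le> Bb" using finite_family_bound by blast
  have db: "norm (b_of q - b_of pair_law) \<le> deviation q * Bb" for q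
  proof -
    have "b_of q - b_of pair_law = (\<Sum>e\<in>UNIV. (q e - pair_law e) *\<^sub>R b_vec c \<zeta> j e)"
      by (simp add: b_of_def scaleR_diff_left sum_subtractf)
    also have "norm \<dots> \<le> (\<Sum>e\<in>UNIV. \<bar>q e - pair_law e\<bar> * Bb)"
      by (rule sum_norm_le) (simp add: Bb mult_left_mono)
    finally show ?thesis by (simp add: deviation_def sum_distrib_right)
  qed
  show ?thesis by (rule that[OF Bb(1) db])
qed

lemma residual_deviation:
  obtains B where "B \<ge> 0" "\<And>q. norm (b_of q - A_of q *v \<theta>s) \<le> B * deviation q"
proof -
  obtain Ba where Ba: "Ba \<ge> 0" and dA: "\<And>q x. norm ((A_of q - A_of pair_law) *v x) \<le> deviation q * Ba * norm x"
    using A_of_deviation by blast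
  obtain Bb where Bb: "Bb \<ge> 0" and db: "\<And>q. norm (b_of q - b_of pair_law) \<le> deviation q * Bb"
    using b_of_deviation by blast
  have "norm (b_of q - A_of q *v \<theta>s) \<le> (Bb + Ba * norm \<theta>s) * deviation q" for q
  proof -
    have split: "b_of q - A_of q *v \<theta>s = (b_of q - b_of pair_law) - (A_of q - A_of pair_law) *v \<theta>s"
      by (simp add: b_of_pair_law matrix_vector_mult_diff_rdistrib)
    have "norm (b_of q - A_of q *v \<theta>s) \<le> norm (b_of q - b_of pair_law) + norm ((A_of q - A_of pair_law) *v \<theta>s)"
      unfolding split by (rule norm_triangle_ineq4)
    also have "\<dots> \<le> deviation q * Bb + deviation q * Ba * norm \<theta>s" by (intro add_mono db dA)
    finally show ?thesis by (simp add: algebra_simps)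
  qed
  moreover have "Bb + Ba * norm \<theta>s \<ge> 0" using Ba Bb by simp
  ultimately show ?thesis using that by blast
qed

text \<open>The active constraints confine the feasible set, and the local description of the feasible set supplies
  the margin \<open>C1 * null_mass q\<close>, so the general perturbation bound applies. The expansion follows from
  \<open>A p (\<theta> - \<theta>s) = (b q - A q \<theta>s) + (A q \<theta> - b q) - (A q - A p) (\<theta> - \<theta>s)\<close>, with \<open>p\<close> the steady-state
  law: the second summand is a multiple of the margin, and the third is of second order in the
  deviation.\<close>

lemma optimizer_expansion:
  obtains \<epsilon> C :: real where "\<epsilon> > 0" "C \<ge> 0"
    "\<And>q. (\<And>e. 0 \<le> q e) \<Longrightarrow> deviation q \<le> \<epsilon> \<Longrightarrow>
      \<not> lp_infeasible_or_unbounded (objective \<mu> \<psi>) (feasible q) \<and>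
      (\<forall>\<theta>. lp_optimizer (objective \<mu> \<psi>) (feasible q) \<theta> \<longrightarrow>
         norm (\<theta> - \<theta>s) \<le> C * deviation q \<and>
         norm (\<theta> - \<theta>s - matrix_inv (A_of pair_law) *v (b_of q - A_of q *v \<theta>s)) \<le> C * (null_mass q + (deviation q)\<^sup>2))"
proof -
  obtain \<rho> \<epsilon>1 C1 where loc: "\<rho> > 0" "\<epsilon>1 > 0" "C1 \<ge> 0"
    "\<And>q \<theta>. (\<And>e. 0 \<le> q e) \<Longrightarrow> deviation q \<le> \<epsilon>1 \<Longrightarrow> norm (\<theta> - \<theta>s) < \<rho> \<Longrightarrow>
      (\<And>i. (A_of q *v \<theta>) $ i \<le> b_of q $ i - C1 * null_mass q) \<Longrightarrow> \<theta> \<in> feasible q"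
    using locally_feasible by metis
  obtain \<epsilon>2 C2 where pert: "\<epsilon>2 > 0" "C2 \<ge> 0" and stable: "lp_stable (A_of pair_law) \<omega> \<theta>s \<rho> \<epsilon>2 C2"
    using lp_perturbation[OF cone_condition loc(1)] by blast
  obtain Ba where Ba: "Ba \<ge> 0" and dA: "\<And>q x. norm ((A_of q - A_of pair_law) *v x) \<le> deviation q * Ba * norm x"
    using A_of_deviation by blast
  obtain Br where Br: "Br \<ge> 0" "\<And>q. norm (b_of q - A_of q *v \<theta>s) \<le> Br * deviation q"
    using residual_deviation by blast
  define H where "H = onorm ((*v) (matrix_inv (A_of pair_law)))"
  have Hb: "norm (matrix_inv (A_of pair_law) *v x) \<le> H * norm x" for x
    unfolding H_def by (rule onorm[OF matrix_vector_mul_bounded_linear])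
  have H0: "H \<ge> 0" unfolding H_def by (rule onorm_pos_le[OF matrix_vector_mul_bounded_linear])
  define D where "D = Ba + Br + C1 + 1"
  have D: "D \<ge> 1" "Ba \<le> D" "Br \<le> D" "C1 \<le> D" using Ba Br(1) loc(3) by (auto simp: D_def)
  define \<epsilon> where "\<epsilon> = min \<epsilon>1 (\<epsilon>2 / D)"
  define C where "C = C2 * D + H * (C2 * C1 + Ba * (C2 * D))"
  have \<epsilon>: "\<epsilon> > 0" using loc pert D by (simp add: \<epsilon>_def)
  have C: "C \<ge> 0" "C2 * D \<le> C" "H * (C2 * C1 + Ba * (C2 * D)) \<le> C" 
    using pert(2) D H0 loc(3) Ba by (auto simp: C_def)
  show ?thesis
  proof (rule that[OF \<epsilon> C(1)])
    fix q assume q: "\<And>e. 0 \<le> q e" and dq: "deviation q \<le> \<epsilon>"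
    note d0 = deviation_nonneg[of q]
    define \<delta> where "\<delta> = D * deviation q"
    define \<kappa> where "\<kappa> = C1 * null_mass q"
    have main: "feasible q \<noteq> {} \<and> bdd_above ((\<lambda>\<theta>. \<omega> \<bullet> \<theta>) ` feasible q) \<and>
      (\<forall>\<theta>. lp_optimizer (\<lambda>\<theta>. \<omega> \<bullet> \<theta>) (feasible q) \<theta> \<longrightarrow> norm (\<theta> - \<theta>s) \<le> C2 * \<delta> \<and> norm (A_of q *v \<theta> - b_of q) \<le> C2 * \<kappa>)"
    proof (rule stable[unfolded lp_stable_def, rule_format], intro conjI allI)
      show "norm ((A_of q - A_of pair_law) *v x) \<le> \<delta> * norm x" for x
      proof -
        have "deviation q * Ba * norm x \<le> \<delta> * norm x"
          unfolding \<delta>_def using mult_right_mono[OF D(2) d0] by (intro mult_right_mono) (auto simp: mult.commute)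
        then show ?thesis using dA[of q x] by linarith
      qed
      have "Br * deviation q \<le> \<delta>" unfolding \<delta>_def by (rule mult_right_mono[OF D(3) d0])
      then show "norm (b_of q - A_of q *v \<theta>s) \<le> \<delta>" using Br(2)[of q] by linarith
      show "0 \<le> \<kappa>" using loc(3) null_mass_nonneg[of q] q by (simp add: \<kappa>_def)
      show "\<kappa> \<le> \<delta>" unfolding \<kappa>_def \<delta>_def
        using D null_mass_le_deviation[of q] null_mass_nonneg[of q] q by (intro mult_mono) auto
      have "D * deviation q \<le> D * (\<epsilon>2 / D)" using dq D by (intro mult_left_mono) (auto simp: \<epsilon>_def)
      then show "\<delta> \<le> \<epsilon>2" using D by (simp add: \<delta>_def)
      show "feasible q \<subseteq> {\<theta>. \<forall>i. (A_of q *v \<theta>) $ i \<le> b_of q $ i}"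
      proof safe
        fix \<theta> i assume "\<theta> \<in> feasible q"
        then have "slack q \<theta> (j i) \<le> 0" by (simp add: feasible_def)
        then show "(A_of q *v \<theta>) $ i \<le> b_of q $ i" using linear_residual_le_slack[of q \<theta> i] q by simp
      qed
      show "{\<theta>. norm (\<theta> - \<theta>s) < \<rho> \<and> (\<forall>i. (A_of q *v \<theta>) $ i \<le> b_of q $ i - \<kappa>)} \<subseteq> feasible q"
        using loc(4)[of q] q dq by (auto simp: \<epsilon>_def \<kappa>_def)
    qed
    have "norm (\<theta> - \<theta>s) \<le> C * deviation q \<and>
         norm (\<theta> - \<theta>s - matrix_inv (A_of pair_law) *v (b_of q - A_of q *v \<theta>s)) \<le> C * (null_mass q + (deviation q)\<^sup>2)"
      if opt: "lp_optimizer (\<lambda>\<theta>. \<omega> \<bullet> \<theta>) (feasible q) \<theta>" for \<theta>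
    proof
      have th: "norm (\<theta> - \<theta>s) \<le> C2 * D * deviation q" and res: "norm (A_of q *v \<theta> - b_of q) \<le> C2 * (C1 * null_mass q)"
        using main opt by (auto simp: \<delta>_def \<kappa>_def mult.assoc)
      from mult_right_mono[OF C(2) d0] th show "norm (\<theta> - \<theta>s) \<le> C * deviation q" by linarith
      define r where "r = (A_of q *v \<theta> - b_of q) - (A_of q - A_of pair_law) *v (\<theta> - \<theta>s)"
      have "matrix_inv (A_of pair_law) *v (A_of pair_law *v (\<theta> - \<theta>s)) = \<theta> - \<theta>s"
        by (simp add: matrix_vector_mul_assoc matrix_inv_inverse[OF invertible_A_bar])
      moreover have "A_of pair_law *v (\<theta> - \<theta>s) - (b_of q - A_of q *v \<theta>s) = r"
        by (simp add: r_def matrix_vector_mult_diff_distrib matrix_vector_mult_diff_rdistrib)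
      ultimately have "\<theta> - \<theta>s - matrix_inv (A_of pair_law) *v (b_of q - A_of q *v \<theta>s) = matrix_inv (A_of pair_law) *v r"
        by (metis matrix_vector_mult_diff_distrib)
      moreover have "norm r \<le> (C2 * C1 + Ba * (C2 * D)) * (null_mass q + (deviation q)\<^sup>2)"
      proof -
        have "norm ((A_of q - A_of pair_law) *v (\<theta> - \<theta>s)) \<le> deviation q * Ba * (C2 * D * deviation q)"
          using dA[of q "\<theta> - \<theta>s"] mult_left_mono[OF th, of "deviation q * Ba"] d0 Ba by simp
        then have "norm r \<le> C2 * C1 * null_mass q + Ba * (C2 * D) * (deviation q)\<^sup>2"
          using norm_triangle_ineq4[of "A_of q *v \<theta> - b_of q" "(A_of q - A_of pair_law) *v (\<theta> - \<theta>s)"] res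
          by (simp add: r_def power2_eq_square mult_ac)
        also have "\<dots> \<le> (C2 * C1 + Ba * (C2 * D)) * (null_mass q + (deviation q)\<^sup>2)"
        proof -
          have "0 \<le> C2 * C1 * (deviation q)\<^sup>2" "0 \<le> Ba * (C2 * D) * null_mass q"
            using pert(2) loc(3) Ba D(1) null_mass_nonneg[of q] q by auto
          then show ?thesis by (simp add: algebra_simps)
        qed
        finally show ?thesis .
      qed
      ultimately have "norm (\<theta> - \<theta>s - matrix_inv (A_of pair_law) *v (b_of q - A_of q *v \<theta>s))
          \<le> H * ((C2 * C1 + Ba * (C2 * D)) * (null_mass q + (deviation q)\<^sup>2))"
        using Hb[of r] mult_left_mono[OF _ H0] by (metis order_trans)
      also have "\<dots> \<le> C * (null_mass q + (deviation q)\<^sup>2)"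
        unfolding mult.assoc[symmetric] using C(3) null_mass_nonneg[of q] q
        by (intro mult_right_mono) (auto simp: mult.assoc)
      finally show "norm (\<theta> - \<theta>s - matrix_inv (A_of pair_law) *v (b_of q - A_of q *v \<theta>s)) \<le> C * (null_mass q + (deviation q)\<^sup>2)" .
    qed
    then show "\<not> lp_infeasible_or_unbounded (objective \<mu> \<psi>) (feasible q) \<and>
      (\<forall>\<theta>. lp_optimizer (objective \<mu> \<psi>) (feasible q) \<theta> \<longrightarrow>
         norm (\<theta> - \<theta>s) \<le> C * deviation q \<and>
         norm (\<theta> - \<theta>s - matrix_inv (A_of pair_law) *v (b_of q - A_of q *v \<theta>s)) \<le> C * (null_mass q + (deviation q)\<^sup>2))"
      using main by (auto simp: lp_infeasible_or_unbounded_def objective_eq)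
  qed
qed

end


section \<open>Empirical frequencies of transitions\<close>

lemma mean_expectation:
  fixes f :: "'z::finite \<Rightarrow> 'b::{banach, second_countable_topology}"
  shows "mean p f = measure_pmf.expectation p f"
  by (simp add: expectation_finite_pmf mean_def)

text \<open>Passes averages through the product structure of the transition kernel of state-input pairs.\<close>

lemma mean_map_pmf: "mean (map_pmf g p) f = mean p (\<lambda>x. f (g x))"
  for f :: "'z::finite \<Rightarrow> real" and p :: "'y::finite pmf"
  by (simp add: mean_expectation)

lemma sum_power4_le:
  fixes f :: "'e::finite \<Rightarrow> real"
  shows "(\<Sum>e\<in>UNIV. f e) ^ 4 \<le> real CARD('e) ^ 3 * (\<Sum>e\<in>UNIV. f e ^ 4)"
proof -
  have "(\<Sum>e\<in>UNIV. f e) ^ 4 = ((\<Sum>e\<in>UNIV. f e)\<^sup>2)\<^sup>2" by simp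
  also have "\<dots> \<le> (real CARD('e) * (\<Sum>e\<in>UNIV. (f e)\<^sup>2))\<^sup>2"
    using sum_squared_le_sum_of_squares[of f UNIV] by (intro power_mono) (auto simp: mult.commute)
  also have "\<dots> = (real CARD('e))\<^sup>2 * (\<Sum>e\<in>UNIV. (f e)\<^sup>2)\<^sup>2" by (simp add: power_mult_distrib)
  also have "\<dots> \<le> (real CARD('e))\<^sup>2 * (real CARD('e) * (\<Sum>e\<in>UNIV. ((f e)\<^sup>2)\<^sup>2))"
    using sum_squared_le_sum_of_squares[of "\<lambda>e. (f e)\<^sup>2" UNIV] by (intro mult_left_mono) (auto simp: mult.commute)
  finally show ?thesis by (simp add: power4_eq_xxxx power3_eq_cube power2_eq_square mult.assoc)
qed

definition empirical :: "nat \<Rightarrow> (nat \<Rightarrow> 'x \<times> 'u) \<Rightarrow> ('x \<times> 'u) \<times> 'x \<Rightarrow> real" where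
  "empirical N a e = (\<Sum>k<N. of_bool ((a k, fst (a (Suc k))) = e)) / real N"

lemma empirical_nonneg: "0 \<le> empirical N a e"
  by (simp add: empirical_def sum_nonneg)

lemma sum_empirical:
  fixes f :: "('x::finite \<times> 'u::finite) \<times> 'x \<Rightarrow> 'b::real_vector"
  shows "(\<Sum>e\<in>UNIV. empirical N a e *\<^sub>R f e) = (1 / real N) *\<^sub>R (\<Sum>k<N. f (a k, fst (a (Suc k))))"
proof -
  have "(\<Sum>e\<in>UNIV. empirical N a e *\<^sub>R f e)
      = (\<Sum>e\<in>UNIV. \<Sum>k<N. (1 / real N) *\<^sub>R (if (a k, fst (a (Suc k))) = e then f e else 0))"
    unfolding empirical_def sum_divide_distrib scaleR_left.sum
    by (intro sum.cong refl) simp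
  also have "\<dots> = (\<Sum>k<N. \<Sum>e\<in>UNIV. (1 / real N) *\<^sub>R (if (a k, fst (a (Suc k))) = e then f e else 0))"
    by (rule sum.swap)
  also have "\<dots> = (\<Sum>k<N. (1 / real N) *\<^sub>R f (a k, fst (a (Suc k))))"
    by (simp add: scaleR_sum_right[symmetric])
  finally show ?thesis by (simp add: scaleR_sum_right)
qed

lemma adapted_empirical: "adapted N (empirical N)"
  unfolding adapted_def empirical_def fun_eq_iff
  by (intro allI impI arg_cong2[where f = "(/)"] sum.cong refl) auto

context unichain_process
begin

lemma stationary_mean_add: "stationary_mean (\<lambda>z z'. f z z' + g z z') = stationary_mean f + stationary_mean g"
  by (simp add: stationary_mean_def mean_add)

lemma stationary_mean_cmult: "stationary_mean (\<lambda>z z'. a * f z z') = a * stationary_mean f" for a :: real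
  by (simp add: stationary_mean_def mean_cmult)

lemma stationary_mean_const [simp]: "stationary_mean (\<lambda>z z'. a) = a"
  by (simp add: stationary_mean_def)

lemma stationary_mean_sum:
  fixes f :: "'i \<Rightarrow> 'z \<Rightarrow> 'z \<Rightarrow> real"
  shows "stationary_mean (\<lambda>z z'. \<Sum>i\<in>I. f i z z') = (\<Sum>i\<in>I. stationary_mean (f i))"
  by (induction I rule: infinite_finite_induct) (simp_all add: stationary_mean_add)

lemma probability_markov_inequality:
  assumes "integrable M X" "\<And>w. w \<in> space M \<Longrightarrow> 0 \<le> X w" "t > 0"
  shows "prob {w \<in> space M. t \<le> X w} \<le> expectation X / t"
proof -
  have [measurable]: "X \<in> borel_measurable M" using assms(1) by auto
  have "prob {w \<in> space M. t \<le> X w} = expectation (indicator {w \<in> space M. t \<le> X w})" by simp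
  also have "\<dots> \<le> expectation (\<lambda>w. X w / t)"
    by (rule integral_mono) (use assms in \<open>auto simp: indicator_def emeasure_eq_measure\<close>)
  finally show ?thesis by simp
qed

end

locale sampled_lp =
  unichain_process M "closed_loop P pol" Z \<pi> + projected_bellman_lp P \<pi> \<mu> c \<gamma> \<psi> \<zeta> \<theta>s \<phi>s j
  for M :: "'w measure"
    and P :: "'u::finite \<Rightarrow> 'x::finite \<Rightarrow> 'x pmf"
    and pol :: "'x \<Rightarrow> 'u pmf"
    and Z :: "nat \<Rightarrow> 'w \<Rightarrow> 'x \<times> 'u"
    and \<pi> \<mu> :: "('x \<times> 'u) pmf"
    and c :: "'x \<times> 'u \<Rightarrow> real"
    and \<gamma> :: real
    and \<psi> :: "'x \<times> 'u \<Rightarrow> real^'d"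
    and \<zeta> :: "'x \<times> 'u \<Rightarrow> real^'p"
    and \<theta>s :: "real^'d"
    and \<phi>s :: "'x \<Rightarrow> 'u"
    and j :: "'d \<Rightarrow> 'p"
begin

text \<open>Links the stationary means of the chain of state-input pairs, in which the Poisson equation is solved,
  to the law of \<open>(Z k, X (k+1))\<close> in which the linear program is formulated.\<close>

lemma stationary_mean_pair:
  "stationary_mean (\<lambda>z z'. f (z, fst z')) = (\<Sum>e\<in>UNIV. pair_law e * f e)" for f :: "('x \<times> 'u) \<times> 'x \<Rightarrow> real"
proof -
  have "mean (closed_loop P pol z) (\<lambda>z'. f (z, fst z')) = mean (P (snd z) (fst z)) (\<lambda>x'. f (z, x'))" for z
    by (simp add: closed_loop_def mean_bind mean_map_pmf)
  then have "stationary_mean (\<lambda>z z'. f (z, fst z')) = mean (steady_pmf P \<pi>) f"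
    by (simp add: stationary_mean_def steady_pmf_def mean_bind mean_map_pmf)
  then show ?thesis by (simp add: mean_def pair_law_def)
qed

abbreviation (input) emp :: "nat \<Rightarrow> 'w \<Rightarrow> ('x \<times> 'u) \<times> 'x \<Rightarrow> real" where
  "emp N w \<equiv> empirical N (\<lambda>i. Z i w)"

lemma integrable_empirical [simp]:
  fixes g :: "(('x \<times> 'u) \<times> 'x \<Rightarrow> real) \<Rightarrow> 'e::{banach, second_countable_topology}"
  shows "integrable M (\<lambda>w. g (emp N w))"
  by (rule adapted_integrable[where k = N and G = "\<lambda>a. g (empirical N a)"])
    (rule adapted_comp[OF adapted_empirical])

lemma g_emp_eq: "g_emp Z c \<gamma> \<psi> \<zeta> N w \<theta> $ k = slack (emp N w) \<theta> k"
  using sum_empirical[of N "\<lambda>i. Z i w" "\<lambda>e. - TD c \<gamma> \<psi> \<theta> e * \<zeta> (fst e) $ k"]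
  by (simp add: slack_def g_emp_def sum_component)

lemma emp_feasible_eq: "emp_feasible Z c \<gamma> \<psi> \<zeta> N w = feasible (emp N w)"
  by (simp add: emp_feasible_def feasible_def g_emp_eq)

abbreviation (input) Wv :: "('x \<times> 'u) \<times> 'x \<Rightarrow> real^'d" where
  "Wv \<equiv> W_vec P \<pi> c \<gamma> \<psi> \<zeta> \<theta>s \<phi>s j"

abbreviation (input) W :: "nat \<Rightarrow> 'w \<Rightarrow> real^'d" where
  "W \<equiv> W_avg P \<pi> Z c \<gamma> \<psi> \<zeta> \<theta>s \<phi>s j"

lemma W_vec_eq: "Wv e = b_vec c \<zeta> j e - A_mat \<gamma> \<psi> \<zeta> \<phi>s j e *v \<theta>s"
  by (simp add: W_vec_def A_bar_eq b_bar_eq b_of_pair_law matrix_vector_mult_diff_rdistrib)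

lemma weighted_W_vec: "(\<Sum>e\<in>UNIV. q e *\<^sub>R Wv e) = b_of q - A_of q *v \<theta>s"
  by (simp add: W_vec_eq b_of_def A_of_def weighted_matrix_vector_mult scaleR_diff_right sum_subtractf)

lemma W_avg_sum: "W N w
    = (1 / real N) *\<^sub>R (\<Sum>k<N. Wv (Z k w, fst (Z (Suc k) w)))"
  by (simp add: W_avg_def sum.atLeast1_atMost_eq)

lemma W_avg_eq: "W N w = b_of (emp N w) - A_of (emp N w) *v \<theta>s"
  unfolding W_avg_sum sum_empirical[symmetric, where a = "\<lambda>i. Z i w"] by (rule weighted_W_vec)

definition noise :: "'d \<Rightarrow> 'x \<times> 'u \<Rightarrow> 'x \<times> 'u \<Rightarrow> real" where
  "noise i z z' = Wv (z, fst z') $ i"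

lemma stationary_mean_noise: "stationary_mean (noise i) = 0"
proof -
  have "stationary_mean (noise i) = (\<Sum>e\<in>UNIV. pair_law e *\<^sub>R Wv e) $ i"
    unfolding noise_def
    using stationary_mean_pair[of "\<lambda>e. Wv e $ i"]
    by (simp add: sum_component)
  also have "\<dots> = 0" unfolding weighted_W_vec by (simp add: b_of_pair_law)
  finally show ?thesis .
qed

lemma W_avg_path_sum: "W N w $ i = path_sum (noise i) N (path w) / real N"
  by (simp add: W_avg_sum path_sum_def noise_def sum_component)

text \<open>Each coordinate of the deviation is an average of a centred additive functional, and the mass of null
  pairs is the number of visits to them divided by \<open>n\<close>.\<close>

lemma empirical_deviation_moments:
  obtains C where "C \<ge> 0"
    "\<And>n. n \<ge> 1 \<Longrightarrow> expectation (\<lambda>w. (deviation (emp n w))\<^sup>2) \<le> C / real n"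
    "\<And>n. n \<ge> 1 \<Longrightarrow> expectation (\<lambda>w. deviation (emp n w) ^ 4) \<le> C / (real n)\<^sup>2"
    "\<And>n. n \<ge> 1 \<Longrightarrow> expectation (\<lambda>w. (null_mass (emp n w))\<^sup>2) \<le> C / (real n)\<^sup>2"
proof -
  let ?E = "UNIV :: (('x \<times> 'u) \<times> 'x) set"
  define m where "m = real CARD(('x \<times> 'u) \<times> 'x)"
  define f where "f e z z' = of_bool ((z, fst z') = e) - pair_law e" for e :: "('x \<times> 'u) \<times> 'x" and z z' :: "'x \<times> 'u"
  have "stationary_mean (f e) = 0" for e
  proof -
    have "stationary_mean (f e) = (\<Sum>y\<in>UNIV. pair_law y * (of_bool (y = e) - pair_law e))"
      unfolding f_def using stationary_mean_pair[of "\<lambda>y. of_bool (y = e) - pair_law e"] by simp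
    also have "\<dots> = (\<Sum>y\<in>UNIV. pair_law y * of_bool (y = e)) - (\<Sum>y\<in>UNIV. pair_law y) * pair_law e"
      by (simp add: right_diff_distrib sum_subtractf sum_distrib_right)
    also have "(\<Sum>y\<in>UNIV. pair_law y) = 1" unfolding pair_law_def by (rule sum_pmf_eq_1) auto
    finally show ?thesis by (simp add: of_bool_def if_distrib cong: if_cong)
  qed
  then have "\<exists>C\<ge>0. \<forall>n\<ge>1. expectation (\<lambda>x. (path_sum (f e) n (path x))\<^sup>2) \<le> C * real n \<and>
    expectation (\<lambda>x. path_sum (f e) n (path x) ^ 4) \<le> C * (real n)\<^sup>2" for e by (rule path_sum_moments)
  then obtain Cf where Cf: "\<And>e. Cf e \<ge> 0"
    "\<And>e n. n \<ge> 1 \<Longrightarrow> expectation (\<lambda>x. (path_sum (f e) n (path x))\<^sup>2) \<le> Cf e * real n"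
    "\<And>e n. n \<ge> 1 \<Longrightarrow> expectation (\<lambda>x. path_sum (f e) n (path x) ^ 4) \<le> Cf e * (real n)\<^sup>2" by metis
  define Cs where "Cs = (\<Sum>e\<in>?E. Cf e)"
  have Cs: "Cs \<ge> 0" unfolding Cs_def using Cf(1) by (simp add: sum_nonneg)
  have freq: "\<bar>emp n w e - pair_law e\<bar> = \<bar>path_sum (f e) n (path w)\<bar> / real n" if "n \<ge> 1" for n w e
  proof -
    have "emp n w e - pair_law e = path_sum (f e) n (path w) / real n"
      using that by (simp add: path_sum_def empirical_def f_def sum_subtractf field_simps)
    then show ?thesis by simp
  qed
  have d2: "expectation (\<lambda>w. (deviation (emp n w))\<^sup>2) \<le> m * Cs / real n" if n: "n \<ge> 1" for n
  proof -
    have "(deviation (emp n w))\<^sup>2 \<le> (\<Sum>e\<in>?E. m / (real n)\<^sup>2 * (path_sum (f e) n (path w))\<^sup>2)" for w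
    proof -
      have "(deviation (emp n w))\<^sup>2 \<le> (\<Sum>e\<in>?E. (\<bar>emp n w e - pair_law e\<bar>)\<^sup>2) * m"
        unfolding deviation_def m_def using sum_squared_le_sum_of_squares[of "\<lambda>e. \<bar>emp n w e - pair_law e\<bar>" ?E] by simp
      then show ?thesis by (simp add: freq[OF n] power_divide sum_distrib_right sum_distrib_left mult.commute)
    qed
    then have "expectation (\<lambda>w. (deviation (emp n w))\<^sup>2) \<le> expectation (\<lambda>w. \<Sum>e\<in>?E. m / (real n)\<^sup>2 * (path_sum (f e) n (path w))\<^sup>2)"
      by (intro integral_mono integrable_empirical[where g = "\<lambda>q. (deviation q)\<^sup>2"] Bochner_Integration.integrable_sum
        integrable_path_sum[where g = "\<lambda>a. m / (real n)\<^sup>2 * a\<^sup>2"])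
    also have "\<dots> = (\<Sum>e\<in>?E. m / (real n)\<^sup>2 * expectation (\<lambda>w. (path_sum (f e) n (path w))\<^sup>2))"
      by (subst Bochner_Integration.integral_sum) (use integrable_path_sum[where g = "\<lambda>a. m / (real n)\<^sup>2 * a\<^sup>2"] in auto)
    also have "\<dots> \<le> (\<Sum>e\<in>?E. m / (real n)\<^sup>2 * (Cf e * real n))"
      by (intro sum_mono mult_left_mono Cf(2)[OF n]) (simp add: m_def)
    also have "\<dots> = m * Cs / real n"
      using n by (simp add: Cs_def sum_distrib_left sum_divide_distrib power2_eq_square)
    finally show ?thesis .
  qed
  have d4: "expectation (\<lambda>w. deviation (emp n w) ^ 4) \<le> m ^ 3 * Cs / (real n)\<^sup>2" if n: "n \<ge> 1" for n
  proof -
    have "deviation (emp n w) ^ 4 \<le> (\<Sum>e\<in>?E. m ^ 3 / (real n) ^ 4 * path_sum (f e) n (path w) ^ 4)" for w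
    proof -
      have "deviation (emp n w) ^ 4 \<le> m ^ 3 * (\<Sum>e\<in>?E. \<bar>emp n w e - pair_law e\<bar> ^ 4)"
        unfolding deviation_def m_def by (rule sum_power4_le)
      then show ?thesis by (simp add: freq[OF n] power_divide sum_distrib_left)
    qed
    then have "expectation (\<lambda>w. deviation (emp n w) ^ 4) \<le> expectation (\<lambda>w. \<Sum>e\<in>?E. m ^ 3 / (real n) ^ 4 * path_sum (f e) n (path w) ^ 4)"
      by (intro integral_mono integrable_empirical[where g = "\<lambda>q. deviation q ^ 4"] Bochner_Integration.integrable_sum
        integrable_path_sum[where g = "\<lambda>a. m ^ 3 / (real n) ^ 4 * a ^ 4"])
    also have "\<dots> = (\<Sum>e\<in>?E. m ^ 3 / (real n) ^ 4 * expectation (\<lambda>w. path_sum (f e) n (path w) ^ 4))"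
      by (subst Bochner_Integration.integral_sum) (use integrable_path_sum[where g = "\<lambda>a. m ^ 3 / (real n) ^ 4 * a ^ 4"] in auto)
    also have "\<dots> \<le> (\<Sum>e\<in>?E. m ^ 3 / (real n) ^ 4 * (Cf e * (real n)\<^sup>2))"
      by (intro sum_mono mult_left_mono Cf(3)[OF n]) (simp add: m_def)
    also have "\<dots> = m ^ 3 * Cs / (real n)\<^sup>2"
      using n by (simp add: Cs_def sum_distrib_left sum_divide_distrib power2_eq_square power4_eq_xxxx)
    finally show ?thesis .
  qed
  define fn :: "'x \<times> 'u \<Rightarrow> 'x \<times> 'u \<Rightarrow> real" where "fn z z' = of_bool (pair_law (z, fst z') = 0)" for z z'
  have "stationary_mean fn = 0"
    unfolding fn_def using stationary_mean_pair[of "\<lambda>e. of_bool (pair_law e = 0)"] by (auto intro!: sum.neutral)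
  then obtain Cn where Cn: "Cn \<ge> 0" "\<And>n. expectation (\<lambda>x. (path_sum fn n (path x))\<^sup>2) \<le> Cn"
    using null_pairs_second_moment[of fn] by (auto simp: fn_def)
  have n2: "expectation (\<lambda>w. (null_mass (emp n w))\<^sup>2) \<le> Cn / (real n)\<^sup>2" for n
  proof -
    have "null_mass (emp n w) = path_sum fn n (path w) / real n" for w
    proof -
      have "null_mass (emp n w) = (\<Sum>e\<in>?E. emp n w e *\<^sub>R of_bool (pair_law e = 0))"
        unfolding null_mass_def by (intro sum.cong) auto
      then show ?thesis by (simp only: sum_empirical) (simp add: path_sum_def fn_def)
    qed
    then show ?thesis using Cn(2)[of n] by (simp add: power_divide divide_right_mono)
  qed
  define C where "C = m * Cs + m ^ 3 * Cs + Cn"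
  have m: "m \<ge> 0" by (simp add: m_def)
  show ?thesis
  proof (rule that[of C])
    have *: "0 \<le> m * Cs" "0 \<le> m ^ 3 * Cs" using m Cs by auto
    show "C \<ge> 0" using * Cn(1) by (simp add: C_def)
    fix n :: nat assume n: "n \<ge> 1"
    have "m * Cs / real n \<le> C / real n" using * Cn(1) by (intro divide_right_mono) (auto simp: C_def)
    then show "expectation (\<lambda>w. (deviation (emp n w))\<^sup>2) \<le> C / real n" using d2[OF n] by linarith
    have "m ^ 3 * Cs / (real n)\<^sup>2 \<le> C / (real n)\<^sup>2" using * Cn(1) by (intro divide_right_mono) (auto simp: C_def)
    then show "expectation (\<lambda>w. deviation (emp n w) ^ 4) \<le> C / (real n)\<^sup>2" using d4[OF n] by linarith
    have "Cn / (real n)\<^sup>2 \<le> C / (real n)\<^sup>2" using * Cn(1) by (intro divide_right_mono) (auto simp: C_def)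
    then show "expectation (\<lambda>w. (null_mass (emp n w))\<^sup>2) \<le> C / (real n)\<^sup>2" using n2[of n] by linarith
  qed
qed

text \<open>The fourth moments are summable, so large deviations occur only finitely often.\<close>

lemma AE_empirical_deviation: "AE w in M. (\<lambda>n. deviation (emp n w)) \<longlonglongrightarrow> 0"
proof -
  obtain C where C: "C \<ge> 0" "\<And>n. n \<ge> 1 \<Longrightarrow> expectation (\<lambda>w. deviation (emp n w) ^ 4) \<le> C / (real n)\<^sup>2"
    using empirical_deviation_moments by metis
  have "AE w in M. eventually (\<lambda>n. deviation (emp n w) ^ 4 < t) sequentially" if t: "t > 0" for t :: real
  proof -
    have [measurable]: "(\<lambda>w. deviation (emp n w) ^ 4) \<in> borel_measurable M" for n
      using integrable_empirical[where g = "\<lambda>q. deviation q ^ 4"] by (rule borel_measurable_integrable)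
    define A where "A n = {w \<in> space M. t \<le> deviation (emp n w) ^ 4}" for n
    have A: "A n \<in> sets M" for n unfolding A_def by measurable
    have "prob (A n) \<le> C / t * (1 / (real n)\<^sup>2)" if "n \<ge> 1" for n
    proof -
      have "prob (A n) \<le> expectation (\<lambda>w. deviation (emp n w) ^ 4) / t"
        unfolding A_def
        by (rule probability_markov_inequality) (use t integrable_empirical[where g = "\<lambda>q. deviation q ^ 4"] in auto)
      also have "\<dots> \<le> C / (real n)\<^sup>2 / t" using C(2)[OF that] t by (intro divide_right_mono) auto
      finally show ?thesis by (simp add: mult.commute)
    qed
    then have "\<forall>n\<ge>1. norm (prob (A n)) \<le> C / t * (1 / (real n)\<^sup>2)" by simp
    moreover have "summable (\<lambda>n. C / t * (1 / (real n)\<^sup>2))"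
      using inverse_power_summable[of 2, where 'a = real] by (intro summable_mult) (simp add: inverse_eq_divide)
    ultimately have "summable (\<lambda>n. prob (A n))" by (meson summable_comparison_test)
    then have "AE w in M. eventually (\<lambda>n. w \<in> space M - A n) sequentially"
      by (intro borel_cantelli_AE1 A) (auto simp: emeasure_eq_measure)
    then show ?thesis
      by eventually_elim (auto simp: A_def not_le elim: eventually_mono)
  qed
  then have "AE w in M. \<forall>m. eventually (\<lambda>n. deviation (emp n w) ^ 4 < 1 / real (Suc m)) sequentially"
    by (subst AE_all_countable) auto
  then show ?thesis
  proof eventually_elim
    case (elim w)
    show ?case
    proof (rule order_tendstoI)
      fix a :: real assume "a < 0"
      then show "eventually (\<lambda>n. a < deviation (emp n w)) sequentially"
        by (intro always_eventually allI) (meson deviation_nonneg less_le_trans)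
    next
      fix a :: real assume a: "0 < a"
      then obtain m where m: "1 / real (Suc m) < a ^ 4"
        using reals_Archimedean[of "a ^ 4"] by (auto simp: inverse_eq_divide)
      from elim have "eventually (\<lambda>n. deviation (emp n w) ^ 4 < 1 / real (Suc m)) sequentially" by blast
      then show "eventually (\<lambda>n. deviation (emp n w) < a) sequentially"
        by eventually_elim (use m a in \<open>meson less_trans less_imp_le power_less_imp_less_base\<close>)
    qed
  qed
qed

end


section \<open>First-order expansion of the estimates\<close>

lemma norm_outer_prod_le: "norm (outer_prod a b) \<le> norm a * norm b" for a b :: "real^'d"
proof -
  have "(norm (outer_prod a b))\<^sup>2 = (\<Sum>i\<in>UNIV. \<Sum>l\<in>UNIV. (a $ i * b $ l)\<^sup>2)"
    unfolding power2_norm_eq_inner by (simp add: outer_prod_def inner_vec_def power2_eq_square)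
  also have "\<dots> = (norm a * norm b)\<^sup>2"
    unfolding power_mult_distrib power2_norm_eq_inner
    by (simp add: inner_vec_def sum_product power_mult_distrib power2_eq_square[symmetric])
  finally show ?thesis by (rule eq_refl[OF power2_eq_imp_eq]) auto
qed

lemma outer_prod_add_left: "outer_prod (a + b) x = outer_prod a x + outer_prod b x"
  by (simp add: outer_prod_def vec_eq_iff algebra_simps)

lemma outer_prod_add_right: "outer_prod x (a + b) = outer_prod x a + outer_prod x b"
  by (simp add: outer_prod_def vec_eq_iff algebra_simps)

lemma outer_prod_matrix: "outer_prod (B *v a) (B *v b) = B ** outer_prod a b ** transpose B" for B :: "real^'d^'d"
  by (simp add: outer_prod_def vec_eq_iff matrix_matrix_mult_def matrix_vector_mult_def transpose_def
      sum_product sum_distrib_right sum_distrib_left mult_ac)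

lemma norm_matrix_le_entries: "(\<And>i l. \<bar>X $ i $ l\<bar> \<le> e) \<Longrightarrow> norm X \<le> (real CARD('d))\<^sup>2 * e" for X :: "real^'d^'d"
proof -
  assume e: "\<And>i l. \<bar>X $ i $ l\<bar> \<le> e"
  have "norm X \<le> (\<Sum>i\<in>UNIV. norm (X $ i))"
    by (simp add: norm_vec_def L2_set_le_sum)
  also have "\<dots> \<le> (\<Sum>i\<in>(UNIV::'d set). \<Sum>l\<in>(UNIV::'d set). e)"
    by (intro sum_mono order_trans[OF norm_le_l1_cart] e)
  finally show ?thesis by (simp add: power2_eq_square mult.assoc)
qed

lemma bounded_linear_conjugation: "bounded_linear (\<lambda>X. B ** X ** transpose B)" for B :: "real^'d^'d"
  unfolding linear_conv_bounded_linear[symmetric]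
  by (rule linearI) (simp_all add: matrix_matrix_mult_def vec_eq_iff algebra_simps sum.distrib sum_distrib_left sum_distrib_right)

lemma Linf_projection_inside: "Linf_projection S v y \<Longrightarrow> v \<in> S \<Longrightarrow> y = v"
  unfolding Linf_projection_def is_arg_min_def
  by (metis infnorm_0 infnorm_eq_0 infnorm_pos_lt diff_self eq_iff_diff_eq_0)

lemma power2_norm_add_le: "(norm (a + b))\<^sup>2 \<le> 2 * (norm a)\<^sup>2 + 2 * (norm b)\<^sup>2" for a b :: "'a::real_normed_vector"
proof -
  have "(norm (a + b))\<^sup>2 \<le> (norm a + norm b)\<^sup>2" by (intro power_mono norm_triangle_ineq) simp
  then show ?thesis using power2_add_le[of "norm a" "norm b"] by linarith
qed

locale estimated_lp = sampled_lp M P pol Z \<pi> \<mu> c \<gamma> \<psi> \<zeta> \<theta>s \<phi>s j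
  for M :: "'w measure"
    and P :: "'u::finite \<Rightarrow> 'x::finite \<Rightarrow> 'x pmf"
    and pol :: "'x \<Rightarrow> 'u pmf"
    and Z :: "nat \<Rightarrow> 'w \<Rightarrow> 'x \<times> 'u"
    and \<pi> \<mu> :: "('x \<times> 'u) pmf"
    and c :: "'x \<times> 'u \<Rightarrow> real"
    and \<gamma> :: real
    and \<psi> :: "'x \<times> 'u \<Rightarrow> real^'d"
    and \<zeta> :: "'x \<times> 'u \<Rightarrow> real^'p"
    and \<theta>s :: "real^'d"
    and \<phi>s :: "'x \<Rightarrow> 'u"
    and j :: "'d \<Rightarrow> 'p" +
  fixes \<theta> \<theta>r :: "nat \<Rightarrow> 'w \<Rightarrow> real^'d" and r :: real
  assumes solution: "\<And>N w. 0 < N \<Longrightarrow> w \<in> space M \<Longrightarrow>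
           \<not> lp_infeasible_or_unbounded (objective \<mu> \<psi>) (emp_feasible Z c \<gamma> \<psi> \<zeta> N w) \<Longrightarrow>
           lp_optimizer (objective \<mu> \<psi>) (emp_feasible Z c \<gamma> \<psi> \<zeta> N w) (\<theta> N w)"
    and r_pos: "0 < r" and interior: "\<And>i. \<bar>\<theta>s $ i\<bar> < r"
    and measurable_\<theta>r [measurable]: "\<And>N. \<theta>r N \<in> borel_measurable M"
    and projected: "\<And>N w. 0 < N \<Longrightarrow> w \<in> space M \<Longrightarrow>
           (if lp_infeasible_or_unbounded (objective \<mu> \<psi>) (emp_feasible Z c \<gamma> \<psi> \<zeta> N w)
            then \<theta>r N w = 0
            else Linf_projection (box_r r) (\<theta> N w) (\<theta>r N w))"
begin

abbreviation (input) err :: "nat \<Rightarrow> 'w \<Rightarrow> real^'d" where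
  "err N w \<equiv> \<theta>r N w - \<theta>s"

abbreviation (input) second_moment :: "('w \<Rightarrow> real^'d) \<Rightarrow> real^'d^'d" where
  "second_moment X \<equiv> expectation (\<lambda>w. outer_prod (X w) (X w))"

definition Ainv :: "real^'d^'d" where
  "Ainv = matrix_inv (A_of pair_law)"

text \<open>The error of the linear approximation of the estimate by the averaged noise.\<close>

definition remainder :: "nat \<Rightarrow> 'w \<Rightarrow> real^'d" where
  "remainder N w = \<theta>r N w - \<theta>s - Ainv *v W N w"

lemma norm_\<theta>r_le: "N \<ge> 1 \<Longrightarrow> w \<in> space M \<Longrightarrow> norm (\<theta>r N w) \<le> real CARD('d) * r"
proof -
  assume "N \<ge> 1" "w \<in> space M"
  then have "\<theta>r N w = 0 \<or> \<theta>r N w \<in> box_r r"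
    using projected[of N w] by (auto simp: Linf_projection_def is_arg_min_def split: if_splits)
  then have "\<bar>\<theta>r N w $ i\<bar> \<le> r" for i using r_pos by (auto simp: box_r_def)
  then have "(\<Sum>i\<in>UNIV. \<bar>\<theta>r N w $ i\<bar>) \<le> (\<Sum>i\<in>(UNIV::'d set). r)" by (intro sum_mono)
  then show ?thesis using norm_le_l1_cart[of "\<theta>r N w"] by simp
qed

lemma Ainv_W_le:
  obtains C where "C \<ge> 0" "\<And>N w. norm (Ainv *v W N w) \<le> C * deviation (emp N w)"
proof -
  obtain B where B: "B \<ge> 0" "\<And>q. norm (b_of q - A_of q *v \<theta>s) \<le> B * deviation q" using residual_deviation by blast
  have H: "norm (Ainv *v x) \<le> onorm ((*v) Ainv) * norm x" for x
    by (rule onorm[OF matrix_vector_mul_bounded_linear])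
  have H0: "onorm ((*v) Ainv) \<ge> 0" by (rule onorm_pos_le[OF matrix_vector_mul_bounded_linear])
  have "norm (Ainv *v W N w) \<le> onorm ((*v) Ainv) * B * deviation (emp N w)" for N w
    using H[of "W N w"] mult_left_mono[OF B(2)[of "emp N w"] H0] by (simp add: W_avg_eq)
  then show ?thesis using that[of "onorm ((*v) Ainv) * B"] H0 B by auto
qed

text \<open>When the frequencies are close to the steady-state law, the optimizer lies in the interior of the box,
  so the projection leaves it unchanged and the expansion of the optimizer applies. Otherwise the
  squared deviation is at least \<open>\<epsilon>\<^sup>2\<close>, and a large constant absorbs the bounded quantity \<open>\<theta>r N\<close> and
  the term \<open>Ainv *v W N w\<close>, which is at most linear in the deviation.\<close>

lemma pathwise_expansion:
  obtains \<epsilon> C where "\<epsilon> > 0" "C \<ge> 0"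
    "\<And>N w. N \<ge> 1 \<Longrightarrow> w \<in> space M \<Longrightarrow> deviation (emp N w) \<le> \<epsilon> \<Longrightarrow>
       \<theta>r N w = \<theta> N w \<and> norm (\<theta> N w - \<theta>s) \<le> C * deviation (emp N w)"
    "\<And>N w. N \<ge> 1 \<Longrightarrow> w \<in> space M \<Longrightarrow> norm (remainder N w) \<le> C * (null_mass (emp N w) + (deviation (emp N w))\<^sup>2)"
proof -
  obtain \<epsilon>1 C1 where e1: "\<epsilon>1 > 0" "C1 \<ge> 0"
    and exp: "\<And>q. (\<And>e. 0 \<le> q e) \<Longrightarrow> deviation q \<le> \<epsilon>1 \<Longrightarrow>
      \<not> lp_infeasible_or_unbounded (objective \<mu> \<psi>) (feasible q) \<and>
      (\<forall>\<theta>. lp_optimizer (objective \<mu> \<psi>) (feasible q) \<theta> \<longrightarrow>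
         norm (\<theta> - \<theta>s) \<le> C1 * deviation q \<and>
         norm (\<theta> - \<theta>s - matrix_inv (A_of pair_law) *v (b_of q - A_of q *v \<theta>s)) \<le> C1 * (null_mass q + (deviation q)\<^sup>2))"
    using optimizer_expansion by metis
  obtain C2 where C2: "C2 \<ge> 0" "\<And>N w. norm (Ainv *v W N w) \<le> C2 * deviation (emp N w)" using Ainv_W_le by blast
  \<comment> \<open>The distance of \<open>\<theta>s\<close> from the boundary of the box.\<close>
  define gap where "gap = Min (range (\<lambda>i. r - \<bar>\<theta>s $ i\<bar>))"
  have gap: "gap > 0" "\<And>i. gap \<le> r - \<bar>\<theta>s $ i\<bar>"
    unfolding gap_def using interior by (auto simp: Min_gr_iff)
  define \<epsilon> where "\<epsilon> = min \<epsilon>1 (gap / (C1 + 1))"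
  have \<epsilon>: "\<epsilon> > 0" using e1 gap by (simp add: \<epsilon>_def)
  define K where "K = real CARD('d) * r + norm \<theta>s"
  have K: "K \<ge> 0" using r_pos by (simp add: K_def)
  define C where "C = C1 + (K / \<epsilon>\<^sup>2 + C2 / \<epsilon>)"
  have C: "C \<ge> 0" "C1 \<le> C" "K / \<epsilon>\<^sup>2 + C2 / \<epsilon> \<le> C" using e1 K C2 \<epsilon> by (auto simp: C_def)
  have good: "\<theta>r N w = \<theta> N w \<and> norm (\<theta> N w - \<theta>s) \<le> C1 * deviation (emp N w) \<and>
      norm (remainder N w) \<le> C1 * (null_mass (emp N w) + (deviation (emp N w))\<^sup>2)"
    if N: "N \<ge> 1" "w \<in> space M" "deviation (emp N w) \<le> \<epsilon>" for N w
  proof -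
    have "deviation (emp N w) \<le> \<epsilon>1" using N(3) by (simp add: \<epsilon>_def)
    note ex = exp[OF empirical_nonneg this]
    then have fin: "\<not> lp_infeasible_or_unbounded (objective \<mu> \<psi>) (emp_feasible Z c \<gamma> \<psi> \<zeta> N w)"
      by (simp add: emp_feasible_eq)
    from solution[OF _ N(2) fin] N(1) have "lp_optimizer (objective \<mu> \<psi>) (feasible (emp N w)) (\<theta> N w)"
      by (simp add: emp_feasible_eq)
    with ex have th: "norm (\<theta> N w - \<theta>s) \<le> C1 * deviation (emp N w)"
      "norm (\<theta> N w - \<theta>s - Ainv *v W N w) \<le> C1 * (null_mass (emp N w) + (deviation (emp N w))\<^sup>2)"
      by (auto simp: W_avg_eq Ainv_def)
    have "C1 * deviation (emp N w) \<le> C1 * (gap / (C1 + 1))"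
      using N(3) e1(2) by (intro mult_left_mono) (auto simp: \<epsilon>_def)
    also have "\<dots> \<le> gap" using e1(2) gap(1) by (simp add: field_simps)
    finally have "norm (\<theta> N w - \<theta>s) \<le> gap" using th(1) by linarith
    then have "\<bar>\<theta> N w $ i\<bar> \<le> r" for i
      using component_le_norm_cart[of "\<theta> N w - \<theta>s" i] gap(2)[of i] by simp
    then have "\<theta> N w \<in> box_r r" by (simp add: box_r_def)
    moreover have "Linf_projection (box_r r) (\<theta> N w) (\<theta>r N w)" using projected[OF _ N(2)] N(1) fin by simp
    ultimately have "\<theta>r N w = \<theta> N w" by (metis Linf_projection_inside)
    then show ?thesis using th by (simp add: remainder_def)
  qed
  show ?thesis
  proof (rule that[OF \<epsilon> C(1)])
    fix N :: nat and w assume N: "N \<ge> 1" "w \<in> space M"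
    note nn = null_mass_nonneg[OF empirical_nonneg[of N "\<lambda>i. Z i w"]] deviation_nonneg[of "emp N w"]
    show "\<theta>r N w = \<theta> N w \<and> norm (\<theta> N w - \<theta>s) \<le> C * deviation (emp N w)" if "deviation (emp N w) \<le> \<epsilon>"
      using good[OF N that] mult_right_mono[OF C(2) nn(2)] by auto
    show "norm (remainder N w) \<le> C * (null_mass (emp N w) + (deviation (emp N w))\<^sup>2)"
    proof (cases "deviation (emp N w) \<le> \<epsilon>")
      case True
      have "C1 * (null_mass (emp N w) + (deviation (emp N w))\<^sup>2) \<le> C * (null_mass (emp N w) + (deviation (emp N w))\<^sup>2)"
        using C(2) nn by (intro mult_right_mono) auto
      then show ?thesis using good[OF N True] by linarith
    next
      case False
      define d where "d = deviation (emp N w)"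
      have d: "d > \<epsilon>" using False by (simp add: d_def)
      have "norm (remainder N w) \<le> norm (\<theta>r N w) + norm \<theta>s + norm (Ainv *v W N w)"
        unfolding remainder_def by (intro order_trans[OF norm_triangle_ineq4] add_mono order_refl)
      also have "\<dots> \<le> K + C2 * d" using norm_\<theta>r_le[OF N] C2(2)[of N w] by (simp add: K_def d_def)
      also have "\<dots> \<le> K / \<epsilon>\<^sup>2 * d\<^sup>2 + C2 / \<epsilon> * d\<^sup>2"
      proof (intro add_mono)
        have "\<epsilon>\<^sup>2 \<le> d\<^sup>2" using d \<epsilon> by (intro power_mono) auto
        then have "K * 1 \<le> K * (d\<^sup>2 / \<epsilon>\<^sup>2)" using K \<epsilon> by (intro mult_left_mono) auto
        then show "K \<le> K / \<epsilon>\<^sup>2 * d\<^sup>2" by simp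
        have "d * \<epsilon> \<le> d * d" using d \<epsilon> by (intro mult_left_mono) auto
        then have "d \<le> d\<^sup>2 / \<epsilon>" using \<epsilon> by (simp add: field_simps power2_eq_square)
        from mult_left_mono[OF this C2(1)] show "C2 * d \<le> C2 / \<epsilon> * d\<^sup>2" by simp
      qed
      also have "\<dots> = (K / \<epsilon>\<^sup>2 + C2 / \<epsilon>) * d\<^sup>2" by (simp add: distrib_right)
      also have "\<dots> \<le> C * (null_mass (emp N w) + d\<^sup>2)"
        using C K C2 \<epsilon> nn by (intro mult_mono) auto
      finally show ?thesis by (simp add: d_def)
    qed
  qed
qed

lemma almost_sure_convergence: "AE w in M. (\<lambda>N. \<theta>r N w) \<longlonglongrightarrow> \<theta>s \<and> (\<lambda>N. \<theta> N w) \<longlonglongrightarrow> \<theta>s"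
proof -
  obtain \<epsilon> C where e: "\<epsilon> > 0" "C \<ge> 0"
    "\<And>N w. N \<ge> 1 \<Longrightarrow> w \<in> space M \<Longrightarrow> deviation (emp N w) \<le> \<epsilon> \<Longrightarrow>
       \<theta>r N w = \<theta> N w \<and> norm (\<theta> N w - \<theta>s) \<le> C * deviation (emp N w)"
    using pathwise_expansion by metis
  have "AE w in M. w \<in> space M" by (rule AE_space)
  with AE_empirical_deviation show ?thesis
  proof eventually_elim
    case (elim w)
    have ev: "eventually (\<lambda>N. N \<ge> 1 \<and> deviation (emp N w) \<le> \<epsilon>) sequentially"
      using order_tendstoD(2)[OF elim(1) e(1)] eventually_ge_at_top[of 1]
      by eventually_elim auto
    have "(\<lambda>N. \<theta> N w - \<theta>s) \<longlonglongrightarrow> 0"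
    proof (rule Lim_null_comparison)
      show "eventually (\<lambda>N. norm (\<theta> N w - \<theta>s) \<le> C * deviation (emp N w)) sequentially"
        using ev by eventually_elim (use e(3) elim(2) in blast)
      show "(\<lambda>N. C * deviation (emp N w)) \<longlonglongrightarrow> 0" by (rule tendsto_mult_right_zero[OF elim(1)])
    qed
    then have 1: "(\<lambda>N. \<theta> N w) \<longlonglongrightarrow> \<theta>s" by (simp add: LIM_zero_iff)
    moreover have "(\<lambda>N. \<theta>r N w) \<longlonglongrightarrow> \<theta>s"
      by (rule Lim_transform_eventually[OF 1]) (use ev in \<open>eventually_elim, metis e(3) elim(2)\<close>)
    ultimately show ?case by simp
  qed
qed

lemma remainder_moments:
  obtains C where "C \<ge> 0"
    "\<And>n. n \<ge> 1 \<Longrightarrow> expectation (\<lambda>w. (norm (Ainv *v W n w))\<^sup>2) \<le> C / real n"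
    "\<And>n. n \<ge> 1 \<Longrightarrow> integrable M (\<lambda>w. (norm (remainder n w))\<^sup>2) \<and> expectation (\<lambda>w. (norm (remainder n w))\<^sup>2) \<le> C / (real n)\<^sup>2"
proof -
  obtain \<epsilon> C1 where C1: "C1 \<ge> 0"
    "\<And>N w. N \<ge> 1 \<Longrightarrow> w \<in> space M \<Longrightarrow> norm (remainder N w) \<le> C1 * (null_mass (emp N w) + (deviation (emp N w))\<^sup>2)"
    using pathwise_expansion by metis
  obtain C2 where C2: "C2 \<ge> 0" "\<And>N w. norm (Ainv *v W N w) \<le> C2 * deviation (emp N w)" using Ainv_W_le by blast
  obtain C3 where C3: "C3 \<ge> 0"
    "\<And>n. n \<ge> 1 \<Longrightarrow> expectation (\<lambda>w. (deviation (emp n w))\<^sup>2) \<le> C3 / real n"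
    "\<And>n. n \<ge> 1 \<Longrightarrow> expectation (\<lambda>w. deviation (emp n w) ^ 4) \<le> C3 / (real n)\<^sup>2"
    "\<And>n. n \<ge> 1 \<Longrightarrow> expectation (\<lambda>w. (null_mass (emp n w))\<^sup>2) \<le> C3 / (real n)\<^sup>2"
    using empirical_deviation_moments by metis
  have [measurable]: "remainder n \<in> borel_measurable M" for n
  proof -
    have "(\<lambda>w. Ainv *v W n w) \<in> borel_measurable M"
      unfolding W_avg_eq using integrable_empirical[where g = "\<lambda>q. Ainv *v (b_of q - A_of q *v \<theta>s)"]
      by (rule borel_measurable_integrable)
    then show ?thesis unfolding remainder_def by measurable
  qed
  have V: "expectation (\<lambda>w. (norm (Ainv *v W n w))\<^sup>2) \<le> C2\<^sup>2 * C3 / real n" if "n \<ge> 1" for n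
  proof -
    have "(norm (Ainv *v W n w))\<^sup>2 \<le> C2\<^sup>2 * (deviation (emp n w))\<^sup>2" for w
      unfolding power_mult_distrib[symmetric] by (rule power_mono[OF C2(2)]) simp
    then have "expectation (\<lambda>w. (norm (Ainv *v W n w))\<^sup>2) \<le> expectation (\<lambda>w. C2\<^sup>2 * (deviation (emp n w))\<^sup>2)"
      unfolding W_avg_eq
      by (intro integral_mono integrable_empirical[where g = "\<lambda>q. (norm (Ainv *v (b_of q - A_of q *v \<theta>s)))\<^sup>2"]
          integrable_empirical[where g = "\<lambda>q. C2\<^sup>2 * (deviation q)\<^sup>2"])
    also have "\<dots> = C2\<^sup>2 * expectation (\<lambda>w. (deviation (emp n w))\<^sup>2)" by simp
    also have "\<dots> \<le> C2\<^sup>2 * (C3 / real n)" using C3(2)[OF that] by (intro mult_left_mono) auto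
    finally show ?thesis by simp
  qed
  have R: "integrable M (\<lambda>w. (norm (remainder n w))\<^sup>2) \<and> expectation (\<lambda>w. (norm (remainder n w))\<^sup>2) \<le> 4 * C1\<^sup>2 * C3 / (real n)\<^sup>2"
    if n: "n \<ge> 1" for n
  proof -
    define U where "U q = 2 * C1\<^sup>2 * ((null_mass q)\<^sup>2 + deviation q ^ 4)" for q
    have le: "(norm (remainder n w))\<^sup>2 \<le> U (emp n w)" if "w \<in> space M" for w
    proof -
      have "(norm (remainder n w))\<^sup>2 \<le> (C1 * (null_mass (emp n w) + (deviation (emp n w))\<^sup>2))\<^sup>2"
        by (rule power_mono[OF C1(2)[OF n that]]) simp
      also have "\<dots> = C1\<^sup>2 * (null_mass (emp n w) + (deviation (emp n w))\<^sup>2)\<^sup>2" by (simp add: power_mult_distrib)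
      also have "\<dots> \<le> C1\<^sup>2 * (2 * (null_mass (emp n w))\<^sup>2 + 2 * ((deviation (emp n w))\<^sup>2)\<^sup>2)"
        by (intro mult_left_mono power2_add_le) simp
      finally show ?thesis by (simp add: U_def algebra_simps)
    qed
    have i: "integrable M (\<lambda>w. U (emp n w))" by (rule integrable_empirical)
    have ir: "integrable M (\<lambda>w. (norm (remainder n w))\<^sup>2)"
      by (rule Bochner_Integration.integrable_bound[OF i])
        (use le in \<open>auto intro!: AE_I2 order_trans[OF le abs_ge_self]\<close>)
    have "expectation (\<lambda>w. (norm (remainder n w))\<^sup>2) \<le> expectation (\<lambda>w. U (emp n w))"
      by (rule integral_mono[OF ir i le])
    also have "\<dots> = 2 * C1\<^sup>2 * (expectation (\<lambda>w. (null_mass (emp n w))\<^sup>2) + expectation (\<lambda>w. deviation (emp n w) ^ 4))"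
      using integrable_empirical[where g = "\<lambda>q. (null_mass q)\<^sup>2" and N = n] integrable_empirical[where g = "\<lambda>q. deviation q ^ 4" and N = n]
      unfolding U_def by simp
    also have "\<dots> \<le> 2 * C1\<^sup>2 * (C3 / (real n)\<^sup>2 + C3 / (real n)\<^sup>2)"
      using C3(3,4)[OF n] by (intro mult_left_mono add_mono) auto
    finally show ?thesis using ir by simp
  qed
  define C where "C = C2\<^sup>2 * C3 + 4 * C1\<^sup>2 * C3"
  show ?thesis
  proof (rule that[of C])
    show "C \<ge> 0" using C3(1) by (simp add: C_def)
    fix n :: nat assume n: "n \<ge> 1"
    have "C2\<^sup>2 * C3 / real n \<le> C / real n" using C3(1) by (intro divide_right_mono) (auto simp: C_def)
    then show "expectation (\<lambda>w. (norm (Ainv *v W n w))\<^sup>2) \<le> C / real n" using V[OF n] by linarith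
    have "4 * C1\<^sup>2 * C3 / (real n)\<^sup>2 \<le> C / (real n)\<^sup>2" using C3(1) by (intro divide_right_mono) (auto simp: C_def)
    then show "integrable M (\<lambda>w. (norm (remainder n w))\<^sup>2) \<and> expectation (\<lambda>w. (norm (remainder n w))\<^sup>2) \<le> C / (real n)\<^sup>2"
      using R[OF n] by linarith
  qed
qed

end


section \<open>Asymptotic covariance and normality\<close>

lemma sqrt_times_divide: "sqrt (real n) * (x / real n) = x / sqrt (real n)"
proof -
  have "sqrt (real n) * (x / real n) = (sqrt (real n) / real n) * x" by simp
  also have "sqrt (real n) / real n = inverse (sqrt (real n))" by (rule sqrt_divide_self_eq) simp
  finally show ?thesis by (simp add: divide_inverse)
qed

context estimated_lp
begin

text \<open>A solution of the Poisson equation for each component of the noise, chosen once so that the covariance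
  matrix and all its projections refer to the same martingale.\<close>

definition corrector :: "'d \<Rightarrow> 'x \<times> 'u \<Rightarrow> real" where
  "corrector i = (SOME h. centred (\<lambda>z z'. noise i z z' + h z' - h z))"

definition martingale_part :: "'d \<Rightarrow> 'x \<times> 'u \<Rightarrow> 'x \<times> 'u \<Rightarrow> real" where
  "martingale_part i = (\<lambda>z z'. noise i z z' + corrector i z' - corrector i z)"

definition \<Sigma>W :: "real^'d^'d" where
  "\<Sigma>W = (\<chi> i l. stationary_mean (\<lambda>z z'. martingale_part i z z' * martingale_part l z z'))"

definition \<Sigma>\<theta> :: "real^'d^'d" where
  "\<Sigma>\<theta> = Ainv ** \<Sigma>W ** transpose Ainv"

lemma centred_martingale_part: "centred (martingale_part i)"
proof -
  have "\<exists>h. centred (\<lambda>z z'. noise i z z' + h z' - h z)"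
    using martingale_decomposition[OF stationary_mean_noise] by blast
  then show ?thesis unfolding martingale_part_def corrector_def by (rule someI_ex)
qed

lemma integrable_Ainv_W:
  fixes g :: "real^'d \<Rightarrow> 'e::{banach, second_countable_topology}"
  shows "integrable M (\<lambda>w. g (Ainv *v W n w))"
  unfolding W_avg_eq by (rule integrable_empirical[where g = "\<lambda>q. g (Ainv *v (b_of q - A_of q *v \<theta>s))"])

lemma integrable_outer_W: "integrable M (\<lambda>w. outer_prod (W n w) (W n w))"
  unfolding W_avg_eq
  by (rule integrable_empirical[where g = "\<lambda>q. outer_prod (b_of q - A_of q *v \<theta>s) (b_of q - A_of q *v \<theta>s)"])

lemma outer_W_component:
  "second_moment (W n) $ i $ l = expectation (\<lambda>w. W n w $ i * W n w $ l)"
proof -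
  have bl: "bounded_linear (\<lambda>X :: real^'d^'d. X $ i $ l)"
    by (rule bounded_linear_compose[OF bounded_linear_vec_nth bounded_linear_vec_nth])
  from integral_bounded_linear[OF bl integrable_outer_W] show ?thesis by (simp add: outer_prod_def)
qed

lemma W_covariance_rate:
  obtains C where "C \<ge> 0"
    "\<And>n. n \<ge> 1 \<Longrightarrow> norm (real n *\<^sub>R second_moment (W n) - \<Sigma>W) \<le> C / sqrt (real n)"
proof -
  define Q where "Q i l C \<longleftrightarrow> (\<forall>n\<ge>1. \<bar>expectation (\<lambda>x. path_sum (noise i) n (path x) * path_sum (noise l) n (path x))
     - real n * stationary_mean (\<lambda>z z'. martingale_part i z z' * martingale_part l z z')\<bar> \<le> C * sqrt (real n))" for i l C
  have "\<exists>C. Q i l C" for i l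
    using path_sum_covariance[OF stationary_mean_noise stationary_mean_noise
          centred_martingale_part martingale_part_def centred_martingale_part martingale_part_def, of i l]
    unfolding Q_def by blast
  then obtain Cf where "\<And>i l. Q i l (Cf i l)" by metis
  then have Cf: "\<bar>expectation (\<lambda>x. path_sum (noise i) n (path x) * path_sum (noise l) n (path x))
     - real n * stationary_mean (\<lambda>z z'. martingale_part i z z' * martingale_part l z z')\<bar> \<le> Cf i l * sqrt (real n)" if "n \<ge> 1" for i l n
    using that unfolding Q_def by blast
  obtain C where C: "C \<ge> 0" "\<And>i l. norm (Cf i l) \<le> C" using finite_family_bound2[of Cf] by blast
  have "norm (real n *\<^sub>R second_moment (W n) - \<Sigma>W) \<le> (real CARD('d))\<^sup>2 * (C / sqrt (real n))"
    if n: "n \<ge> 1" for n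
  proof (rule norm_matrix_le_entries)
    fix i l
    let ?e = "expectation (\<lambda>x. path_sum (noise i) n (path x) * path_sum (noise l) n (path x))"
    let ?s = "stationary_mean (\<lambda>z z'. martingale_part i z z' * martingale_part l z z')"
    have "expectation (\<lambda>w. W n w $ i * W n w $ l) = ?e / (real n)\<^sup>2"
      by (simp add: W_avg_path_sum power2_eq_square)
    then have "(real n *\<^sub>R second_moment (W n) - \<Sigma>W) $ i $ l = (?e - real n * ?s) / real n"
      using n by (simp add: outer_W_component \<Sigma>W_def field_simps power2_eq_square)
    also have "\<bar>\<dots>\<bar> \<le> C * sqrt (real n) / real n"
    proof -
      have "Cf i l * sqrt (real n) \<le> C * sqrt (real n)" using C(2)[of i l] by (intro mult_right_mono) auto
      then show ?thesis unfolding abs_divide using Cf[OF n, of i l] by (simp add: divide_right_mono)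
    qed
    also have "\<dots> = C / sqrt (real n)" using n by (simp add: field_simps)
    finally show "\<bar>(real n *\<^sub>R second_moment (W n) - \<Sigma>W) $ i $ l\<bar> \<le> C / sqrt (real n)" .
  qed
  then show ?thesis using that[of "(real CARD('d))\<^sup>2 * C"] C(1) by simp
qed

lemma W_covariance_limit:
  "(\<lambda>n. real n *\<^sub>R second_moment (W n)) \<longlonglongrightarrow> \<Sigma>W"
proof -
  obtain C where C: "C \<ge> 0"
    "\<And>n. n \<ge> 1 \<Longrightarrow> norm (real n *\<^sub>R second_moment (W n) - \<Sigma>W) \<le> C / sqrt (real n)"
    using W_covariance_rate by blast
  have "(\<lambda>n. real n *\<^sub>R second_moment (W n) - \<Sigma>W) \<longlonglongrightarrow> 0"
  proof (rule Lim_null_comparison)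
    show "eventually (\<lambda>n. norm (real n *\<^sub>R second_moment (W n) - \<Sigma>W) \<le> C / sqrt (real n)) sequentially"
      using eventually_ge_at_top[of 1] by eventually_elim (rule C(2))
    show "(\<lambda>n. C / sqrt (real n)) \<longlonglongrightarrow> 0" by real_asymp
  qed
  then show ?thesis by (simp add: LIM_zero_iff)
qed

text \<open>With \<open>V = Ainv *v W n w\<close>, the error is \<open>V\<close> plus the remainder. The second moment of \<open>V\<close> inherits the rate
  of the averaged noise. The cross terms are balanced by Young's inequality with weight \<open>a = 1/\<surd>n\<close>:
  \<open>E (norm V)\<^sup>2 = O(1/n)\<close> and \<open>E (norm remainder)\<^sup>2 = O(1/n\<^sup>2)\<close> both contribute \<open>O(n\<^sup>-\<^sup>3\<^sup>/\<^sup>2)\<close>.\<close>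

lemma second_moment_rate:
  "(\<lambda>n. norm (real n *\<^sub>R second_moment (err n) - \<Sigma>\<theta>))
     \<in> O(\<lambda>n. 1 / sqrt (real n))"
proof -
  obtain C1 where C1: "C1 \<ge> 0"
    "\<And>n. n \<ge> 1 \<Longrightarrow> norm (real n *\<^sub>R second_moment (W n) - \<Sigma>W) \<le> C1 / sqrt (real n)"
    using W_covariance_rate by blast
  obtain C2 where C2: "C2 \<ge> 0"
    "\<And>n. n \<ge> 1 \<Longrightarrow> expectation (\<lambda>w. (norm (Ainv *v W n w))\<^sup>2) \<le> C2 / real n"
    "\<And>n. n \<ge> 1 \<Longrightarrow> integrable M (\<lambda>w. (norm (remainder n w))\<^sup>2) \<and> expectation (\<lambda>w. (norm (remainder n w))\<^sup>2) \<le> C2 / (real n)\<^sup>2"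
    using remainder_moments by blast
  obtain L where L: "\<And>X. norm (Ainv ** X ** transpose Ainv) \<le> norm X * L"
    using bounded_linear.bounded[OF bounded_linear_conjugation] by blast
  define V where "V n w = Ainv *v W n w" for n w
  have bound: "norm (real n *\<^sub>R second_moment (err n) - \<Sigma>\<theta>)
      \<le> (C1 * \<bar>L\<bar> + 3 * C2) * (1 / sqrt (real n))" if n: "n \<ge> 1" for n
  proof -
    have sq: "sqrt (real n) \<ge> 1" using n by simp
    have V_id: "\<theta>r n w - \<theta>s = V n w + remainder n w" for w by (simp add: V_def remainder_def)
    have EV: "second_moment (V n)
        = Ainv ** second_moment (W n) ** transpose Ainv"
      unfolding V_def outer_prod_matrix
      by (rule integral_bounded_linear[OF bounded_linear_conjugation]) (rule integrable_outer_W)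
    have "real n *\<^sub>R second_moment (V n) - \<Sigma>\<theta>
      = Ainv ** (real n *\<^sub>R second_moment (W n) - \<Sigma>W) ** transpose Ainv"
      unfolding EV \<Sigma>\<theta>_def
      using linear_diff[OF bounded_linear.linear[OF bounded_linear_conjugation[of Ainv]]]
        linear_scale[OF bounded_linear.linear[OF bounded_linear_conjugation[of Ainv]]] by simp
    then have "norm (real n *\<^sub>R second_moment (V n) - \<Sigma>\<theta>)
      \<le> norm (real n *\<^sub>R second_moment (W n) - \<Sigma>W) * L" using L by simp
    also have "\<dots> \<le> norm (real n *\<^sub>R second_moment (W n) - \<Sigma>W) * \<bar>L\<bar>"
      by (intro mult_left_mono) auto
    also have "\<dots> \<le> C1 / sqrt (real n) * \<bar>L\<bar>" by (rule mult_right_mono[OF C1(2)[OF n]]) simp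
    finally have p1: "norm (real n *\<^sub>R second_moment (V n) - \<Sigma>\<theta>) \<le> C1 * \<bar>L\<bar> * (1 / sqrt (real n))" by simp
    define a where "a = 1 / sqrt (real n)"
    have a: "a > 0" using n by (simp add: a_def)
    have iV2: "integrable M (\<lambda>w. (norm (V n w))\<^sup>2)" unfolding V_def by (rule integrable_Ainv_W)
    define T where "T w = a * (norm (V n w))\<^sup>2 + (1 / a + 1) * (norm (remainder n w))\<^sup>2" for w
    have iT: "integrable M T" unfolding T_def using iV2 C2(3)[OF n] by simp
    have diff: "outer_prod (err n w) (err n w) - outer_prod (V n w) (V n w)
        = outer_prod (V n w) (remainder n w) + outer_prod (remainder n w) (V n w) + outer_prod (remainder n w) (remainder n w)" for w
      by (simp add: V_id outer_prod_add_left outer_prod_add_right)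
    have le: "norm (outer_prod (err n w) (err n w) - outer_prod (V n w) (V n w)) \<le> T w" for w
    proof -
      have "norm (outer_prod (err n w) (err n w) - outer_prod (V n w) (V n w))
         \<le> norm (V n w) * norm (remainder n w) + norm (remainder n w) * norm (V n w) + norm (remainder n w) * norm (remainder n w)"
        unfolding diff by (intro order_trans[OF norm_triangle_ineq] add_mono norm_outer_prod_le)
      also have "\<dots> \<le> T w"
      proof -
        have "0 \<le> (a * norm (V n w) - norm (remainder n w))\<^sup>2 / a" using a by simp
        then have "2 * (norm (V n w) * norm (remainder n w)) \<le> a * (norm (V n w))\<^sup>2 + (1 / a) * (norm (remainder n w))\<^sup>2"
          using a by (simp add: power2_diff field_simps power2_eq_square)
        then show ?thesis by (simp add: T_def algebra_simps power2_eq_square)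
      qed
      finally show ?thesis .
    qed
    have iO: "integrable M (\<lambda>w. outer_prod (err n w) (err n w))"
    proof (rule integrable_const_bound)
      let ?K = "real CARD('d) * r + norm \<theta>s"
      have "norm (outer_prod (err n w) (err n w)) \<le> ?K * ?K" if "w \<in> space M" for w
      proof -
        have "norm (err n w) \<le> ?K" using norm_\<theta>r_le[OF n that] norm_triangle_ineq4[of "\<theta>r n w" \<theta>s] by linarith
        then show ?thesis by (intro order_trans[OF norm_outer_prod_le] mult_mono) (use r_pos in auto)
      qed
      then show "AE w in M. norm (outer_prod (err n w) (err n w)) \<le> ?K * ?K" by (intro AE_I2)
      have "continuous_on UNIV (\<lambda>v :: real^'d. outer_prod v v)"
        unfolding outer_prod_def by (intro continuous_intros)
      then have [measurable]: "(\<lambda>v :: real^'d. outer_prod v v) \<in> borel_measurable borel"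
        by (rule borel_measurable_continuous_onI)
      show "(\<lambda>w. outer_prod (err n w) (err n w)) \<in> borel_measurable M"
        by (rule measurable_compose[of "\<lambda>w. \<theta>r n w - \<theta>s" _ borel]) measurable
    qed
    have iVV: "integrable M (\<lambda>w. outer_prod (V n w) (V n w))" unfolding V_def by (rule integrable_Ainv_W)
    have ET: "expectation T \<le> 3 * C2 * (1 / sqrt (real n)) / real n"
    proof -
      have "expectation T = a * expectation (\<lambda>w. (norm (V n w))\<^sup>2) + (1 / a + 1) * expectation (\<lambda>w. (norm (remainder n w))\<^sup>2)"
        unfolding T_def using iV2 C2(3)[OF n] by simp
      also have "\<dots> \<le> a * (C2 / real n) + (1 / a + 1) * (C2 / (real n)\<^sup>2)"
        using C2(2,3)[OF n] a by (intro add_mono mult_left_mono) (auto simp: V_def)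
      also have "\<dots> = (a * C2 + (1 / a + 1) * C2 / real n) / real n"
        using n by (simp add: field_simps power2_eq_square)
      also have "\<dots> \<le> (3 * C2 * a) / real n"
      proof (intro divide_right_mono)
        have "(1 / a) / real n = a" using n by (simp add: a_def real_div_sqrt field_simps)
        moreover have "1 / real n \<le> a"
        proof -
          have "sqrt (real n) \<le> real n" using sq mult_left_mono[OF sq, of "sqrt (real n)"] by simp
          then show ?thesis unfolding a_def using n by (intro divide_left_mono) auto
        qed
        ultimately have "(1 / a + 1) / real n \<le> 2 * a" by (simp add: add_divide_distrib)
        from mult_right_mono[OF this C2(1)] show "a * C2 + (1 / a + 1) * C2 / real n \<le> 3 * C2 * a"
          by (simp add: algebra_simps)
      qed simp
      finally show ?thesis by (simp add: a_def)
    qed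
    have "norm (second_moment (err n) - second_moment (V n)) \<le> expectation T"
      unfolding Bochner_Integration.integral_diff[OF iO iVV, symmetric]
      by (rule norm_lebesgue_integral_le[OF Bochner_Integration.integrable_diff[OF iO iVV] iT le])
    then have "real n * norm (second_moment (err n) - second_moment (V n))
       \<le> real n * (3 * C2 * (1 / sqrt (real n)) / real n)"
      using ET by (intro mult_left_mono) auto
    then have p2: "norm (real n *\<^sub>R second_moment (err n) - real n *\<^sub>R second_moment (V n))
       \<le> 3 * C2 * (1 / sqrt (real n))"
      using n by (simp flip: scaleR_diff_right)
    from norm_triangle_mono[OF p2 p1] show ?thesis by (simp add: algebra_simps add_divide_distrib)
  qed
  show ?thesis
    by (rule bigoI[where c = "C1 * \<bar>L\<bar> + 3 * C2"])
      (use eventually_ge_at_top[of "1::nat"] in eventually_elim, use bound in simp)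
qed

text \<open>The martingale increment seen in direction \<open>t\<close> after applying \<open>Ainv\<close>; its stationary variance is the
  quadratic form of \<open>\<Sigma>\<theta>\<close>.\<close>

definition directional :: "real^'d \<Rightarrow> 'x \<times> 'u \<Rightarrow> 'x \<times> 'u \<Rightarrow> real" where
  "directional t z z' = (\<Sum>i\<in>UNIV. (transpose Ainv *v t) $ i * martingale_part i z z')"

lemma inner_Ainv: "t \<bullet> (Ainv *v x) = (transpose Ainv *v t) \<bullet> x"
  by (simp add: dot_lmul_matrix[symmetric] vector_transpose_matrix)

lemma directional_eq: "directional t z z' = t \<bullet> (Ainv *v (\<chi> i. martingale_part i z z'))"
  unfolding inner_Ainv directional_def by (simp add: inner_vec_def)

lemma centred_directional: "centred (directional t)"
proof -
  have "mean (closed_loop P pol z) (directional t z) = (\<Sum>i\<in>UNIV. (transpose Ainv *v t) $ i * mean (closed_loop P pol z) (martingale_part i z))" for z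
    unfolding directional_def[abs_def] mean_def
    by (simp add: sum_distrib_left) (subst sum.swap, simp add: mult_ac)
  then show ?thesis using centred_martingale_part by (simp add: centred_def)
qed

lemma directional_variance: "stationary_mean (\<lambda>z z'. directional t z z' * directional t z z') = t \<bullet> (\<Sigma>\<theta> *v t)"
proof -
  let ?s = "transpose Ainv *v t"
  have "stationary_mean (\<lambda>z z'. directional t z z' * directional t z z')
      = (\<Sum>i\<in>UNIV. \<Sum>l\<in>UNIV. ?s $ i * ?s $ l * stationary_mean (\<lambda>z z'. martingale_part i z z' * martingale_part l z z'))"
  proof -
    have "directional t z z' * directional t z z' = (\<Sum>i\<in>UNIV. \<Sum>l\<in>UNIV. ?s $ i * ?s $ l * (martingale_part i z z' * martingale_part l z z'))" for z z'
      by (simp add: directional_def sum_product mult_ac)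
    then show ?thesis by (simp add: stationary_mean_sum stationary_mean_cmult)
  qed
  also have "\<dots> = ?s \<bullet> (\<Sigma>W *v ?s)"
  proof -
    have "(\<Sum>i\<in>UNIV. \<Sum>l\<in>UNIV. s $ i * s $ l * stationary_mean (\<lambda>z z'. martingale_part i z z' * martingale_part l z z'))
        = s \<bullet> (\<Sigma>W *v s)" for s :: "real^'d"
      by (simp add: inner_vec_def matrix_vector_mult_def \<Sigma>W_def sum_distrib_left mult_ac)
    then show ?thesis .
  qed
  also have "\<dots> = t \<bullet> (\<Sigma>\<theta> *v t)"
    unfolding \<Sigma>\<theta>_def inner_Ainv[symmetric] by (simp only: matrix_vector_mul_assoc matrix_mul_assoc)
  finally show ?thesis .
qed

text \<open>The scaled error in direction \<open>t\<close> is a normalized martingale sum up to the boundary terms of the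
  correctors and the remainder, both of mean size \<open>O(1/\<surd>n)\<close>.\<close>

lemma characteristic_function_limit:
  "(\<lambda>n. expectation (\<lambda>w. iexp (t \<bullet> (sqrt (real n) *\<^sub>R (err n w)))))
     \<longlonglongrightarrow> complex_of_real (exp (- (t \<bullet> (\<Sigma>\<theta> *v t)) / 2))"
proof (rule characteristic_function_perturbation)
  let ?s = "transpose Ainv *v t"
  let ?X = "\<lambda>n w. t \<bullet> (sqrt (real n) *\<^sub>R (err n w))"
  let ?Y = "\<lambda>n w. path_sum (directional t) n (path w) / sqrt (real n)"
  show mX: "?X n \<in> borel_measurable M" for n by measurable
  have iY: "integrable M (?Y n)" for n
    by (rule integrable_path_sum[where g = "\<lambda>a. a / sqrt (real n)"])
  then show mY: "?Y n \<in> borel_measurable M" for n by (rule borel_measurable_integrable)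
  show iXY: "integrable M (\<lambda>w. ?X n w - ?Y n w)" for n
  proof (cases "n \<ge> 1")
    case True
    have "integrable M (?X n)"
    proof (rule integrable_const_bound)
      let ?K = "real CARD('d) * r + norm \<theta>s"
      have "norm (?X n w) \<le> norm t * (sqrt (real n) * ?K)" if "w \<in> space M" for w
      proof -
        have "norm (err n w) \<le> ?K" using norm_\<theta>r_le[OF True that] norm_triangle_ineq4[of "\<theta>r n w" \<theta>s] by linarith
        then have K: "norm (sqrt (real n) *\<^sub>R (err n w)) \<le> sqrt (real n) * ?K" by (simp add: mult_left_mono)
        have "norm (?X n w) \<le> norm t * norm (sqrt (real n) *\<^sub>R (err n w))"
          unfolding real_norm_def by (rule Cauchy_Schwarz_ineq2)
        also have "\<dots> \<le> norm t * (sqrt (real n) * ?K)" by (rule mult_left_mono[OF K]) simp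
        finally show ?thesis .
      qed
      then show "AE w in M. norm (?X n w) \<le> norm t * (sqrt (real n) * ?K)" by (intro AE_I2)
    qed (rule mX)
    then show ?thesis using iY by (rule Bochner_Integration.integrable_diff)
  next
    case False
    then have "n = 0" by simp
    then show ?thesis by simp
  qed
  show "(\<lambda>n. expectation (\<lambda>w. iexp (?Y n w))) \<longlonglongrightarrow> complex_of_real (exp (- (t \<bullet> (\<Sigma>\<theta> *v t)) / 2))"
    using martingale_clt[OF centred_directional[of t]] unfolding directional_variance .
  obtain C2 where moments: "C2 \<ge> 0"
    "\<And>n. n \<ge> 1 \<Longrightarrow> expectation (\<lambda>w. (norm (Ainv *v W n w))\<^sup>2) \<le> C2 / real n"
    "\<And>n. n \<ge> 1 \<Longrightarrow> integrable M (\<lambda>w. (norm (remainder n w))\<^sup>2) \<and> expectation (\<lambda>w. (norm (remainder n w))\<^sup>2) \<le> C2 / (real n)\<^sup>2"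
    using remainder_moments by blast
  note C2 = moments(1,3)
  define hs where "hs z = (\<Sum>i\<in>UNIV. ?s $ i * corrector i z)" for z
  obtain H where H: "H \<ge> 0" "\<And>z. norm (hs z) \<le> H" using finite_family_bound by blast
  have directional_sum: "path_sum (directional t) n a = (\<Sum>i\<in>UNIV. ?s $ i * path_sum (noise i) n a) + hs (a n) - hs (a 0)" for n a
  proof -
    have "directional t = (\<lambda>z z'. (\<Sum>i\<in>UNIV. ?s $ i * noise i z z') + hs z' - hs z)"
      by (simp add: fun_eq_iff directional_def martingale_part_def hs_def algebra_simps sum.distrib sum_subtractf)
    then have "path_sum (directional t) n a = path_sum (\<lambda>z z'. \<Sum>i\<in>UNIV. ?s $ i * noise i z z') n a + hs (a n) - hs (a 0)"
      by (simp add: path_sum_coboundary)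
    also have "path_sum (\<lambda>z z'. \<Sum>i\<in>UNIV. ?s $ i * noise i z z') n a = (\<Sum>i\<in>UNIV. ?s $ i * path_sum (noise i) n a)"
      unfolding path_sum_def sum_distrib_left by (rule sum.swap)
    finally show ?thesis .
  qed
  have XY: "\<bar>?X n w - ?Y n w\<bar> \<le> sqrt (real n) * norm t * norm (remainder n w) + 2 * H / sqrt (real n)" if n: "n \<ge> 1" for n w
  proof -
    have "?X n w = sqrt (real n) * (t \<bullet> (Ainv *v W n w)) + sqrt (real n) * (t \<bullet> remainder n w)"
      by (simp add: remainder_def inner_diff_right algebra_simps)
    also have "sqrt (real n) * (t \<bullet> (Ainv *v W n w)) = (\<Sum>i\<in>UNIV. ?s $ i * path_sum (noise i) n (path w)) / sqrt (real n)"
    proof -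
      have "t \<bullet> (Ainv *v W n w) = (\<Sum>i\<in>UNIV. ?s $ i * path_sum (noise i) n (path w)) / real n"
        unfolding inner_Ainv by (simp add: inner_vec_def W_avg_path_sum sum_divide_distrib)
      then show ?thesis by (simp only: sqrt_times_divide)
    qed
    finally have "?X n w - ?Y n w = sqrt (real n) * (t \<bullet> remainder n w) - (hs (Z n w) - hs (Z 0 w)) / sqrt (real n)"
      by (simp add: directional_sum diff_divide_distrib add_divide_distrib)
    moreover have "\<bar>sqrt (real n) * (t \<bullet> remainder n w)\<bar> \<le> sqrt (real n) * norm t * norm (remainder n w)"
      using Cauchy_Schwarz_ineq2[of t "remainder n w"] by (simp add: abs_mult mult_left_mono mult.assoc)
    moreover have "\<bar>(hs (Z n w) - hs (Z 0 w)) / sqrt (real n)\<bar> \<le> 2 * H / sqrt (real n)"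
      unfolding abs_divide using H(2)[of "Z n w"] H(2)[of "Z 0 w"] by (simp add: divide_right_mono)
    ultimately show ?thesis by linarith
  qed
  define K where "K = norm t * (C2 + 1) / 2 + 2 * H"
  show "(\<lambda>n. expectation (\<lambda>w. \<bar>?X n w - ?Y n w\<bar>)) \<longlonglongrightarrow> 0"
  proof (rule Lim_null_comparison)
    show "(\<lambda>n. K / sqrt (real n)) \<longlonglongrightarrow> 0" by real_asymp
    have "norm (expectation (\<lambda>w. \<bar>?X n w - ?Y n w\<bar>)) \<le> K / sqrt (real n)" if n: "n \<ge> 1" for n
    proof -
      define U where "U w = sqrt (real n) * norm t * ((real n * (norm (remainder n w))\<^sup>2 + 1 / real n) / 2) + 2 * H / sqrt (real n)" for w
      have iU: "integrable M U" unfolding U_def using C2(2)[OF n] by simp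
      have "\<bar>?X n w - ?Y n w\<bar> \<le> U w" for w
      proof -
        have "norm (remainder n w) \<le> (real n * (norm (remainder n w))\<^sup>2 + 1 / real n) / 2"
          using zero_le_power2[of "real n * norm (remainder n w) - 1"] n
          by (simp add: power2_diff field_simps power2_eq_square)
        then show ?thesis using XY[OF n, of w] mult_left_mono[of _ _ "sqrt (real n) * norm t"]
          unfolding U_def by (smt (verit) mult_nonneg_nonneg norm_ge_zero real_sqrt_ge_zero of_nat_0_le_iff)
      qed
      then have "expectation (\<lambda>w. \<bar>?X n w - ?Y n w\<bar>) \<le> expectation U"
        using iXY[of n] iU by (intro integral_mono) auto
      also have "expectation U = sqrt (real n) * norm t * ((real n * expectation (\<lambda>w. (norm (remainder n w))\<^sup>2) + 1 / real n) / 2) + 2 * H / sqrt (real n)"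
        unfolding U_def using C2(2)[OF n] by (simp add: prob_space)
      also have "\<dots> \<le> sqrt (real n) * norm t * ((real n * (C2 / (real n)\<^sup>2) + 1 / real n) / 2) + 2 * H / sqrt (real n)"
        using C2(2)[OF n] by (intro add_right_mono mult_left_mono divide_right_mono) auto
      also have "\<dots> = K / sqrt (real n)"
      proof -
        have "sqrt (real n) * norm t * ((real n * (C2 / (real n)\<^sup>2) + 1 / real n) / 2)
            = sqrt (real n) * (norm t * (C2 + 1) / 2 / real n)"
          using n by (simp add: field_simps power2_eq_square)
        then show ?thesis unfolding sqrt_times_divide K_def by (simp add: add_divide_distrib)
      qed
      finally have "expectation (\<lambda>w. \<bar>?X n w - ?Y n w\<bar>) \<le> K / sqrt (real n)" .
      moreover have "0 \<le> expectation (\<lambda>w. \<bar>?X n w - ?Y n w\<bar>)" by (rule Bochner_Integration.integral_nonneg) simp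
      ultimately show ?thesis by simp
    qed
    then show "eventually (\<lambda>n. norm (expectation (\<lambda>w. \<bar>?X n w - ?Y n w\<bar>)) \<le> K / sqrt (real n)) sequentially"
      using eventually_ge_at_top[of 1] by (rule eventually_mono[rotated])
  qed
qed

lemma scaled_error_tight:
  assumes "\<epsilon> > 0"
  shows "\<exists>R. \<forall>n\<ge>1. prob {w \<in> space M. norm (sqrt (real n) *\<^sub>R (err n w)) > R} \<le> \<epsilon>"
proof -
  obtain C where C: "C \<ge> 0"
    "\<And>n. n \<ge> 1 \<Longrightarrow> expectation (\<lambda>w. (norm (Ainv *v W n w))\<^sup>2) \<le> C / real n"
    "\<And>n. n \<ge> 1 \<Longrightarrow> integrable M (\<lambda>w. (norm (remainder n w))\<^sup>2) \<and> expectation (\<lambda>w. (norm (remainder n w))\<^sup>2) \<le> C / (real n)\<^sup>2"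
    using remainder_moments by blast
  define R where "R = 1 + 4 * C / \<epsilon>"
  have R: "R \<ge> 1" "4 * C / \<epsilon> \<le> R\<^sup>2"
  proof -
    show "R \<ge> 1" using C(1) assms by (simp add: R_def)
    then have "R \<le> R\<^sup>2" by (simp add: power2_eq_square)
    then show "4 * C / \<epsilon> \<le> R\<^sup>2" by (simp add: R_def)
  qed
  have "prob {w \<in> space M. norm (sqrt (real n) *\<^sub>R (err n w)) > R} \<le> \<epsilon>" if n: "n \<ge> 1" for n
  proof -
    define X where "X w = real n * (2 * (norm (Ainv *v W n w))\<^sup>2 + 2 * (norm (remainder n w))\<^sup>2)" for w
    have iW: "integrable M (\<lambda>w. (norm (Ainv *v W n w))\<^sup>2)"
      by (rule integrable_Ainv_W)
    have iX: "integrable M X" unfolding X_def using iW C(3)[OF n] by simp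
    have X: "(norm (sqrt (real n) *\<^sub>R (err n w)))\<^sup>2 \<le> X w" for w
    proof -
      have "(norm (err n w))\<^sup>2 \<le> 2 * (norm (Ainv *v W n w))\<^sup>2 + 2 * (norm (remainder n w))\<^sup>2"
        using power2_norm_add_le[of "Ainv *v W n w" "remainder n w"] by (simp add: remainder_def)
      from mult_left_mono[OF this, of "real n"] show ?thesis by (simp add: X_def power_mult_distrib)
    qed
    have [measurable]: "X \<in> borel_measurable M" using iX by (rule borel_measurable_integrable)
    have "{w \<in> space M. norm (sqrt (real n) *\<^sub>R (err n w)) > R} \<subseteq> {w \<in> space M. R\<^sup>2 \<le> X w}"
    proof safe
      fix w assume "norm (sqrt (real n) *\<^sub>R (err n w)) > R"
      then have "R\<^sup>2 \<le> (norm (sqrt (real n) *\<^sub>R (err n w)))\<^sup>2" using R(1) by (intro power_mono) auto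
      then show "R\<^sup>2 \<le> X w" using X[of w] by linarith
    qed
    then have "prob {w \<in> space M. norm (sqrt (real n) *\<^sub>R (err n w)) > R} \<le> prob {w \<in> space M. R\<^sup>2 \<le> X w}"
      by (intro finite_measure_mono) measurable
    also have "\<dots> \<le> expectation X / R\<^sup>2"
      by (rule probability_markov_inequality[OF iX]) (use R(1) in \<open>auto simp: X_def\<close>)
    also have "\<dots> \<le> (4 * C) / R\<^sup>2"
    proof (rule divide_right_mono)
      have "expectation X = real n * (2 * expectation (\<lambda>w. (norm (Ainv *v W n w))\<^sup>2) + 2 * expectation (\<lambda>w. (norm (remainder n w))\<^sup>2))"
        unfolding X_def using iW C(3)[OF n] by simp
      also have "\<dots> \<le> real n * (2 * (C / real n) + 2 * (C / (real n)\<^sup>2))"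
        using C(2,3)[OF n] by (intro mult_left_mono add_mono) auto
      also have "\<dots> = 2 * C + 2 * (C / real n)" using n by (simp add: field_simps power2_eq_square)
      also have "\<dots> \<le> 4 * C" using n C(1) by (simp add: divide_le_eq mult_le_cancel_left1)
      finally show "expectation X \<le> 4 * C" .
    qed simp
    also have "\<dots> \<le> \<epsilon>" using R assms by (simp add: field_simps)
    finally show ?thesis .
  qed
  then show ?thesis by blast
qed

text \<open>The covariance matrix is the stationary mean of outer products of transformed martingale increments, a
  finite sum over pairs of states; each pair contributes one Gaussian direction, scaled by the square
  root of its stationary probability.\<close>

lemma asymptotic_normality:
  obtains \<nu> where "centred_normal \<nu> \<Sigma>\<theta>"
    "converges_in_distribution M (\<lambda>n w. sqrt (real n) *\<^sub>R (err n w)) \<nu>"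
proof -
  define b where "b = (\<lambda>(z, z'). sqrt (pmf \<pi> z * pmf (closed_loop P pol z) z') *\<^sub>R (Ainv *v (\<chi> i. martingale_part i z z')))"
  obtain \<nu> :: "(real^'d) measure" where \<nu>: "prob_space \<nu>" "sets \<nu> = sets borel"
    "\<And>t. (CLINT x|\<nu>. iexp (t \<bullet> x)) = complex_of_real (exp (- (\<Sum>e\<in>UNIV. (t \<bullet> b e)\<^sup>2) / 2))"
    using gaussian_combination[of b] by blast
  have var: "(\<Sum>e\<in>UNIV. (t \<bullet> b e)\<^sup>2) = t \<bullet> (\<Sigma>\<theta> *v t)" for t
  proof -
    have "(t \<bullet> b (z, z'))\<^sup>2 = pmf \<pi> z * (pmf (closed_loop P pol z) z' * (directional t z z' * directional t z z'))" for z z'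
      by (simp add: b_def directional_eq power_mult_distrib) (simp add: power2_eq_square)
    then have "(\<Sum>e\<in>UNIV. (t \<bullet> b e)\<^sup>2) = stationary_mean (\<lambda>z z'. directional t z z' * directional t z z')"
      unfolding stationary_mean_def mean_def UNIV_Times_UNIV[symmetric] sum.cartesian_product'
      by (simp add: sum_distrib_left)
    then show ?thesis by (simp add: directional_variance)
  qed
  have "centred_normal \<nu> \<Sigma>\<theta>" using \<nu> by (simp add: centred_normal_def var)
  moreover have "converges_in_distribution M (\<lambda>n w. sqrt (real n) *\<^sub>R (err n w)) \<nu>"
  proof (rule convergence_of_characteristic_functions[OF prob_space_axioms _ \<nu>(1,2)])
    show "(\<lambda>w. sqrt (real n) *\<^sub>R (err n w)) \<in> borel_measurable M" for n by measurable
    show "(\<lambda>n. CLINT w|M. iexp (t \<bullet> (sqrt (real n) *\<^sub>R (err n w)))) \<longlonglongrightarrow> (CLINT x|\<nu>. iexp (t \<bullet> x))" for t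
      unfolding \<nu>(3) var by (rule characteristic_function_limit)
  qed (rule scaled_error_tight)
  ultimately show ?thesis by (rule that)
qed

end

theorem proposition4p2:
  fixes M :: "'w measure"
    and P :: "'u::finite \<Rightarrow> 'x::finite \<Rightarrow> 'x pmf"
    and pol :: "'x \<Rightarrow> 'u pmf"
    and Z :: "nat \<Rightarrow> 'w \<Rightarrow> 'x \<times> 'u"
    and \<pi> \<mu> :: "('x \<times> 'u) pmf"
    and c :: "'x \<times> 'u \<Rightarrow> real"
    and \<gamma> r :: real
    and \<psi> :: "'x \<times> 'u \<Rightarrow> real^'d"
    and \<zeta> :: "'x \<times> 'u \<Rightarrow> real^'p"
    and \<theta>s :: "real^'d"
    and \<phi>s :: "'x \<Rightarrow> 'u"
    and j :: "'d \<Rightarrow> 'p"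
    and \<theta> \<theta>r :: "nat \<Rightarrow> 'w \<Rightarrow> real^'d"
  assumes "prob_space M"
    and "markov_chain M (closed_loop P pol) Z"
    and "unichain (closed_loop P pol)"
    and "aperiodic (closed_loop P pol)"
    and "invariant_pmf (closed_loop P pol) \<pi>"
    and "\<And>z. 0 \<le> c z"
    and "0 < \<gamma>" and "\<gamma> < 1"
    and "CARD('d) < CARD('p)"
    and "\<And>z i. 0 \<le> \<zeta> z $ i"
    \<comment> \<open>unique optimizer of the limiting linear program\<close>
    and "lp_optimizer (objective \<mu> \<psi>) (lim_feasible P \<pi> c \<gamma> \<psi> \<zeta>) \<theta>s"
    and "\<And>\<theta>'. lp_optimizer (objective \<mu> \<psi>) (lim_feasible P \<pi> c \<gamma> \<psi> \<zeta>) \<theta>' \<Longrightarrow> \<theta>' = \<theta>s"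
    and "greedy \<psi> \<theta>s \<phi>s"
    and "basic_solution P \<pi> c \<gamma> \<psi> \<zeta> \<theta>s \<phi>s j"
    \<comment> \<open>the estimates\<close>
    and "\<And>N. \<theta> N \<in> borel_measurable M"
    and "\<And>N w. 0 < N \<Longrightarrow> w \<in> space M \<Longrightarrow>
           \<not> lp_infeasible_or_unbounded (objective \<mu> \<psi>) (emp_feasible Z c \<gamma> \<psi> \<zeta> N w) \<Longrightarrow>
           lp_optimizer (objective \<mu> \<psi>) (emp_feasible Z c \<gamma> \<psi> \<zeta> N w) (\<theta> N w)"
    and "0 < r" and "\<And>i. \<bar>\<theta>s $ i\<bar> < r"
    and "\<And>N. \<theta>r N \<in> borel_measurable M"
    and "\<And>N w. 0 < N \<Longrightarrow> w \<in> space M \<Longrightarrow>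
           (if lp_infeasible_or_unbounded (objective \<mu> \<psi>) (emp_feasible Z c \<gamma> \<psi> \<zeta> N w)
            then \<theta>r N w = 0
            else Linf_projection (box_r r) (\<theta> N w) (\<theta>r N w))"
  shows "(AE w in M. (\<lambda>N. \<theta>r N w) \<longlonglongrightarrow> \<theta>s \<and> (\<lambda>N. \<theta> N w) \<longlonglongrightarrow> \<theta>s) \<and>
    invertible (A_bar P \<pi> \<gamma> \<psi> \<zeta> \<phi>s j) \<and>
    (\<exists>\<Sigma>\<theta> \<Sigma>W \<nu>.
       (\<lambda>N. real N *\<^sub>R integral\<^sup>L M (\<lambda>w.
          outer_prod (W_avg P \<pi> Z c \<gamma> \<psi> \<zeta> \<theta>s \<phi>s j N w) (W_avg P \<pi> Z c \<gamma> \<psi> \<zeta> \<theta>s \<phi>s j N w)))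
         \<longlonglongrightarrow> \<Sigma>W \<and>
       \<Sigma>\<theta> = matrix_inv (A_bar P \<pi> \<gamma> \<psi> \<zeta> \<phi>s j) ** \<Sigma>W ** transpose (matrix_inv (A_bar P \<pi> \<gamma> \<psi> \<zeta> \<phi>s j)) \<and>
       (\<lambda>N. norm (real N *\<^sub>R integral\<^sup>L M (\<lambda>w. outer_prod (\<theta>r N w - \<theta>s) (\<theta>r N w - \<theta>s)) - \<Sigma>\<theta>))
         \<in> O(\<lambda>N. 1 / sqrt (real N)) \<and>
       centred_normal \<nu> \<Sigma>\<theta> \<and>
       converges_in_distribution M (\<lambda>N w. sqrt (real N) *\<^sub>R (\<theta>r N w - \<theta>s)) \<nu>)"
proof -
  have chain: "unichain_process M (closed_loop P pol) Z \<pi>"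
    using assms(1-3,5) by (intro unichain_process.intro unichain_process_axioms.intro)
  have lp: "projected_bellman_lp P \<pi> \<mu> c \<gamma> \<psi> \<zeta> \<theta>s \<phi>s j"
    by (rule projected_bellman_lp.intro) (fact assms)+
  interpret estimated_lp M P pol Z \<pi> \<mu> c \<gamma> \<psi> \<zeta> \<theta>s \<phi>s j \<theta> \<theta>r r
    by (intro estimated_lp.intro sampled_lp.intro estimated_lp_axioms.intro chain lp) (fact assms)+
  obtain \<nu> where normal: "centred_normal \<nu> \<Sigma>\<theta>"
    "converges_in_distribution M (\<lambda>n w. sqrt (real n) *\<^sub>R (\<theta>r n w - \<theta>s)) \<nu>"
    using asymptotic_normality by blast
  show ?thesis
  proof (intro conjI exI)
    show "AE w in M. (\<lambda>N. \<theta>r N w) \<longlonglongrightarrow> \<theta>s \<and> (\<lambda>N. \<theta> N w) \<longlonglongrightarrow> \<theta>s"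
      by (rule almost_sure_convergence)
    show "invertible (A_bar P \<pi> \<gamma> \<psi> \<zeta> \<phi>s j)"
      unfolding A_bar_eq by (rule invertible_A_bar)
    show "\<Sigma>\<theta> = matrix_inv (A_bar P \<pi> \<gamma> \<psi> \<zeta> \<phi>s j) ** \<Sigma>W ** transpose (matrix_inv (A_bar P \<pi> \<gamma> \<psi> \<zeta> \<phi>s j))"
      unfolding A_bar_eq \<Sigma>\<theta>_def Ainv_def ..
  qed (fact W_covariance_limit second_moment_rate normal)+
qed

end
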